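(* Let $\nu\ge3$, $\beta>0$, $H=-\Delta/2$ on $L^2(\mathbb{R}^\nu)$, and let $\overline\rho:(0,+\infty)\to\mathbb{R}$ satisfy $\overline\rho(h)>\rho_c(\beta h)$ for all $h>0$ and $$\lim_{h\to0^+}h\big(\overline\rho(h)-\rho_c(\beta h)\big)=\alpha$$ with $\alpha\in[0,+\infty)$. For $h>0$ let $\omega_h^{\overline\rho(h),0}$ be the state on $\mathcal{W}(\mathcal{S}(\mathbb{R}^\nu),h\sigma)$ given by $$\omega_h^{\overline\rho(h),0}(W^h(f))=\exp\Big\{-\frac h4\Big(\langle f,(I+e^{-\beta hH})(I-e^{-\beta hH})^{-1}f\rangle+2^{\nu+1}(\overline\rho(h)-\rho_c(\beta h))\Big|\int_{\mathbb{R}^\nu}f(x)\,d^\nu x\Big|^2\Big)\Big\}.$$ Then, as $h\to0^+$, these states converge to the classical state $\omega_0^{\alpha,0}$ on $\mathcal{W}(\mathcal{S}(\mathbb{R}^\nu),0)$ given by $$\omega_0^{\alpha,0}(W^0(f))=\exp\Big\{-\frac12\Big(\langle f,(\beta H)^{-1}f\rangle+2^\nu\alpha\Big|\int_{\mathbb{R}^\nu}f(x)\,d^\nu x\Big|^2\Big)\Big\},\qquad f\in\mathcal{S}(\mathbb{R}^\nu),$$ in the sense that $\omega_h^{\overline\rho(h),0}\circ Q_h(c)\to\omega_0^{\alpha,0}(c)$ for all $c\in\mathcal{W}(\mathcal{S}(\mathbb{R}^\nu),0)$. The limit states $\omega_0^{\alpha,0}$ are labeled by the parameter $\alpha\ge0$,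 and all of them satisfy the $(\delta_0^0,\beta)$-weak KMS condition, where $\delta_0^0(W^0(f))=i\Phi_0(iHf)W^0(f)$ for $f\in\mathcal{S}(\mathbb{R}^\nu)$.
   Context: Inner products are linear in the second argument; $\langle\cdot,\cdot\rangle$ is that of $L^2(\mathbb{R}^\nu)$, $\sigma=\operatorname{Im}\langle\cdot,\cdot\rangle$, and $\mathcal{S}(\mathbb{R}^\nu)$ (complex Schwartz functions) carries the $L^2$ norm. The critical density is $\rho_c(\beta h)=\int_{\mathbb{R}^\nu}\frac{d^\nu p}{(2\pi)^\nu}e^{-\beta hp^2/2}(1-e^{-\beta hp^2/2})^{-1}$. Quadratic forms of functions of $H$ are defined by Fourier transform, e.g. $\langle f,(\beta H)^{-1}f\rangle=\int\frac{d^\nu p}{(2\pi)^\nu}\frac{2}{\beta p^2}|\hat f(p)|^2$ with $\hat f(p)=\int e^{-ip\cdot x}f(x)\,d^\nu x$. (Background: $\omega_h^{\overline\rho(h),0}$ is an equilibrium (KMS) state at inverse temperature $\beta h$ of the dynamics $W^h(f)\mapsto W^h(e^{iHt}f)$.) For $E=\mathcal{S}(\mathbb{R}^\nu)$ and $h\ge0$, $\Delta(E,h\sigma)$ is the unital $*$-algebra with linear basis $\{W^h(f):f\in E\}$ and relations $W^h(f)W^h(g)=e^{-\frac i2h\sigma(f,g)}W^h(f+g)$, $W^h(f)^*=W^h(-f)$, $W^h(0)=I$; $\mathcal{W}(E,h\sigma)$ is its completion in the maximal $C^*$-norm $\|A\|_h=\sup_\omega\omega(A^*A)^{1/2}$ over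 all states. $Q_h:\mathcal{W}(E,0)\to\mathcal{W}(E,h\sigma)$ is the continuous positive linear map with $Q_h(W^0(f))=e^{-\frac h4\|f\|^2}W^h(f)$. For $h=0$, $W^0(f)$ is identified with the function $g\mapsto e^{i\operatorname{Re}\langle f,g\rangle}$ on $L^2(\mathbb{R}^\nu)$, and $\Phi_0(f)[g]=\operatorname{Re}\langle f,g\rangle$. Poisson bracket on $\Delta(E,0)$: bilinear with $\{W^0(f),W^0(g)\}=\sigma(g,f)W^0(f+g)$. A state $\omega$ on $\mathcal{W}(E,0)$ with GNS triple $(\mathcal{H}_\omega,\pi_\omega,\Omega_\omega)$ is of class $C^2$ if $t\mapsto\pi_\omega(W^0(tf))$ is strongly continuous for every $f\in E$ and $\Omega_\omega$ lies in the domain of its self-adjoint generator $\Phi_\omega(f)$ for every $f\in E$; then $\omega(\Phi_0(f)W^0(g)):=-i\frac{d}{dt}\omega(W^0(g+tf))|_{t=0}$. The $(\delta_0^0,\beta)$-weak KMS condition: $\omega$ is of class $C^2$ and $\omega(\{a,b\})=\beta\,\omega(b\,\delta_0^0(a))$ for all $a,b\in\Delta(E,0)$, with $\delta_0^0$ extended linearly. *)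

theory Defs
  imports
    "HOL-Analysis.Analysis"
    "HOL-Algebra.Module"
    "HOL-Library.Function_Algebras"
    "HOL-Library.Poly_Mapping"
begin

section \<open>Schwartz functions and the one-particle Hamiltonian\<close>

definition partial_deriv :: "'n::finite \<Rightarrow> (real^'n \<Rightarrow> complex) \<Rightarrow> real^'n \<Rightarrow> complex" where
  "partial_deriv i f x = vector_derivative (\<lambda>t. f (x + t *\<^sub>R axis i 1)) (at 0)"

definition iter_partial_deriv :: "'n::finite list \<Rightarrow> (real^'n \<Rightarrow> complex) \<Rightarrow> real^'n \<Rightarrow> complex" where
  "iter_partial_deriv is f = foldr partial_deriv is f"

definition schwartz :: "(real^'n::finite \<Rightarrow> complex) set" where
  "schwartz = {f. \<forall>is. (\<forall>x. iter_partial_deriv is f differentiable (at x)) \<and>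
     (\<forall>k::nat. bounded ((\<lambda>x. norm x ^ k *\<^sub>R iter_partial_deriv is f x) ` UNIV))}"

definition l2_inner :: "(real^'n::finite \<Rightarrow> complex) \<Rightarrow> (real^'n \<Rightarrow> complex) \<Rightarrow> complex" where
  "l2_inner f g = (LINT x|lborel. cnj (f x) * g x)"

definition l2_norm :: "(real^'n::finite \<Rightarrow> complex) \<Rightarrow> real" where
  "l2_norm f = sqrt (LINT x|lborel. (cmod (f x))\<^sup>2)"

definition symp_form :: "(real^'n::finite \<Rightarrow> complex) \<Rightarrow> (real^'n \<Rightarrow> complex) \<Rightarrow> real" where
  "symp_form f g = Im (l2_inner f g)"

text \<open>\<open>H = - \<Delta> / 2\<close>, needed only on Schwartz functions.\<close>

definition hamiltonian :: "(real^'n::finite \<Rightarrow> complex) \<Rightarrow> real^'n \<Rightarrow> complex" where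
  "hamiltonian f x = - (\<Sum>i\<in>UNIV. partial_deriv i (partial_deriv i f) x) / 2"

definition fourier :: "(real^'n::finite \<Rightarrow> complex) \<Rightarrow> real^'n \<Rightarrow> complex" where
  "fourier f p = (LINT x|lborel. exp (- \<i> * complex_of_real (p \<bullet> x)) * f x)"

text \<open>The quadratic form \<open>\<langle>f, F(H) f\<rangle>\<close>; in Fourier space \<open>H\<close> is multiplication by \<open>p\<^sup>2 / 2\<close>.
  (The value at \<open>p = 0\<close>, where \<open>F\<close> may be singular, does not matter.)\<close>

definition form_of_H :: "(real \<Rightarrow> real) \<Rightarrow> (real^'n::finite \<Rightarrow> complex) \<Rightarrow> real" where
  "form_of_H F f = (LINT p|lborel. F (p \<bullet> p / 2) * (cmod (fourier f p))\<^sup>2 / (2 * pi) ^ CARD('n))"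

definition critical_density :: "'n::finite itself \<Rightarrow> real \<Rightarrow> real" where
  "critical_density _ s =
     (LINT p::(real^'n)|lborel.
        exp (- s * (p \<bullet> p) / 2) * inverse (1 - exp (- s * (p \<bullet> p) / 2)) / (2 * pi) ^ CARD('n))"


section \<open>Unital *-algebras, states, maximal norm\<close>

record 'a star_algebra = "(complex, 'a) module" +
  star :: "'a \<Rightarrow> 'a"

record 'a normed_star_algebra = "'a star_algebra" +
  anorm :: "'a \<Rightarrow> real"

definition is_state :: "('a, 'm) star_algebra_scheme \<Rightarrow> ('a \<Rightarrow> complex) \<Rightarrow> bool" where
  "is_state A \<omega> \<longleftrightarrow>
     (\<forall>a\<in>carrier A. \<forall>b\<in>carrier A. \<omega> (a \<oplus>\<^bsub>A\<^esub> b) = \<omega> a + \<omega> b) \<and>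
     (\<forall>c. \<forall>a\<in>carrier A. \<omega> (c \<odot>\<^bsub>A\<^esub> a) = c * \<omega> a) \<and>
     (\<forall>a\<in>carrier A. \<omega> (star A a \<otimes>\<^bsub>A\<^esub> a) \<in> \<real>\<^sub>\<ge>\<^sub>0) \<and>
     \<omega> \<one>\<^bsub>A\<^esub> = 1"

definition max_norm :: "('a, 'm) star_algebra_scheme \<Rightarrow> 'a \<Rightarrow> real" where
  "max_norm A a = (SUP \<omega>\<in>{\<omega>. is_state A \<omega>}. sqrt (Re (\<omega> (star A a \<otimes>\<^bsub>A\<^esub> a))))"

text \<open>A state of a \<open>C\<^sup>*\<close>-algebra is a positive linear functional of norm one.\<close>

definition is_cstar_state :: "('a, 'm) normed_star_algebra_scheme \<Rightarrow> ('a \<Rightarrow> complex) \<Rightarrow> bool" where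
  "is_cstar_state A \<omega> \<longleftrightarrow> is_state A \<omega> \<and> (\<forall>a\<in>carrier A. cmod (\<omega> a) \<le> anorm A a)"

definition alg_positive ::
  "('a, 'm) star_algebra_scheme \<Rightarrow> ('b, 'k) star_algebra_scheme \<Rightarrow> ('a \<Rightarrow> 'b) \<Rightarrow> bool" where
  "alg_positive A B Q \<longleftrightarrow>
     (\<forall>a\<in>carrier A. \<exists>b\<in>carrier B. Q (star A a \<otimes>\<^bsub>A\<^esub> a) = star B b \<otimes>\<^bsub>B\<^esub> b)"

definition alg_linear ::
  "('a, 'm) star_algebra_scheme \<Rightarrow> ('b, 'k) star_algebra_scheme \<Rightarrow> ('a \<Rightarrow> 'b) \<Rightarrow> bool" where
  "alg_linear A B Q \<longleftrightarrow>
     (\<forall>a\<in>carrier A. Q a \<in> carrier B) \<and>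
     (\<forall>a\<in>carrier A. \<forall>b\<in>carrier A. Q (a \<oplus>\<^bsub>A\<^esub> b) = Q a \<oplus>\<^bsub>B\<^esub> Q b) \<and>
     (\<forall>c. \<forall>a\<in>carrier A. Q (c \<odot>\<^bsub>A\<^esub> a) = c \<odot>\<^bsub>B\<^esub> Q a)"

definition alg_continuous ::
  "('a, 'm) normed_star_algebra_scheme \<Rightarrow> ('b, 'k) normed_star_algebra_scheme \<Rightarrow> ('a \<Rightarrow> 'b) \<Rightarrow> bool" where
  "alg_continuous A B Q \<longleftrightarrow> (\<exists>C. \<forall>a\<in>carrier A. anorm B (Q a) \<le> C * anorm A a)"


section \<open>Completion with respect to a seminorm\<close>

text \<open>
  The (Hausdorff) completion of the vector space underlying \<open>A\<close> with respect to a seminorm \<open>N\<close>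
  consists of the Cauchy sequences modulo the null sequences. It is used both for the
  \<open>C\<^sup>*\<close>-completion and for the Hilbert space of the GNS construction.
\<close>

definition alg_diff :: "('a, 'm) star_algebra_scheme \<Rightarrow> 'a \<Rightarrow> 'a \<Rightarrow> 'a" where
  "alg_diff A x y = x \<oplus>\<^bsub>A\<^esub> ((-1) \<odot>\<^bsub>A\<^esub> y)"

definition cauchy_seqs :: "('a, 'm) star_algebra_scheme \<Rightarrow> ('a \<Rightarrow> real) \<Rightarrow> (nat \<Rightarrow> 'a) set" where
  "cauchy_seqs A N = {x. (\<forall>n. x n \<in> carrier A) \<and>
     (\<forall>e>0. \<exists>M. \<forall>m\<ge>M. \<forall>n\<ge>M. N (alg_diff A (x m) (x n)) < e)}"

definition cauchy_rel ::
  "('a, 'm) star_algebra_scheme \<Rightarrow> ('a \<Rightarrow> real) \<Rightarrow> ((nat \<Rightarrow> 'a) \<times> (nat \<Rightarrow> 'a)) set" where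
  "cauchy_rel A N = {(x, y). x \<in> cauchy_seqs A N \<and> y \<in> cauchy_seqs A N \<and>
     (\<lambda>n. N (alg_diff A (x n) (y n))) \<longlonglongrightarrow> 0}"

definition cauchy_class ::
  "('a, 'm) star_algebra_scheme \<Rightarrow> ('a \<Rightarrow> real) \<Rightarrow> (nat \<Rightarrow> 'a) \<Rightarrow> (nat \<Rightarrow> 'a) set" where
  "cauchy_class A N x = cauchy_rel A N `` {x}"

definition compl_carrier ::
  "('a, 'm) star_algebra_scheme \<Rightarrow> ('a \<Rightarrow> real) \<Rightarrow> (nat \<Rightarrow> 'a) set set" where
  "compl_carrier A N = cauchy_seqs A N // cauchy_rel A N"

definition compl_embed ::
  "('a, 'm) star_algebra_scheme \<Rightarrow> ('a \<Rightarrow> real) \<Rightarrow> 'a \<Rightarrow> (nat \<Rightarrow> 'a) set" where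
  "compl_embed A N a = cauchy_class A N (\<lambda>_. a)"

definition compl_lift ::
  "('a, 'm) star_algebra_scheme \<Rightarrow> ('a \<Rightarrow> real) \<Rightarrow> ('a \<Rightarrow> 'a) \<Rightarrow> (nat \<Rightarrow> 'a) set \<Rightarrow> (nat \<Rightarrow> 'a) set" where
  "compl_lift A N T X = (\<Union>x\<in>X. cauchy_class A N (\<lambda>n. T (x n)))"

definition compl_lift2 ::
  "('a, 'm) star_algebra_scheme \<Rightarrow> ('a \<Rightarrow> real) \<Rightarrow> ('a \<Rightarrow> 'a \<Rightarrow> 'a) \<Rightarrow>
     (nat \<Rightarrow> 'a) set \<Rightarrow> (nat \<Rightarrow> 'a) set \<Rightarrow> (nat \<Rightarrow> 'a) set" where
  "compl_lift2 A N T X Y = (\<Union>x\<in>X. \<Union>y\<in>Y. cauchy_class A N (\<lambda>n. T (x n) (y n)))"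

definition compl_norm ::
  "('a \<Rightarrow> real) \<Rightarrow> (nat \<Rightarrow> 'a) set \<Rightarrow> real" where
  "compl_norm N X = (THE r. \<forall>x\<in>X. (\<lambda>n. N (x n)) \<longlonglongrightarrow> r)"

definition cstar_completion ::
  "('a, 'm) star_algebra_scheme \<Rightarrow> (nat \<Rightarrow> 'a) set normed_star_algebra" where
  "cstar_completion A = (let N = max_norm A in
     \<lparr> carrier = compl_carrier A N,
       mult = compl_lift2 A N (mult A),
       one = compl_embed A N \<one>\<^bsub>A\<^esub>,
       zero = compl_embed A N \<zero>\<^bsub>A\<^esub>,
       add = compl_lift2 A N (add A),
       smult = (\<lambda>c. compl_lift A N (smult A c)),
       star = compl_lift A N (star A),
       anorm = compl_norm N \<rparr>)"


section \<open>Weyl algebras over Schwartz space\<close>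

text \<open>
  The finitely supported function \<open>a\<close> stands for the linear combination of the generators
  \<open>W\<^sup>h(f)\<close> with coefficients \<open>lookup a f\<close>.
\<close>

type_synonym 'n weyl_poly = "(real^'n \<Rightarrow> complex) \<Rightarrow>\<^sub>0 complex"
type_synonym 'n weyl_elem = "(nat \<Rightarrow> 'n weyl_poly) set"

definition weyl_poly_algebra :: "real \<Rightarrow> 'n::finite weyl_poly star_algebra" where
  "weyl_poly_algebra h =
     \<lparr> carrier = {a. Poly_Mapping.keys a \<subseteq> schwartz},
       mult = (\<lambda>a b. \<Sum>f\<in>Poly_Mapping.keys a. \<Sum>g\<in>Poly_Mapping.keys b.
                 Poly_Mapping.single (f + g)
                   (Poly_Mapping.lookup a f * Poly_Mapping.lookup b g *
                      exp (- \<i> / 2 * complex_of_real (h * symp_form f g)))),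
       one = Poly_Mapping.single 0 1,
       zero = 0,
       add = (+),
       smult = (\<lambda>c. Poly_Mapping.map ((*) c)),
       star = (\<lambda>a. \<Sum>f\<in>Poly_Mapping.keys a.
                 Poly_Mapping.single (- f) (cnj (Poly_Mapping.lookup a f))) \<rparr>"

definition weyl_algebra :: "real \<Rightarrow> 'n::finite weyl_elem normed_star_algebra" where
  "weyl_algebra h = cstar_completion (weyl_poly_algebra h)"

definition weyl_incl :: "real \<Rightarrow> 'n::finite weyl_poly \<Rightarrow> 'n weyl_elem" where
  "weyl_incl h = compl_embed (weyl_poly_algebra h) (max_norm (weyl_poly_algebra h))"

definition weyl :: "real \<Rightarrow> (real^'n::finite \<Rightarrow> complex) \<Rightarrow> 'n weyl_elem" where
  "weyl h f = weyl_incl h (Poly_Mapping.single f 1)"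

definition is_quantization :: "real \<Rightarrow> ('n::finite weyl_elem \<Rightarrow> 'n weyl_elem) \<Rightarrow> bool" where
  "is_quantization h Q \<longleftrightarrow>
     alg_linear (weyl_algebra 0) (weyl_algebra h) Q \<and>
     alg_continuous (weyl_algebra 0) (weyl_algebra h) Q \<and>
     alg_positive (weyl_algebra 0) (weyl_algebra h) Q \<and>
     (\<forall>f\<in>schwartz. Q (weyl 0 f) =
        complex_of_real (exp (- h / 4 * (l2_norm f)\<^sup>2)) \<odot>\<^bsub>weyl_algebra h\<^esub> weyl h f)"


section \<open>GNS representation and states of class \<open>C\<^sup>2\<close>\<close>

text \<open>
  The GNS space of \<open>\<omega>\<close> is the completion of \<open>A\<close> in the seminorm \<open>\<omega>(a\<^sup>*a)\<^sup>1\<^sup>/\<^sup>2\<close>; \<open>A\<close> acts on it by left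
  multiplication and the class of the unit is the cyclic vector.
\<close>

definition gns_seminorm :: "('a, 'm) star_algebra_scheme \<Rightarrow> ('a \<Rightarrow> complex) \<Rightarrow> 'a \<Rightarrow> real" where
  "gns_seminorm A \<omega> a = sqrt (Re (\<omega> (star A a \<otimes>\<^bsub>A\<^esub> a)))"

definition gns_space :: "('a, 'm) star_algebra_scheme \<Rightarrow> ('a \<Rightarrow> complex) \<Rightarrow> (nat \<Rightarrow> 'a) set set" where
  "gns_space A \<omega> = compl_carrier A (gns_seminorm A \<omega>)"

definition gns_sub ::
  "('a, 'm) star_algebra_scheme \<Rightarrow> ('a \<Rightarrow> complex) \<Rightarrow> (nat \<Rightarrow> 'a) set \<Rightarrow> (nat \<Rightarrow> 'a) set \<Rightarrow> (nat \<Rightarrow> 'a) set" where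
  "gns_sub A \<omega> = compl_lift2 A (gns_seminorm A \<omega>) (alg_diff A)"

definition gns_smult ::
  "('a, 'm) star_algebra_scheme \<Rightarrow> ('a \<Rightarrow> complex) \<Rightarrow> complex \<Rightarrow> (nat \<Rightarrow> 'a) set \<Rightarrow> (nat \<Rightarrow> 'a) set" where
  "gns_smult A \<omega> c = compl_lift A (gns_seminorm A \<omega>) (smult A c)"

definition gns_norm ::
  "('a, 'm) star_algebra_scheme \<Rightarrow> ('a \<Rightarrow> complex) \<Rightarrow> (nat \<Rightarrow> 'a) set \<Rightarrow> real" where
  "gns_norm A \<omega> = compl_norm (gns_seminorm A \<omega>)"

definition gns_rep ::
  "('a, 'm) star_algebra_scheme \<Rightarrow> ('a \<Rightarrow> complex) \<Rightarrow> 'a \<Rightarrow> (nat \<Rightarrow> 'a) set \<Rightarrow> (nat \<Rightarrow> 'a) set" where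
  "gns_rep A \<omega> a = compl_lift A (gns_seminorm A \<omega>) (mult A a)"

definition gns_vector :: "('a, 'm) star_algebra_scheme \<Rightarrow> ('a \<Rightarrow> complex) \<Rightarrow> (nat \<Rightarrow> 'a) set" where
  "gns_vector A \<omega> = compl_embed A (gns_seminorm A \<omega>) \<one>\<^bsub>A\<^esub>"

definition strongly_continuous ::
  "('a, 'm) star_algebra_scheme \<Rightarrow> ('a \<Rightarrow> complex) \<Rightarrow> (real \<Rightarrow> 'a) \<Rightarrow> bool" where
  "strongly_continuous A \<omega> u \<longleftrightarrow>
     (\<forall>\<psi>\<in>gns_space A \<omega>. \<forall>s.
        ((\<lambda>t. gns_norm A \<omega> (gns_sub A \<omega> (gns_rep A \<omega> (u t) \<psi>) (gns_rep A \<omega> (u s) \<psi>))) \<longlongrightarrow> 0) (at s))"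

text \<open>
  By Stone's theorem, the domain of the self-adjoint generator \<open>\<Phi>\<close> of \<open>t \<mapsto> \<pi>(u t) = exp(i t \<Phi>)\<close> consists
  of the vectors \<open>\<psi>\<close> for which \<open>(\<pi>(u t) \<psi> - \<psi>) / (i t)\<close> converges (to \<open>\<Phi> \<psi>\<close>) as \<open>t \<rightarrow> 0\<close>.
\<close>

definition generator_domain ::
  "('a, 'm) star_algebra_scheme \<Rightarrow> ('a \<Rightarrow> complex) \<Rightarrow> (real \<Rightarrow> 'a) \<Rightarrow> (nat \<Rightarrow> 'a) set set" where
  "generator_domain A \<omega> u = {\<psi>\<in>gns_space A \<omega>. \<exists>\<eta>\<in>gns_space A \<omega>.
     ((\<lambda>t. gns_norm A \<omega> (gns_sub A \<omega>
         (gns_smult A \<omega> (1 / (\<i> * complex_of_real t)) (gns_sub A \<omega> (gns_rep A \<omega> (u t) \<psi>) \<psi>)) \<eta>))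
       \<longlongrightarrow> 0) (at 0)}"

definition class_C2 :: "('n::finite weyl_elem \<Rightarrow> complex) \<Rightarrow> bool" where
  "class_C2 \<omega> \<longleftrightarrow> (\<forall>f\<in>schwartz.
     strongly_continuous (weyl_algebra 0) \<omega> (\<lambda>t. weyl 0 (\<lambda>x. t *\<^sub>R f x)) \<and>
     gns_vector (weyl_algebra 0) \<omega> \<in>
       generator_domain (weyl_algebra 0) \<omega> (\<lambda>t. weyl 0 (\<lambda>x. t *\<^sub>R f x)))"


section \<open>The classical weak KMS condition\<close>

text \<open>The bilinear extension of \<open>{W\<^sup>0(f), W\<^sup>0(g)} = \<sigma>(g,f) W\<^sup>0(f + g)\<close>.\<close>

definition poisson :: "'n::finite weyl_poly \<Rightarrow> 'n weyl_poly \<Rightarrow> 'n weyl_poly" where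
  "poisson a b = (\<Sum>f\<in>Poly_Mapping.keys a. \<Sum>g\<in>Poly_Mapping.keys b.
     Poly_Mapping.single (f + g)
       (Poly_Mapping.lookup a f * Poly_Mapping.lookup b g * complex_of_real (symp_form g f)))"

text \<open>
  Finite sums of products \<open>\<Phi>\<^sub>0(u) W\<^sup>0(f)\<close> are represented formally by their coefficients at \<open>(u, f)\<close>.
  On them act the pointwise product \<open>W\<^sup>0(g) \<Phi>\<^sub>0(u) W\<^sup>0(f) = \<Phi>\<^sub>0(u) W\<^sup>0(g + f)\<close> and the expectation
  \<open>\<omega>(\<Phi>\<^sub>0(u) W\<^sup>0(f)) = - i d/dt \<omega>(W\<^sup>0(f + t u))\<close> at \<open>t = 0\<close>.
\<close>

type_synonym 'n field_weyl = "((real^'n \<Rightarrow> complex) \<times> (real^'n \<Rightarrow> complex)) \<Rightarrow>\<^sub>0 complex"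

definition delta00 :: "'n::finite weyl_poly \<Rightarrow> 'n field_weyl" where
  "delta00 a = (\<Sum>f\<in>Poly_Mapping.keys a.
     Poly_Mapping.single ((\<lambda>x. \<i> * hamiltonian f x), f) (Poly_Mapping.lookup a f * \<i>))"

definition weyl_times_field :: "'n::finite weyl_poly \<Rightarrow> 'n field_weyl \<Rightarrow> 'n field_weyl" where
  "weyl_times_field b c = (\<Sum>g\<in>Poly_Mapping.keys b. \<Sum>(u, f)\<in>Poly_Mapping.keys c.
     Poly_Mapping.single (u, g + f) (Poly_Mapping.lookup b g * Poly_Mapping.lookup c (u, f)))"

definition field_expectation ::
  "('n::finite weyl_elem \<Rightarrow> complex) \<Rightarrow> 'n field_weyl \<Rightarrow> complex" where
  "field_expectation \<omega> c = (\<Sum>(u, f)\<in>Poly_Mapping.keys c. Poly_Mapping.lookup c (u, f) *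
     (- \<i> * vector_derivative (\<lambda>t. \<omega> (weyl 0 (f + (\<lambda>x. t *\<^sub>R u x)))) (at 0)))"

definition weak_KMS :: "real \<Rightarrow> ('n::finite weyl_elem \<Rightarrow> complex) \<Rightarrow> bool" where
  "weak_KMS \<beta> \<omega> \<longleftrightarrow> class_C2 \<omega> \<and>
     (\<forall>a\<in>carrier (weyl_poly_algebra 0). \<forall>b\<in>carrier (weyl_poly_algebra 0).
        \<omega> (weyl_incl 0 (poisson a b)) =
          complex_of_real \<beta> * field_expectation \<omega> (weyl_times_field b (delta00 a)))"

end

theory Submission
  imports Defs "HOL-Probability.Sinc_Integral" "HOL-Probability.Characteristic_Functions"
begin

text \<open>
  The limit functional \<open>W\<^sup>0(f) \<mapsto> exp (- q(f) / 2)\<close> is positive because the polarization of \<open>q\<close> is an average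
  of Gram kernels, so that its exponential is positive semidefinite by Schur's theorem. It is of class
  \<open>C\<^sup>2\<close> since \<open>t \<mapsto> exp (- t\<^sup>2 q(f) / 2)\<close> is twice differentiable at \<open>0\<close>. The weak KMS condition is the identity
  \<open>q(g, i H f) = - \<sigma>(g, f) / \<beta>\<close>: in Fourier space the factor \<open>p\<^sup>2 / 2\<close> of \<open>H\<close> cancels the one in
  \<open>(\<beta> H)\<^sup>-\<^sup>1\<close>, Plancherel's theorem gives \<open>\<sigma>\<close>, and the condensate term vanishes since \<open>\<integral> H f = 0\<close>.
  For the limit \<open>h \<rightarrow> 0\<close>, dominated convergence with \<open>s coth (s / 2) \<le> s + 2\<close> treats the generators; all the functionals
  \<open>\<omega>\<^sub>h \<circ> Q\<^sub>h\<close> are states, hence contractions for the maximal norm, which extends the convergence to the completion.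
\<close>

section \<open>Completions\<close>

text \<open>The obstacle is that completions come in two layers: \<open>weyl_algebra 0\<close>
  consists of Cauchy classes, and the GNS space of a state on it consists of Cauchy classes of
  those. The locale therefore asks of the seminorm only a pseudometric and a Lipschitz bound, with
  no algebra axioms, and every estimate on a completion is a limit of an estimate on Weyl
  polynomials. At \<open>h = 0\<close> these form a commutative ring: multiplication by
  \<open>W f\<close> is isometric in every state and commutes with all polynomials, which reduces
  strong continuity to the cyclic vector. The quantum algebras with \<open>h > 0\<close> are never
  analysed from inside. \<open>Q h\<close> pulls each state back to the classical polynomials, and
  the only fact proved about those algebras is that the generators lie in the carrier, which comes
  down to the existence of one state. The restriction \<nu> \<ge> 3 enters through the integrability
  of \<open>inverse (p \<bullet> p)\<close> near 0, obtained from products of one-dimensional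
  integrals.\<close>

locale alg_completion =
  fixes A :: "('a, 'm) star_algebra_scheme" (structure) and N :: "'a \<Rightarrow> real"
  assumes dist_refl: "x \<in> carrier A \<Longrightarrow> N (alg_diff A x x) = 0"
    and dist_sym: "\<lbrakk>x \<in> carrier A; y \<in> carrier A\<rbrakk> \<Longrightarrow> N (alg_diff A x y) = N (alg_diff A y x)"
    and dist_triangle: "\<lbrakk>x \<in> carrier A; y \<in> carrier A; z \<in> carrier A\<rbrakk>
          \<Longrightarrow> N (alg_diff A x z) \<le> N (alg_diff A x y) + N (alg_diff A y z)"
    and norm_lipschitz: "\<lbrakk>x \<in> carrier A; y \<in> carrier A\<rbrakk> \<Longrightarrow> \<bar>N x - N y\<bar> \<le> N (alg_diff A x y)"
begin

abbreviation d :: "'a \<Rightarrow> 'a \<Rightarrow> real" where "d x y \<equiv> N (alg_diff A x y)"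
abbreviation CS :: "(nat \<Rightarrow> 'a) set" where "CS \<equiv> cauchy_seqs A N"
abbreviation cls :: "(nat \<Rightarrow> 'a) \<Rightarrow> (nat \<Rightarrow> 'a) set" where "cls \<equiv> cauchy_class A N"

lemma dist_nonneg: "x \<in> carrier A \<Longrightarrow> y \<in> carrier A \<Longrightarrow> 0 \<le> d x y"
  using dist_triangle[of x y x] dist_refl[of x] dist_sym[of x y] by simp

lemma CS_carrier: "x \<in> CS \<Longrightarrow> x n \<in> carrier A"
  by (simp add: cauchy_seqs_def)

lemma CS_I:
  assumes "\<And>n. x n \<in> carrier A"
    and "\<And>e. e > 0 \<Longrightarrow> \<exists>M. \<forall>m\<ge>M. \<forall>n\<ge>M. d (x m) (x n) < e"
  shows "x \<in> CS"
  using assms by (simp add: cauchy_seqs_def)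

lemma CS_D: "x \<in> CS \<Longrightarrow> e > 0 \<Longrightarrow> \<exists>M. \<forall>m\<ge>M. \<forall>n\<ge>M. d (x m) (x n) < e"
  by (simp add: cauchy_seqs_def)

lemma const_CS: "a \<in> carrier A \<Longrightarrow> (\<lambda>_. a) \<in> CS"
  by (rule CS_I) (auto simp: dist_refl)

lemma equiv_cauchy_rel: "equiv CS (cauchy_rel A N)"
proof (rule equivI)
  show "cauchy_rel A N \<subseteq> CS \<times> CS"
    by (auto simp: cauchy_rel_def)
  show "refl_on CS (cauchy_rel A N)"
    by (auto simp: refl_on_def cauchy_rel_def CS_carrier dist_refl)
  show "sym (cauchy_rel A N)"
  proof (rule symI)
    fix x y assume "(x, y) \<in> cauchy_rel A N"
    then have "x \<in> CS" "y \<in> CS" "(\<lambda>n. d (x n) (y n)) \<longlonglongrightarrow> 0" by (auto simp: cauchy_rel_def)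
    moreover have "(\<lambda>n. d (x n) (y n)) = (\<lambda>n. d (y n) (x n))"
      using \<open>x \<in> CS\<close> \<open>y \<in> CS\<close> by (intro ext dist_sym CS_carrier)
    ultimately show "(y, x) \<in> cauchy_rel A N" by (simp add: cauchy_rel_def)
  qed
  show "trans (cauchy_rel A N)"
  proof (rule transI)
    fix x y z assume a: "(x, y) \<in> cauchy_rel A N" "(y, z) \<in> cauchy_rel A N"
    then have cs: "x \<in> CS" "y \<in> CS" "z \<in> CS" by (auto simp: cauchy_rel_def)
    have "(\<lambda>n. d (x n) (y n) + d (y n) (z n)) \<longlonglongrightarrow> 0 + 0"
      using a by (intro tendsto_add) (auto simp: cauchy_rel_def)
    then have "(\<lambda>n. d (x n) (z n)) \<longlonglongrightarrow> 0"
      by (intro tendsto_sandwich[of "\<lambda>_. 0" "\<lambda>n. d (x n) (z n)" _ "\<lambda>n. d (x n) (y n) + d (y n) (z n)"])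
        (auto intro!: always_eventually dist_nonneg dist_triangle CS_carrier cs)
    then show "(x, z) \<in> cauchy_rel A N" using cs by (simp add: cauchy_rel_def)
  qed
qed

lemma cls_eqI: "x \<in> CS \<Longrightarrow> y \<in> CS \<Longrightarrow> (\<lambda>n. d (x n) (y n)) \<longlonglongrightarrow> 0 \<Longrightarrow> cls x = cls y"
  unfolding cauchy_class_def by (rule equiv_class_eq[OF equiv_cauchy_rel]) (simp add: cauchy_rel_def)

lemma mem_cls: "y \<in> cls x \<longleftrightarrow> x \<in> CS \<and> y \<in> CS \<and> (\<lambda>n. d (x n) (y n)) \<longlonglongrightarrow> 0"
  by (simp add: cauchy_class_def cauchy_rel_def)

lemma self_mem_cls: "x \<in> CS \<Longrightarrow> x \<in> cls x"
  by (simp add: mem_cls CS_carrier dist_refl)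

lemma cls_in_compl_carrier: "x \<in> CS \<Longrightarrow> cls x \<in> compl_carrier A N"
  unfolding compl_carrier_def cauchy_class_def by (rule quotientI)

lemma compl_carrierE:
  assumes "X \<in> compl_carrier A N" obtains x where "x \<in> CS" "X = cls x"
  using assms unfolding compl_carrier_def cauchy_class_def by (auto elim: quotientE)

lemma CS_norm_convergent:
  assumes "x \<in> CS" shows "convergent (\<lambda>n. N (x n))"
proof (rule real_Cauchy_convergent, unfold Cauchy_def, intro allI impI)
  fix e :: real assume "e > 0"
  then obtain M where M: "\<forall>m\<ge>M. \<forall>n\<ge>M. d (x m) (x n) < e" using CS_D[OF assms] by blast
  have "dist (N (x m)) (N (x n)) < e" if "m \<ge> M" "n \<ge> M" for m n
    unfolding dist_real_def
    by (rule le_less_trans[OF norm_lipschitz]) (use M that CS_carrier[OF assms] in auto)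
  then show "\<exists>M. \<forall>m\<ge>M. \<forall>n\<ge>M. dist (N (x m)) (N (x n)) < e" by blast
qed

lemma CS_norm_bounded:
  assumes "x \<in> CS" shows "\<exists>K. \<forall>n. N (x n) \<le> K"
proof -
  have "Bseq (\<lambda>n. N (x n))" using CS_norm_convergent[OF assms] by (rule convergent_imp_Bseq)
  then show ?thesis unfolding Bseq_def by (metis abs_le_D1 real_norm_def)
qed

text \<open>\<open>compl_norm\<close> requires one limit common to all representatives of a class;
  the Lipschitz bound transports the limit from \<open>x\<close> to any equivalent
  \<open>y\<close>.\<close>

lemma compl_norm_cls:
  assumes "x \<in> CS" and lim: "(\<lambda>n. N (x n)) \<longlonglongrightarrow> r"
  shows "compl_norm N (cls x) = r"
  unfolding compl_norm_def
proof (rule the_equality)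
  show "\<forall>y\<in>cls x. (\<lambda>n. N (y n)) \<longlonglongrightarrow> r"
  proof
    fix y assume "y \<in> cls x"
    then have y: "y \<in> CS" "(\<lambda>n. d (x n) (y n)) \<longlonglongrightarrow> 0" by (auto simp: mem_cls)
    have "(\<lambda>n. N (y n) - N (x n)) \<longlonglongrightarrow> 0"
      by (rule Lim_null_comparison[OF _ y(2)])
        (auto intro!: always_eventually simp: abs_minus_commute[of "N (y _)"]
           norm_lipschitz CS_carrier \<open>x \<in> CS\<close> \<open>y \<in> CS\<close>)
    from tendsto_add[OF this lim] show "(\<lambda>n. N (y n)) \<longlonglongrightarrow> r" by simp
  qed
  fix r' assume "\<forall>y\<in>cls x. (\<lambda>n. N (y n)) \<longlonglongrightarrow> r'"
  then show "r' = r" using self_mem_cls[OF \<open>x \<in> CS\<close>] lim LIMSEQ_unique by blast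
qed

lemma compl_norm_cls_tendsto:
  assumes "x \<in> CS" shows "(\<lambda>n. N (x n)) \<longlonglongrightarrow> compl_norm N (cls x)"
  using CS_norm_convergent[OF assms] compl_norm_cls[OF assms] by (metis convergent_def)

text \<open>The estimate on \<open>T\<close> copies
  \<open>a b - a' b' = a (b - b') + (a - a') b'\<close>: the factors \<open>P a\<close> and
  \<open>R b'\<close> may grow, provided that they stay bounded along Cauchy sequences. Constant
  factors cover addition, norms cover the product.\<close>

lemma compl_lift2_cls:
  assumes x: "x \<in> CS" and y: "y \<in> CS"
    and cl: "\<And>a b. a \<in> carrier A \<Longrightarrow> b \<in> carrier A \<Longrightarrow> T a b \<in> carrier A"
    and T: "\<And>a b a' b'. \<lbrakk>a \<in> carrier A; b \<in> carrier A; a' \<in> carrier A; b' \<in> carrier A\<rbrakk>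
        \<Longrightarrow> d (T a b) (T a' b') \<le> P a * d b b' + R b' * d a a'"
    and P: "\<And>x. x \<in> CS \<Longrightarrow> \<exists>K. \<forall>n. P (x n) \<le> K"
    and R: "\<And>x. x \<in> CS \<Longrightarrow> \<exists>K. \<forall>n. R (x n) \<le> K"
  shows "(\<lambda>n. T (x n) (y n)) \<in> CS"
    and "compl_lift2 A N T (cls x) (cls y) = cls (\<lambda>n. T (x n) (y n))"
proof -
  have TCS: "(\<lambda>n. T (x n) (y n)) \<in> CS" if x: "x \<in> CS" and y: "y \<in> CS" for x y
  proof (rule CS_I)
    show "T (x n) (y n) \<in> carrier A" for n by (intro cl CS_carrier x y)
    fix e :: real assume e: "e > 0"
    obtain K where K: "\<forall>n. P (x n) \<le> K" using P x by blast
    obtain L where L: "\<forall>n. R (y n) \<le> L" using R y by blast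
    \<comment> \<open>The maximum with 1 makes the divisor positive, as \<open>K\<close> and
      \<open>L\<close> are arbitrary upper bounds.\<close>
    define J where "J = max 1 (max K L)"
    have J: "J > 0" "\<And>n. P (x n) \<le> J" "\<And>n. R (y n) \<le> J"
      using K L unfolding J_def by (auto simp: le_max_iff_disj)
    have e': "e / (2 * J) > 0" using e J by simp
    obtain M1 where M1: "\<forall>m\<ge>M1. \<forall>n\<ge>M1. d (x m) (x n) < e / (2 * J)" using CS_D[OF x e'] by blast
    obtain M2 where M2: "\<forall>m\<ge>M2. \<forall>n\<ge>M2. d (y m) (y n) < e / (2 * J)" using CS_D[OF y e'] by blast
    show "\<exists>M. \<forall>m\<ge>M. \<forall>n\<ge>M. d (T (x m) (y m)) (T (x n) (y n)) < e"
    proof (intro exI[of _ "max M1 M2"] allI impI)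
      fix m n assume mn: "max M1 M2 \<le> m" "max M1 M2 \<le> n"
      have "d (T (x m) (y m)) (T (x n) (y n)) \<le> P (x m) * d (y m) (y n) + R (y n) * d (x m) (x n)"
        by (intro T CS_carrier x y)
      also have "\<dots> \<le> J * d (y m) (y n) + J * d (x m) (x n)"
        by (intro add_mono mult_right_mono J dist_nonneg CS_carrier x y)
      also have "\<dots> < J * (e / (2 * J)) + J * (e / (2 * J))"
        using mn M1 M2 J(1) by (intro add_strict_mono mult_strict_left_mono) auto
      also have "\<dots> = e" using J(1) by (simp add: field_simps)
      finally show "d (T (x m) (y m)) (T (x n) (y n)) < e" .
    qed
  qed
  show "(\<lambda>n. T (x n) (y n)) \<in> CS" by (rule TCS[OF x y])
  \<comment> \<open>\<open>compl_lift2\<close> is a union over all pairs of representatives, so the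
    classes in it must coincide before it collapses to a single class.\<close>
  have eq: "cls (\<lambda>n. T (x' n) (y' n)) = cls (\<lambda>n. T (x n) (y n))" if "x' \<in> cls x" "y' \<in> cls y" for x' y'
  proof -
    have x': "x' \<in> CS" "(\<lambda>n. d (x n) (x' n)) \<longlonglongrightarrow> 0" and y': "y' \<in> CS" "(\<lambda>n. d (y n) (y' n)) \<longlonglongrightarrow> 0"
      using that by (auto simp: mem_cls)
    obtain K where K: "\<forall>n. P (x n) \<le> K" using P x by blast
    obtain L where L: "\<forall>n. R (y' n) \<le> L" using R y' by blast
    have "(\<lambda>n. d (T (x n) (y n)) (T (x' n) (y' n))) \<longlonglongrightarrow> 0"
    proof (rule tendsto_sandwich[where f = "\<lambda>_. 0"])
      show "\<forall>\<^sub>F n in sequentially. d (T (x n) (y n)) (T (x' n) (y' n)) \<le> K * d (y n) (y' n) + L * d (x n) (x' n)"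
      proof (intro always_eventually allI)
        fix n
        have "d (T (x n) (y n)) (T (x' n) (y' n)) \<le> P (x n) * d (y n) (y' n) + R (y' n) * d (x n) (x' n)"
          by (intro T CS_carrier x y x' y')
        also have "\<dots> \<le> K * d (y n) (y' n) + L * d (x n) (x' n)"
          by (intro add_mono mult_right_mono K[rule_format] L[rule_format] dist_nonneg CS_carrier x y x' y')
        finally show "d (T (x n) (y n)) (T (x' n) (y' n)) \<le> K * d (y n) (y' n) + L * d (x n) (x' n)" .
      qed
      show "(\<lambda>n. K * d (y n) (y' n) + L * d (x n) (x' n)) \<longlonglongrightarrow> 0"
        using tendsto_add[OF tendsto_mult_left[OF y'(2)] tendsto_mult_left[OF x'(2)], of K L] by simp
      show "\<forall>\<^sub>F n in sequentially. 0 \<le> d (T (x n) (y n)) (T (x' n) (y' n))"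
        by (intro always_eventually allI dist_nonneg cl CS_carrier x y x' y')
    qed auto
    then show ?thesis by (intro cls_eqI[symmetric] TCS x y x' y')
  qed
  show "compl_lift2 A N T (cls x) (cls y) = cls (\<lambda>n. T (x n) (y n))"
    unfolding compl_lift2_def using self_mem_cls[OF x] self_mem_cls[OF y] eq by blast
qed

text \<open>A unary map is a binary one that ignores its first argument, with \<open>P = K\<close>
  and \<open>R = 0\<close>.\<close>

lemma compl_lift_cls:
  assumes x: "x \<in> CS"
    and cl: "\<And>a. a \<in> carrier A \<Longrightarrow> T a \<in> carrier A"
    and T: "\<And>a a'. \<lbrakk>a \<in> carrier A; a' \<in> carrier A\<rbrakk> \<Longrightarrow> d (T a) (T a') \<le> K * d a a'"
  shows "(\<lambda>n. T (x n)) \<in> CS" and "compl_lift A N T (cls x) = cls (\<lambda>n. T (x n))"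
proof -
  have "compl_lift A N T (cls x) = compl_lift2 A N (\<lambda>_. T) (cls x) (cls x)"
    unfolding compl_lift_def compl_lift2_def using self_mem_cls[OF x] by blast
  moreover have "(\<lambda>n. T (x n)) \<in> CS \<and> compl_lift2 A N (\<lambda>_. T) (cls x) (cls x) = cls (\<lambda>n. T (x n))"
    using compl_lift2_cls[OF x x, where T = "\<lambda>_. T" and P = "\<lambda>_. K" and R = "\<lambda>_. 0"] cl T by fastforce
  ultimately show "(\<lambda>n. T (x n)) \<in> CS" "compl_lift A N T (cls x) = cls (\<lambda>n. T (x n))" by auto
qed

end

section \<open>Integrable weights\<close>

text \<open>Lebesgue measure on \<open>real^'n\<close> is the image of a product measure indexed by
  \<open>Basis\<close>, under the map that sums coordinates times basis vectors. \<open>J\<close>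
  translates basis vectors back to indices, after which the product theorems apply.\<close>

lemma
  fixes g :: "'n::finite \<Rightarrow> real \<Rightarrow> 'b::{real_normed_field,banach,second_countable_topology}"
  assumes g: "\<And>i. integrable lborel (g i)"
  shows integrable_prod_components: "integrable lborel (\<lambda>x::real^'n. \<Prod>i\<in>UNIV. g i (x $ i))"
    and integral_prod_components:
      "(LINT x::(real^'n)|lborel. (\<Prod>i\<in>UNIV. g i (x $ i))) = (\<Prod>i\<in>UNIV. (LINT t|lborel. g i t))"
proof -
  let ?B = "Basis :: (real^'n) set"
  let ?e = "\<lambda>i::'n. axis i 1 :: real^'n"
  define J where "J = inv_into (UNIV :: 'n set) ?e"
  have inj: "inj ?e" by (auto simp: inj_on_def axis_eq_axis)
  have J: "J (?e i) = i" for i unfolding J_def by (rule inv_f_f[OF inj])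
  have B: "?B = range ?e" by (auto simp: Basis_vec_def)
  have reindex: "(\<Prod>b\<in>?B. h b) = (\<Prod>i\<in>UNIV. h (?e i))" for h :: "real^'n \<Rightarrow> 'b"
    unfolding B by (subst prod.reindex[OF inj]) simp
  interpret P: product_sigma_finite "\<lambda>_::real^'n. lborel :: real measure" ..
  let ?M = "\<Pi>\<^sub>M b\<in>?B. (lborel :: real measure)"
  let ?T = "\<lambda>f. \<Sum>b\<in>?B. f b *\<^sub>R b"
  have [measurable]: "g i \<in> borel_measurable borel" for i
    using borel_measurable_integrable[OF g[of i]] by simp
  have comp: "(\<Prod>i\<in>UNIV. g i (?T f $ i)) = (\<Prod>b\<in>?B. g (J b) (f b))" for f
  proof -
    have "?T f $ i = f (?e i)" for i
    proof -
      have "?T f $ i = ?T f \<bullet> ?e i" by (simp add: inner_axis)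
      also have "\<dots> = f (?e i)" by (rule inner_sum_left_Basis) (simp add: B)
      finally show ?thesis .
    qed
    then show ?thesis by (simp add: reindex J)
  qed
  have meas: "?T \<in> measurable ?M borel" by measurable
  have int: "integrable ?M (\<lambda>f. \<Prod>b\<in>?B. g (J b) (f b))"
    by (rule P.product_integrable_prod) (auto intro: g)
  show "integrable lborel (\<lambda>x::real^'n. \<Prod>i\<in>UNIV. g i (x $ i))"
    unfolding lborel_eq[where 'a="real^'n"] by (subst integrable_distr_eq[OF meas]) (use int in \<open>simp_all only: comp\<close>, measurable)
  have "(LINT x::(real^'n)|lborel. (\<Prod>i\<in>UNIV. g i (x $ i))) = (LINT f|?M. (\<Prod>b\<in>?B. g (J b) (f b)))"
    unfolding lborel_eq[where 'a="real^'n"] by (subst integral_distr[OF meas]) (simp_all only: comp, measurable)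
  also have "\<dots> = (\<Prod>b\<in>?B. (LINT t|lborel. g (J b) t))"
    by (rule P.product_integral_prod) (auto intro: g)
  finally show "(LINT x::(real^'n)|lborel. (\<Prod>i\<in>UNIV. g i (x $ i))) = (\<Prod>i\<in>UNIV. (LINT t|lborel. g i t))"
    by (simp add: reindex J)
qed

lemma integrable_inverse_1_plus_square_lborel: "integrable lborel (\<lambda>t::real. inverse (1 + t\<^sup>2))"
  using integrable_inverse_1_plus_square by (simp add: set_integrable_def)

text \<open>For |t| \<le> 1 the function is dominated by \<open>\<bar>t\<bar> powr (-a)\<close>,
  which is integrable there because \<open>a < 1\<close>; beyond that the power is at most 1 and the
  second factor is integrable.\<close>

lemma integrable_powr_inverse_1_plus_square:
  assumes a: "0 \<le> a" "a < (1::real)"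
  shows "integrable lborel (\<lambda>t::real. \<bar>t\<bar> powr (-a) * inverse (1 + t\<^sup>2))"
proof -
  let ?f = "\<lambda>t::real. indicator {0..1} t * t powr (-a)"
  have "(\<lambda>t. t powr (-a)) absolutely_integrable_on {0..1::real}"
    by (intro nonnegative_absolutely_integrable_1 integrable_on_powr_from_0) (use a in auto)
  then have f: "integrable lborel ?f"
    unfolding set_integrable_def by (subst (asm) integrable_completion) auto
  have f': "integrable lborel (\<lambda>t. ?f (- t))"
    using lborel_integrable_real_affine[OF f, of "-1" 0] by simp
  let ?g = "\<lambda>t. ?f t + ?f (- t) + inverse (1 + t\<^sup>2)"
  have "integrable lborel ?g"
    by (intro Bochner_Integration.integrable_add f f' integrable_inverse_1_plus_square_lborel)
  then show ?thesis
  proof (rule Bochner_Integration.integrable_bound)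
    show "AE t in lborel. norm (\<bar>t\<bar> powr (-a) * inverse (1 + t\<^sup>2)) \<le> norm (?g t)"
    proof (intro always_eventually allI)
      fix t :: real
      have i1: "inverse (1 + t\<^sup>2) \<le> 1" "0 \<le> inverse (1 + t\<^sup>2)"
        by (auto simp: inverse_le_1_iff add_nonneg_eq_0_iff)
      have g0: "0 \<le> ?f t" "0 \<le> ?f (-t)" by (auto simp: indicator_def)
      have "\<bar>t\<bar> powr (-a) * inverse (1 + t\<^sup>2) \<le> ?g t"
      proof (cases "\<bar>t\<bar> \<le> 1")
        case True
        have "\<bar>t\<bar> powr (-a) * inverse (1 + t\<^sup>2) \<le> \<bar>t\<bar> powr (-a)" using i1 by (intro mult_left_le) auto
        also have "\<dots> \<le> ?f t + ?f (-t)" using True by (cases "t \<ge> 0") (auto simp: indicator_def)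
        finally show ?thesis using i1(2) by linarith
      next
        case False
        then have "\<bar>t\<bar> powr (-a) \<le> \<bar>t\<bar> powr 0" using a by (intro powr_mono) auto
          then have "\<bar>t\<bar> powr (-a) \<le> 1" using False by (simp split: if_splits)
        then have "\<bar>t\<bar> powr (-a) * inverse (1 + t\<^sup>2) \<le> 1 * inverse (1 + t\<^sup>2)"
          using i1 False by (intro mult_right_mono) auto
        then show ?thesis using g0 by linarith
      qed
      moreover have "0 \<le> \<bar>t\<bar> powr (-a) * inverse (1 + t\<^sup>2)" using i1 by simp
      ultimately show "norm (\<bar>t\<bar> powr (-a) * inverse (1 + t\<^sup>2)) \<le> norm (?g t)" by simp
    qed
  qed simp
qed

text \<open>The exponent \<open>CARD('n)\<close> lets one factor be given to each coordinate, which
  makes the weight integrable by comparison with a product of functions of one variable. It serves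
  as the standard dominating function below.\<close>

definition decay_weight :: "real^'n::finite \<Rightarrow> real" where
  "decay_weight x = inverse (1 + x \<bullet> x) ^ CARD('n)"

lemma inner_self_ge_component: "(x $ i)\<^sup>2 \<le> x \<bullet> x" for x :: "real^'n::finite"
  using member_le_sum[of i UNIV "\<lambda>j. (x $ j)\<^sup>2"] by (simp add: inner_vec_def power2_eq_square)

lemma decay_weight_pos: "0 < decay_weight x"
  unfolding decay_weight_def by (intro zero_less_power positive_imp_inverse_positive add_pos_nonneg) auto

lemma decay_weight_le_1: "decay_weight x \<le> 1"
  unfolding decay_weight_def
  by (intro power_le_one) (auto simp: inverse_le_1_iff intro: add_nonneg_nonneg)

lemma decay_weight_measurable[measurable]: "decay_weight \<in> borel_measurable borel"
  unfolding decay_weight_def[abs_def] by measurable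

lemma decay_weight_le_prod: "decay_weight x \<le> (\<Prod>i\<in>UNIV. inverse (1 + (x $ i)\<^sup>2))"
proof -
  have "decay_weight x = (\<Prod>i\<in>(UNIV::'a set). inverse (1 + x \<bullet> x))"
    by (simp add: decay_weight_def)
  also have "\<dots> \<le> (\<Prod>i\<in>UNIV. inverse (1 + (x $ i)\<^sup>2))"
    by (intro prod_mono conjI le_imp_inverse_le add_left_mono inner_self_ge_component)
       (auto simp: add_pos_nonneg)
  finally show ?thesis .
qed

lemma integrable_decay_weight: "integrable lborel (decay_weight :: real^'n::finite \<Rightarrow> real)"
proof (rule Bochner_Integration.integrable_bound)
  show "integrable lborel (\<lambda>x::real^'n. \<Prod>i\<in>UNIV. inverse (1 + (x $ i)\<^sup>2))"
    by (intro integrable_prod_components integrable_inverse_1_plus_square_lborel)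
  show "AE x in lborel. norm (decay_weight x) \<le> norm (\<Prod>i\<in>(UNIV::'n set). inverse (1 + (x $ i)\<^sup>2))"
    by (intro always_eventually allI)
      (simp add: abs_of_pos[OF decay_weight_pos] order_trans[OF decay_weight_le_prod abs_ge_self])
qed simp

lemma AE_component_nonzero: "AE x::(real^'n::finite) in lborel. x $ i \<noteq> 0"
proof -
  have "negligible {x::real^'n. x $ i = 0}" by (rule negligible_standard_hyperplane_cart)
  then have "{x::real^'n. x $ i = 0} \<in> null_sets (completion lborel)" by (simp add: negligible_iff_null_sets)
  moreover have "{x::real^'n. x $ i = 0} \<in> sets lborel" by simp
  ultimately have "{x::real^'n. x $ i = 0} \<in> null_sets lborel" by (simp add: null_sets_completion_iff)
  then have "AE x in lborel. x \<notin> {x::real^'n. x $ i = 0}" by (rule AE_not_in)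
  then show ?thesis by simp
qed

text \<open>Since \<open>\<bar>p\<bar>\<^sup>-\<^sup>2 \<le> \<Prod>\<^sub>i \<bar>p\<^sub>i\<bar> powr (-2/n)\<close>, the singularity is integrable as soon as \<open>2/n < 1\<close>.\<close>

lemma integrable_decay_weight_over_square:
  assumes "CARD('n::finite) \<ge> 3"
  shows "integrable lborel (\<lambda>p::real^'n. inverse (p \<bullet> p) * decay_weight p)"
proof (rule Bochner_Integration.integrable_bound)
  let ?n = "real CARD('n)"
  let ?h = "\<lambda>p::real^'n. \<Prod>i\<in>(UNIV::'n set). \<bar>p $ i\<bar> powr (- (2 / ?n)) * inverse (1 + (p $ i)\<^sup>2)"
  have n: "0 \<le> 2 / ?n" "2 / ?n < 1" using assms by (auto simp: field_simps)
  show "integrable lborel ?h"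
    by (intro integrable_prod_components integrable_powr_inverse_1_plus_square n)
  \<comment> \<open>On the hyperplanes \<open>p $ i = 0\<close> the bound by \<open>?h\<close> can
    fail, because \<open>0 powr x = 0\<close>; they form a null set.\<close>
  have "AE p::(real^'n) in lborel. \<forall>i\<in>UNIV. p $ i \<noteq> 0"
    by (intro AE_finite_allI AE_component_nonzero) auto
  then show "AE p in lborel. norm (inverse (p \<bullet> p) * decay_weight p) \<le> norm (?h p)"
  proof eventually_elim
    case (elim p)
    then have pi: "\<And>i. p $ i \<noteq> 0" by simp
    then have p0: "p \<noteq> 0" by (metis zero_index)
    then have pp: "p \<bullet> p > 0" by simp
    have "inverse (p \<bullet> p) = ((p \<bullet> p) powr (- (1 / ?n))) ^ CARD('n)"
      using pp assms by (subst powr_realpow[symmetric]) (simp_all only: powr_powr, simp_all add: powr_minus)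
    also have "\<dots> = (\<Prod>i\<in>(UNIV::'n set). (p \<bullet> p) powr (- (1 / ?n)))" by simp
    also have "\<dots> \<le> (\<Prod>i\<in>(UNIV::'n set). \<bar>p $ i\<bar> powr (- (2 / ?n)))"
    proof (intro prod_mono conjI)
      fix i
      have "(p \<bullet> p) powr (- (1 / ?n)) \<le> ((p $ i)\<^sup>2) powr (- (1 / ?n))"
        using inner_self_ge_component[of p i] pi[of i] by (intro powr_mono2') auto
      also have "\<dots> = (\<bar>p $ i\<bar> powr 2) powr (- (1 / ?n))" using pi[of i] by (simp add: powr_numeral)
      also have "\<dots> = \<bar>p $ i\<bar> powr (- (2 / ?n))" by (simp only: powr_powr) simp
      finally show "(p \<bullet> p) powr (- (1 / ?n)) \<le> \<bar>p $ i\<bar> powr (- (2 / ?n))" .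
    qed auto
    finally have 1: "inverse (p \<bullet> p) \<le> (\<Prod>i\<in>(UNIV::'n set). \<bar>p $ i\<bar> powr (- (2 / ?n)))" .
    have "inverse (p \<bullet> p) * decay_weight p \<le> ?h p"
      unfolding prod.distrib
      by (intro mult_mono 1 decay_weight_le_prod prod_nonneg) (auto intro: less_imp_le[OF decay_weight_pos])
    moreover have "0 \<le> inverse (p \<bullet> p) * decay_weight p"
      using pp decay_weight_pos[of p] by simp
    ultimately show ?case by simp
  qed
qed simp

section \<open>Schwartz functions and their Fourier transforms\<close>

lemma iter_partial_deriv_Nil [simp]: "iter_partial_deriv [] f = f"
  and iter_partial_deriv_Cons [simp]:
    "iter_partial_deriv (i # is) f = partial_deriv i (iter_partial_deriv is f)"
  and iter_partial_deriv_snoc: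
    "iter_partial_deriv (is @ [i]) f = iter_partial_deriv is (partial_deriv i f)"
  by (simp_all add: iter_partial_deriv_def fun_eq_iff)

lemma has_vector_derivative_along_axis:
  assumes "(f has_derivative D) (at (x + t *\<^sub>R axis i 1))"
  shows "((\<lambda>s. f (x + s *\<^sub>R axis i 1)) has_vector_derivative D (axis i 1)) (at t)"
proof -
  interpret D: bounded_linear D using assms by (rule has_derivative_bounded_linear)
  have "((\<lambda>s. f (x + s *\<^sub>R axis i 1)) has_derivative (\<lambda>h. D (h *\<^sub>R axis i 1))) (at t)"
    by (rule has_derivative_compose[where f = "\<lambda>s. x + s *\<^sub>R axis i 1" and g = f, OF _ assms]) (auto intro!: derivative_eq_intros)
  then show ?thesis by (simp add: has_vector_derivative_def D.scaleR)
qed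

lemma partial_deriv_eq:
  assumes "(f has_derivative D) (at x)"
  shows "partial_deriv i f x = D (axis i 1)"
  using has_vector_derivative_along_axis[of f D x 0 i] assms
  unfolding partial_deriv_def by (intro vector_derivative_at) simp

lemma has_vector_derivative_partial_deriv:
  assumes "f differentiable (at (x + t *\<^sub>R axis i 1))"
  shows "((\<lambda>s. f (x + s *\<^sub>R axis i 1)) has_vector_derivative partial_deriv i f (x + t *\<^sub>R axis i 1)) (at t)"
  using assms has_vector_derivative_along_axis partial_deriv_eq
  unfolding differentiable_def by metis

lemma partial_deriv_add:
  assumes "\<And>x. f differentiable (at x)" "\<And>x. g differentiable (at x)"
  shows "partial_deriv i (f + g) = partial_deriv i f + partial_deriv i g"
proof
  fix x
  obtain D E where D: "(f has_derivative D) (at x)" "(g has_derivative E) (at x)"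
    using assms unfolding differentiable_def by meson
  have "(f + g has_derivative (\<lambda>h. D h + E h)) (at x)"
    using has_derivative_add[OF D] by (simp add: plus_fun_def)
  then show "partial_deriv i (f + g) x = (partial_deriv i f + partial_deriv i g) x"
    by (simp add: partial_deriv_eq D partial_deriv_eq[OF D(1)] partial_deriv_eq[OF D(2)])
qed

lemma partial_deriv_cmult:
  assumes "\<And>x. f differentiable (at x)"
  shows "partial_deriv i (\<lambda>x. c * f x) = (\<lambda>x. c * partial_deriv i f x)"
proof
  fix x
  obtain D where D: "(f has_derivative D) (at x)"
    using assms unfolding differentiable_def by meson
  have "((\<lambda>x. c * f x) has_derivative (\<lambda>h. c * D h)) (at x)"
    by (rule has_derivative_mult_right[OF D])
  then show "partial_deriv i (\<lambda>x. c * f x) x = c * partial_deriv i f x"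
    by (simp add: partial_deriv_eq partial_deriv_eq[OF D])
qed

lemma schwartz_iter_differentiable: "f \<in> schwartz \<Longrightarrow> iter_partial_deriv is f differentiable (at x)"
  by (simp add: schwartz_def)

lemma schwartz_differentiable: "f \<in> schwartz \<Longrightarrow> f differentiable (at x)"
  using schwartz_iter_differentiable[of f "[]"] by simp

lemma schwartz_iter_bounded:
  "f \<in> schwartz \<Longrightarrow> bounded (range (\<lambda>x. norm x ^ k *\<^sub>R iter_partial_deriv is f x))"
  by (simp add: schwartz_def)

lemma iter_partial_deriv_add:
  "f \<in> schwartz \<Longrightarrow> g \<in> schwartz \<Longrightarrow> iter_partial_deriv is (f + g) = iter_partial_deriv is f + iter_partial_deriv is g"
  by (induction "is") (simp_all add: partial_deriv_add schwartz_iter_differentiable)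

lemma iter_partial_deriv_cmult:
  "f \<in> schwartz \<Longrightarrow> iter_partial_deriv is (\<lambda>x. c * f x) = (\<lambda>x. c * iter_partial_deriv is f x)"
  by (induction "is") (simp_all add: partial_deriv_cmult schwartz_iter_differentiable)

lemma schwartz_add:
  assumes f: "f \<in> schwartz" and g: "g \<in> schwartz" shows "f + g \<in> schwartz"
  unfolding schwartz_def
proof (intro CollectI allI conjI)
  fix "is" k x
  show "iter_partial_deriv is (f + g) differentiable (at x)"
    unfolding iter_partial_deriv_add[OF f g] unfolding plus_fun_def
    by (intro differentiable_add schwartz_iter_differentiable f g)
  obtain A where A: "\<And>x. norm (norm x ^ k *\<^sub>R iter_partial_deriv is f x) \<le> A"
    using schwartz_iter_bounded[OF f, of k "is"] by (auto simp: bounded_iff)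
  obtain B where B: "\<And>x. norm (norm x ^ k *\<^sub>R iter_partial_deriv is g x) \<le> B"
    using schwartz_iter_bounded[OF g, of k "is"] by (auto simp: bounded_iff)
  have "norm (norm x ^ k *\<^sub>R iter_partial_deriv is (f + g) x) \<le> A + B" for x
    unfolding iter_partial_deriv_add[OF f g] plus_fun_apply scaleR_add_right
    by (rule norm_triangle_mono[OF A B])
  then show "bounded (range (\<lambda>x. norm x ^ k *\<^sub>R iter_partial_deriv is (f + g) x))"
    unfolding bounded_iff by blast
qed

lemma schwartz_cmult:
  assumes f: "f \<in> schwartz" shows "(\<lambda>x. c * f x) \<in> schwartz"
  unfolding schwartz_def
proof (intro CollectI allI conjI)
  fix "is" k x
  show "iter_partial_deriv is (\<lambda>x. c * f x) differentiable (at x)"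
    unfolding iter_partial_deriv_cmult[OF f]
    by (intro differentiable_mult differentiable_const schwartz_iter_differentiable f)
  obtain B where B: "\<And>x. norm (norm x ^ k *\<^sub>R iter_partial_deriv is f x) \<le> B"
    using schwartz_iter_bounded[OF f, of k "is"] by (auto simp: bounded_iff)
  have "norm (norm x ^ k *\<^sub>R (c * iter_partial_deriv is f x)) \<le> cmod c * B" for x
    using mult_left_mono[OF B[of x], of "cmod c"] by (simp add: norm_mult mult_ac)
  then show "bounded (range (\<lambda>x. norm x ^ k *\<^sub>R iter_partial_deriv is (\<lambda>x. c * f x) x))"
    unfolding iter_partial_deriv_cmult[OF f] bounded_iff by blast
qed

lemma schwartz_zero: "0 \<in> schwartz"
proof -
  have "partial_deriv i (0 :: real^'a \<Rightarrow> complex) = 0" for i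
    by (auto simp: fun_eq_iff zero_fun_def intro!: partial_deriv_eq derivative_eq_intros)
  then have "iter_partial_deriv is (0 :: real^'a \<Rightarrow> complex) = 0" for "is"
    by (induction "is") auto
  then show ?thesis by (simp add: schwartz_def zero_fun_def image_constant_conv)
qed

lemma schwartz_scaleR: "f \<in> schwartz \<Longrightarrow> (\<lambda>x. (t::real) *\<^sub>R f x) \<in> schwartz"
  unfolding scaleR_conv_of_real by (rule schwartz_cmult)

lemma schwartz_uminus: "f \<in> schwartz \<Longrightarrow> - f \<in> schwartz"
  using schwartz_cmult[of f "-1"] by (simp add: fun_Compl_def)

lemma schwartz_partial_deriv: "f \<in> schwartz \<Longrightarrow> partial_deriv i f \<in> schwartz"
  unfolding schwartz_def by (simp flip: iter_partial_deriv_snoc)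

lemma schwartz_sum:
  assumes "\<And>i. i \<in> I \<Longrightarrow> f i \<in> schwartz" shows "(\<lambda>x. \<Sum>i\<in>I. f i x) \<in> schwartz"
proof (cases "finite I")
  case True
  then show ?thesis using assms
  proof (induction I)
    case empty
    then show ?case using schwartz_zero by (simp add: zero_fun_def)
  next
    case (insert i I)
    then show ?case using schwartz_add[of "f i" "\<lambda>x. \<Sum>i\<in>I. f i x"] by (simp add: plus_fun_def)
  qed
next
  case False
  then show ?thesis using schwartz_zero by (simp add: zero_fun_def)
qed

lemma schwartz_hamiltonian:
  assumes f: "f \<in> schwartz" shows "hamiltonian f \<in> schwartz"
proof -
  have "(\<lambda>x. (-1/2) * (\<Sum>i\<in>UNIV. partial_deriv i (partial_deriv i f) x)) \<in> schwartz"
    by (intro schwartz_cmult schwartz_sum schwartz_partial_deriv f)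
  moreover have "(\<lambda>x. (-1/2) * (\<Sum>i\<in>UNIV. partial_deriv i (partial_deriv i f) x)) = hamiltonian f"
    by (simp add: hamiltonian_def fun_eq_iff)
  ultimately show ?thesis by simp
qed

section \<open>Decay, measurability and integrability of Schwartz functions\<close>

lemma schwartz_decay:
  assumes "f \<in> schwartz" obtains C where "C \<ge> 0" "\<And>x. cmod (f x) \<le> C * decay_weight x"
proof -
  let ?n = "CARD('a)"
  obtain B where B: "\<And>x. cmod (f x) \<le> B"
    using schwartz_iter_bounded[OF assms, of 0 "[]"] by (auto simp: bounded_iff)
  obtain B' where B': "\<And>x. norm x ^ (2 * ?n) * cmod (f x) \<le> B'"
    using schwartz_iter_bounded[OF assms, of "2 * ?n" "[]"] by (auto simp: bounded_iff)
  have "cmod (f x) \<le> (2 ^ ?n * (B + B')) * decay_weight x" for x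
  proof -
    let ?s = "x \<bullet> x"
    have s: "0 \<le> ?s" "norm x ^ (2 * ?n) = ?s ^ ?n"
      by (simp_all add: power_mult dot_square_norm)
    \<comment> \<open>Two Schwartz seminorms suffice, those with powers 0 and 2n, because
      \<open>(1 + s) ^ n\<close> is at most \<open>2 ^ n\<close> times
      \<open>1 + s ^ n\<close>.\<close>
    have "(1 + ?s) ^ ?n \<le> (2 * max 1 ?s) ^ ?n" by (intro power_mono) (auto simp: max_def)
    also have "\<dots> \<le> 2 ^ ?n * (1 + ?s ^ ?n)"
      using s by (auto simp: power_mult_distrib max_def intro!: mult_left_mono)
    finally have "(1 + ?s) ^ ?n * cmod (f x) \<le> 2 ^ ?n * (1 + ?s ^ ?n) * cmod (f x)"
      by (rule mult_right_mono) simp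
    also have "\<dots> = 2 ^ ?n * (cmod (f x) + norm x ^ (2 * ?n) * cmod (f x))"
      by (simp only: s(2)) (simp add: algebra_simps)
    also have "\<dots> \<le> 2 ^ ?n * (B + B')" by (intro mult_left_mono add_mono B B') auto
    finally have "(1 + ?s) ^ ?n * cmod (f x) \<le> 2 ^ ?n * (B + B')" .
    moreover have "0 < (1 + ?s) ^ ?n" by (intro zero_less_power add_pos_nonneg) auto
    ultimately show ?thesis
      by (simp add: decay_weight_def power_inverse field_simps)
  qed
  moreover have "0 \<le> B" "0 \<le> B'" using B[of 0] B'[of 0] norm_ge_zero order_trans
     apply (metis norm_ge_zero order_trans) using B'[of 0] by (simp add: power_0_left split: if_splits)
  ultimately show ?thesis using that[of "2 ^ ?n * (B + B')"] by simp
qed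

text \<open>It serves to dominate the difference quotients of a Schwartz function for steps of
  length at most 1. From |x|^2 \<le> 2|x+y|^2 + 2|y|^2 and |y| \<le> 1 follows 1 + |x|^2 \<le> 3 (1
  + |x+y|^2), hence the constant.\<close>

lemma decay_weight_translate:
  fixes x y :: "real^'n::finite"
  assumes "norm y \<le> 1" shows "decay_weight (x + y) \<le> 3 ^ CARD('n) * decay_weight x"
proof -
  have y: "y \<bullet> y \<le> 1" using assms by (simp add: norm_eq_sqrt_inner)
  \<comment> \<open>This square is exactly the difference of the two sides of the next
    inequality.\<close>
  have "0 \<le> (x + 2 *\<^sub>R y) \<bullet> (x + 2 *\<^sub>R y)" by simp
  then have "x \<bullet> x \<le> 2 * ((x + y) \<bullet> (x + y)) + 2 * (y \<bullet> y)"
    by (simp add: inner_simps inner_commute algebra_simps)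
  then have "1 + x \<bullet> x \<le> 3 * (1 + (x + y) \<bullet> (x + y))"
    using y inner_ge_zero[of "x + y"] by (smt (verit))
  then have "inverse (1 + (x + y) \<bullet> (x + y)) \<le> 3 * inverse (1 + x \<bullet> x)"
    using inner_ge_zero[of x] inner_ge_zero[of "x + y"]
    by (simp add: field_simps add_pos_nonneg del: inner_ge_zero)
  then have "inverse (1 + (x + y) \<bullet> (x + y)) ^ CARD('n) \<le> (3 * inverse (1 + x \<bullet> x)) ^ CARD('n)"
    by (intro power_mono) (auto simp: add_nonneg_nonneg)
  then show ?thesis by (simp add: decay_weight_def power_mult_distrib)
qed

lemma schwartz_measurable: "f \<in> schwartz \<Longrightarrow> f \<in> borel_measurable borel"
  by (intro borel_measurable_continuous_onI continuous_at_imp_continuous_on ballI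
      differentiable_imp_continuous_within schwartz_differentiable)

lemma integrable_of_decay:
  fixes f :: "real^'n::finite \<Rightarrow> 'b::{banach,second_countable_topology}"
  assumes "f \<in> borel_measurable borel" "\<And>x. norm (f x) \<le> C * decay_weight x"
  shows "integrable lborel f"
  by (rule Bochner_Integration.integrable_bound[OF integrable_mult_right[OF integrable_decay_weight, of C]])
    (use assms in \<open>auto intro!: always_eventually intro: order_trans[OF _ abs_ge_self]\<close>)

lemma schwartz_integrable: "f \<in> schwartz \<Longrightarrow> integrable lborel f"
  using schwartz_decay integrable_of_decay schwartz_measurable by metis

lemma schwartz_bounded:
  assumes "f \<in> schwartz" obtains C where "C \<ge> 0" "\<And>x. cmod (f x) \<le> C"
  using schwartz_decay[OF assms] decay_weight_le_1 by (metis mult_left_le order_trans)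

section \<open>Affine substitution and elementary rules for the Fourier transform\<close>

lemma integral_lborel_affine:
  fixes F :: "real^'n::finite \<Rightarrow> 'b::{banach,second_countable_topology}"
  assumes "c \<noteq> 0" and [measurable]: "F \<in> borel_measurable borel"
  shows "(LINT x|lborel. F x) = \<bar>c\<bar> ^ CARD('n) *\<^sub>R (LINT x|lborel. F (a + c *\<^sub>R x))"
  by (subst lborel_affine[OF assms(1), of a])
    (simp add: integral_density integral_distr)

lemma integral_lborel_translate:
  fixes F :: "real^'n::finite \<Rightarrow> 'b::{banach,second_countable_topology}"
  assumes "F \<in> borel_measurable borel"
  shows "(LINT x|lborel. F (x + a)) = (LINT x|lborel. F x)"
  using integral_lborel_affine[of 1 F a] assms by (simp add: add.commute)

lemma norm_exp_imaginary [simp]: "cmod (exp (- (\<i> * complex_of_real r))) = 1" "cmod (exp (\<i> * complex_of_real r)) = 1"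
  by (simp_all add: norm_exp_eq_Re)

lemma measurable_fourier_kernel[measurable]:
  "(\<lambda>x::real^'n::finite. exp (- \<i> * complex_of_real (p \<bullet> x))) \<in> borel_measurable borel"
  by (intro borel_measurable_continuous_onI continuous_intros)

lemma integrable_mult_bounded_kernel:
  fixes f :: "'a \<Rightarrow> complex"
  assumes f: "integrable M f" and "k \<in> borel_measurable M" "\<And>x. cmod (k x) \<le> 1"
  shows "integrable M (\<lambda>x. k x * f x)"
proof (rule Bochner_Integration.integrable_bound[OF f])
  show "(\<lambda>x. k x * f x) \<in> borel_measurable M" using assms by measurable
qed (use assms in \<open>auto simp: norm_mult mult_left_le_one_le\<close>)

lemma integrable_fourier:
  assumes "integrable lborel f"
  shows "integrable lborel (\<lambda>x. exp (- \<i> * complex_of_real (p \<bullet> x)) * f x)"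
  by (rule integrable_mult_bounded_kernel[OF assms]) auto

lemma borel_measurable_cnj [measurable (raw)]:
  assumes "f \<in> borel_measurable S" shows "(\<lambda>x. cnj (f x)) \<in> borel_measurable S"
  by (rule measurable_compose[OF assms]) (intro borel_measurable_continuous_onI continuous_intros)

lemma integrable_cnj_mult_of_decay:
  fixes f g :: "real^'n::finite \<Rightarrow> complex"
  assumes [measurable]: "f \<in> borel_measurable borel" "g \<in> borel_measurable borel"
    and f: "\<And>x. cmod (f x) \<le> C * decay_weight x" and g: "\<And>x. cmod (g x) \<le> D * decay_weight x"
    and C: "C \<ge> 0"
  shows "integrable lborel (\<lambda>x. cnj (f x) * g x)"
proof (rule integrable_of_decay[where C = "C * D"])
  show "norm (cnj (f x) * g x) \<le> C * D * decay_weight x" for x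
  proof -
    have "cmod (f x) \<le> C" using f[of x] mult_left_mono[OF decay_weight_le_1[of x] C] by simp
    then show ?thesis using mult_mono[OF _ g[of x] C] by (simp add: norm_mult mult.assoc)
  qed
qed measurable

lemma fourier_translate:
  assumes [measurable]: "f \<in> borel_measurable borel"
  shows "fourier (\<lambda>x. f (x + a)) p = exp (\<i> * complex_of_real (p \<bullet> a)) * fourier f p"
proof -
  have "fourier (\<lambda>x. f (x + a)) p =
    (LINT x|lborel. (\<lambda>x. exp (\<i> * complex_of_real (p \<bullet> a)) * (exp (- \<i> * complex_of_real (p \<bullet> x)) * f x)) (x + a))"
    unfolding fourier_def by (rule Bochner_Integration.integral_cong) (auto simp: inner_add_right algebra_simps simp flip: exp_add)
  also have "\<dots> = (LINT x|lborel. (\<lambda>x. exp (\<i> * complex_of_real (p \<bullet> a)) * (exp (- \<i> * complex_of_real (p \<bullet> x)) * f x)) x)"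
    by (rule integral_lborel_translate) measurable
  finally show ?thesis by (simp add: fourier_def)
qed

lemma fourier_add:
  assumes "integrable lborel f" "integrable lborel g"
  shows "fourier (f + g) p = fourier f p + fourier g p"
  unfolding fourier_def plus_fun_def distrib_left
  by (rule Bochner_Integration.integral_add) (intro integrable_fourier assms)+

lemma fourier_cmult: "fourier (\<lambda>x. c * f x) p = c * fourier f p"
  unfolding fourier_def by (simp add: mult.left_commute)

lemma fourier_sum:
  assumes "\<And>i. i \<in> I \<Longrightarrow> integrable lborel (f i)"
  shows "fourier (\<lambda>x. \<Sum>i\<in>I. f i x) p = (\<Sum>i\<in>I. fourier (f i) p)"
  unfolding fourier_def sum_distrib_left
  by (rule Bochner_Integration.integral_sum) (intro integrable_fourier assms)

lemma norm_fourier_le: "cmod (fourier f p) \<le> (LINT x|lborel. cmod (f x))"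
  unfolding fourier_def by (rule order_trans[OF integral_norm_bound]) (simp add: norm_mult)

lemma measurable_fourier[measurable]:
  assumes [measurable]: "f \<in> borel_measurable borel"
  shows "fourier f \<in> borel_measurable borel"
proof -
  have "(\<lambda>z::(real^'a) \<times> (real^'a). exp (- \<i> * complex_of_real (fst z \<bullet> snd z))) \<in> borel_measurable borel"
    by (intro borel_measurable_continuous_onI continuous_intros)
  then have [measurable]: "(\<lambda>z::(real^'a) \<times> (real^'a). exp (- \<i> * complex_of_real (fst z \<bullet> snd z))) \<in> borel_measurable (borel \<Otimes>\<^sub>M borel)"
    by (simp add: borel_prod)
  have "(\<lambda>z::(real^'a) \<times> (real^'a). exp (- \<i> * complex_of_real (fst z \<bullet> snd z)) * f (snd z)) \<in> borel_measurable (borel \<Otimes>\<^sub>M lborel)"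
    by measurable
  then show ?thesis
    unfolding fourier_def[abs_def]
    using lborel.borel_measurable_lebesgue_integral[of "\<lambda>p x. exp (- \<i> * complex_of_real (p \<bullet> x)) * f x" borel]
    by (simp add: case_prod_beta')
qed

section \<open>Derivatives under the Fourier transform\<close>

lemma exp_difference_quotient_tendsto:
  "(\<lambda>n. (exp (\<i> * complex_of_real (r * inverse (real (Suc n)))) - 1) / complex_of_real (inverse (real (Suc n)))) \<longlonglongrightarrow> \<i> * complex_of_real r"
proof -
  have "((\<lambda>z. exp (\<i> * complex_of_real r * z)) has_field_derivative \<i> * complex_of_real r) (at 0)"
    by (auto intro!: derivative_eq_intros)
  then have *: "((\<lambda>h. (exp (\<i> * complex_of_real r * h) - 1) / h) \<longlongrightarrow> \<i> * complex_of_real r) (at 0)"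
    by (simp add: DERIV_def)
  have "filterlim (\<lambda>n. complex_of_real (inverse (real (Suc n)))) (at 0) sequentially"
    unfolding filterlim_at using tendsto_of_real[OF LIMSEQ_inverse_real_of_nat, where 'a = complex] by (simp del: of_nat_Suc)
  from filterlim_compose[OF * this] show ?thesis by (simp add: mult.assoc)
qed

lemma has_vector_derivative_difference_quotient:
  assumes "((\<lambda>s. g s) has_vector_derivative D) (at 0)" and "g 0 = c"
  shows "((\<lambda>s. (g s - c) /\<^sub>R s) \<longlongrightarrow> D) (at 0)"
proof -
  have "((\<lambda>s. norm ((g s - g 0 - s *\<^sub>R D) /\<^sub>R norm s)) \<longlongrightarrow> 0) (at 0)"
    by (rule tendsto_norm_zero) (use assms in \<open>simp add: has_vector_derivative_def has_derivative_def Lim_ident_at\<close>)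
  then have "((\<lambda>s. norm ((g s - c) /\<^sub>R s - D)) \<longlongrightarrow> 0) (at 0)"
  proof (rule Lim_transform_eventually)
    show "\<forall>\<^sub>F s in at 0. norm ((g s - g 0 - s *\<^sub>R D) /\<^sub>R norm s) = norm ((g s - c) /\<^sub>R s - D)"
      unfolding eventually_at_filter
    proof (intro always_eventually allI impI)
      fix s :: real assume "s \<noteq> 0"
      then have "(g s - c) /\<^sub>R s - D = (g s - g 0 - s *\<^sub>R D) /\<^sub>R s"
        using assms(2) by (simp add: scaleR_diff_right)
      then show "norm ((g s - g 0 - s *\<^sub>R D) /\<^sub>R norm s) = norm ((g s - c) /\<^sub>R s - D)" by simp
    qed
  qed
  from LIM_zero_cancel[OF tendsto_norm_zero_cancel[OF this]] show ?thesis .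
qed

text \<open>Integration by parts without Fubini: the difference quotients of \<open>f\<close> are dominated, and the
  Fourier transform of a translate is known.\<close>

lemma fourier_partial_deriv:
  fixes f :: "real^'n::finite \<Rightarrow> complex"
  assumes f: "f \<in> schwartz"
  shows "fourier (partial_deriv i f) p = \<i> * complex_of_real (p $ i) * fourier f p"
proof -
  \<comment> \<open>A sequence of steps, since dominated convergence is applied along sequences;
    steps of size at most 1 keep \<open>decay_weight_translate\<close> applicable.\<close>
  define t where "t = (\<lambda>n. inverse (real (Suc n)))"
  have t: "0 < t n" "t n \<le> 1" for n by (auto simp: t_def inverse_le_1_iff)
  have t0: "t \<longlonglongrightarrow> 0" unfolding t_def by (rule LIMSEQ_inverse_real_of_nat)
  have t_at: "filterlim t (at 0) sequentially" unfolding filterlim_at using t0 t by (auto simp: less_imp_neq[symmetric])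
  let ?e = "axis i 1 :: real^'n"
  define q where "q = (\<lambda>n x. (f (x + t n *\<^sub>R ?e) - f x) / complex_of_real (t n))"
  have [measurable]: "f \<in> borel_measurable borel" "partial_deriv i f \<in> borel_measurable borel"
    by (intro schwartz_measurable schwartz_partial_deriv f)+
  obtain C where C: "C \<ge> 0" "\<And>x. cmod (partial_deriv i f x) \<le> C * decay_weight x"
    using schwartz_decay[OF schwartz_partial_deriv[OF f]] by blast
  let ?w = "\<lambda>x::real^'n. C * 3 ^ CARD('n) * decay_weight x"
  have bound: "cmod (q n x) \<le> ?w x" for n x
  proof -
    \<comment> \<open>Mean value inequality on the segment from \<open>x\<close> to
      \<open>x + t n *\<^sub>R ?e\<close>, where the derivative is bounded uniformly by the
      translated weight.\<close>
    have "norm (f (x + t n *\<^sub>R ?e) - f (x + 0 *\<^sub>R ?e)) \<le> ?w x * norm (t n - 0)"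
    proof (rule differentiable_bound[of "{0..t n}" "\<lambda>s. f (x + s *\<^sub>R ?e)" "\<lambda>s h. h *\<^sub>R partial_deriv i f (x + s *\<^sub>R ?e)"])
      show "((\<lambda>s. f (x + s *\<^sub>R ?e)) has_derivative (\<lambda>h. h *\<^sub>R partial_deriv i f (x + s *\<^sub>R ?e))) (at s within {0..t n})" for s
        using has_vector_derivative_partial_deriv[OF schwartz_differentiable[OF f]]
        unfolding has_vector_derivative_def by (rule has_derivative_at_withinI)
      show "onorm (\<lambda>h. h *\<^sub>R partial_deriv i f (x + s *\<^sub>R ?e)) \<le> ?w x" if "s \<in> {0..t n}" for s
      proof (rule onorm_le)
        fix h :: real
        have "norm (s *\<^sub>R ?e) \<le> 1" using that t[of n] by simp
        then have "cmod (partial_deriv i f (x + s *\<^sub>R ?e)) \<le> ?w x"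
          using C(2)[of "x + s *\<^sub>R ?e"] mult_left_mono[OF decay_weight_translate C(1)]
          by (smt (verit) mult.assoc)
        then show "norm (h *\<^sub>R partial_deriv i f (x + s *\<^sub>R ?e)) \<le> ?w x * norm h"
          by (simp add: mult.commute mult_left_mono)
      qed
    qed (use t[of n] in auto)
    then show ?thesis using t[of n] by (simp add: q_def norm_divide divide_le_eq)
  qed
  have lim: "(\<lambda>n. q n x) \<longlonglongrightarrow> partial_deriv i f x" for x
  proof -
    have "((\<lambda>s. f (x + s *\<^sub>R ?e)) has_vector_derivative partial_deriv i f x) (at 0)"
      using has_vector_derivative_partial_deriv[of f x 0 i] schwartz_differentiable[OF f] by simp
    then have "((\<lambda>s. (f (x + s *\<^sub>R ?e) - f x) /\<^sub>R s) \<longlongrightarrow> partial_deriv i f x) (at 0)"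
      by (rule has_vector_derivative_difference_quotient) simp
    from filterlim_compose[OF this t_at] show ?thesis
      by (simp add: q_def scaleR_conv_of_real divide_inverse mult.commute)
  qed
  have "(\<lambda>n. fourier (q n) p) \<longlonglongrightarrow> fourier (partial_deriv i f) p"
    unfolding fourier_def
  proof (rule integral_dominated_convergence[where w = ?w])
    show "integrable lborel ?w" by (intro integrable_mult_right integrable_decay_weight)
    show "AE x in lborel. (\<lambda>n. exp (- \<i> * complex_of_real (p \<bullet> x)) * q n x)
        \<longlonglongrightarrow> exp (- \<i> * complex_of_real (p \<bullet> x)) * partial_deriv i f x"
      by (intro always_eventually allI tendsto_mult tendsto_const lim)
    show "AE x in lborel. cmod (exp (- \<i> * complex_of_real (p \<bullet> x)) * q n x) \<le> ?w x" for n
      using bound by (simp add: norm_mult)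
  qed (auto simp: q_def)
  \<comment> \<open>A translate only acquires a phase, so the transform of the difference quotient
    is a difference quotient of that phase.\<close>
  moreover have "fourier (q n) p = (exp (\<i> * complex_of_real (p $ i * t n)) - 1) / complex_of_real (t n) * fourier f p" for n
  proof -
    have "q n = (\<lambda>x. inverse (complex_of_real (t n)) * ((\<lambda>x. f (x + t n *\<^sub>R ?e)) + (\<lambda>x. - 1 * f x)) x)"
      by (simp add: q_def fun_eq_iff divide_inverse mult.commute)
    moreover have "integrable lborel (\<lambda>x. f (x + t n *\<^sub>R ?e))"
    proof -
      have "f (x + t n *\<^sub>R ?e) = q n x * complex_of_real (t n) + f x" for x
        using t[of n] by (simp add: q_def)
      moreover have "integrable lborel (q n)"
        by (rule integrable_of_decay[OF _ bound]) (auto simp: q_def)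
      ultimately show ?thesis using schwartz_integrable[OF f] by simp
    qed
    ultimately have "fourier (q n) p = inverse (complex_of_real (t n)) * (fourier (\<lambda>x. f (x + t n *\<^sub>R ?e)) p + - 1 * fourier f p)"
      by (simp only: fourier_cmult) (subst fourier_add, auto simp only: fourier_cmult intro!: schwartz_integrable schwartz_cmult f)
    then show ?thesis
      by (simp add: fourier_translate inner_axis divide_inverse algebra_simps)
  qed
  ultimately have "(\<lambda>n. (exp (\<i> * complex_of_real (p $ i * t n)) - 1) / complex_of_real (t n) * fourier f p) \<longlonglongrightarrow> fourier (partial_deriv i f) p"
    by simp
  moreover have "(\<lambda>n. (exp (\<i> * complex_of_real (p $ i * t n)) - 1) / complex_of_real (t n) * fourier f p) \<longlonglongrightarrow> \<i> * complex_of_real (p $ i) * fourier f p"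
    unfolding t_def by (intro tendsto_mult_right exp_difference_quotient_tendsto)
  ultimately show ?thesis by (rule LIMSEQ_unique)
qed

lemma fourier_hamiltonian:
  assumes f: "f \<in> schwartz"
  shows "fourier (hamiltonian f) p = complex_of_real (p \<bullet> p / 2) * fourier f p"
proof -
  have "hamiltonian f = (\<lambda>x. (-1/2) * (\<Sum>i\<in>UNIV. partial_deriv i (partial_deriv i f) x))"
    by (simp add: hamiltonian_def fun_eq_iff)
  then have "fourier (hamiltonian f) p = (-1/2) * (\<Sum>i\<in>UNIV. fourier (partial_deriv i (partial_deriv i f)) p)"
    by (simp only: fourier_cmult) (subst fourier_sum, auto intro!: schwartz_integrable schwartz_partial_deriv f)
  also have "\<dots> = (1/2) * (\<Sum>i\<in>UNIV. complex_of_real (p $ i * p $ i) * fourier f p)"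
    by (simp add: fourier_partial_deriv f schwartz_partial_deriv sum_negf mult.left_commute mult.assoc)
  also have "\<dots> = complex_of_real (p \<bullet> p / 2) * fourier f p"
    by (simp add: inner_vec_def sum_distrib_right)
  finally show ?thesis .
qed

text \<open>\<open>(1 + p \<bullet> p) ^ k\<close> times the transform of \<open>f\<close> is the
  transform of \<open>(1 + 2 H) ^ k f\<close>, which is again Schwartz and therefore has a bounded
  transform. The case \<open>k = CARD('n)\<close> gives the weight.\<close>

lemma fourier_decay:
  fixes f :: "real^'n::finite \<Rightarrow> complex"
  assumes f: "f \<in> schwartz"
  obtains C where "C \<ge> 0" "\<And>p. cmod (fourier f p) \<le> C * decay_weight p"
proof -
  have *: "\<exists>g\<in>schwartz. \<forall>p. fourier g p = complex_of_real ((1 + p \<bullet> p) ^ k) * fourier f p" for k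
  proof (induction k)
    case 0
    then show ?case using f by auto
  next
    case (Suc k)
    then obtain g where g: "g \<in> schwartz" "\<And>p. fourier g p = complex_of_real ((1 + p \<bullet> p) ^ k) * fourier f p" by auto
    have h: "(\<lambda>x. 2 * hamiltonian g x) \<in> schwartz"
      by (intro schwartz_cmult schwartz_hamiltonian g)
    have "fourier (g + (\<lambda>x. 2 * hamiltonian g x)) p = complex_of_real ((1 + p \<bullet> p) ^ Suc k) * fourier f p" for p
      unfolding fourier_add[OF schwartz_integrable[OF g(1)] schwartz_integrable[OF h]] fourier_cmult
        fourier_hamiltonian[OF g(1)] g(2) by (simp add: algebra_simps)
    then show ?case using schwartz_add[OF g(1) h] by blast
  qed
  obtain g where g: "g \<in> schwartz" "\<And>p. fourier g p = complex_of_real ((1 + p \<bullet> p) ^ CARD('n)) * fourier f p"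
    using * by blast
  let ?C = "LINT x|lborel. cmod (g x)"
  have "cmod (fourier f p) \<le> ?C * decay_weight p" for p
  proof -
    have pos: "0 < (1 + p \<bullet> p) ^ CARD('n)" by (intro zero_less_power add_pos_nonneg) auto
    have "(1 + p \<bullet> p) ^ CARD('n) * cmod (fourier f p) = cmod (fourier g p)"
      using pos by (simp add: g norm_mult norm_power del: of_real_power of_real_add)
    then show ?thesis
      using norm_fourier_le[of g p] pos by (simp add: decay_weight_def power_inverse field_simps)
  qed
  then show ?thesis using that[of ?C] by simp
qed

section \<open>Fourier inversion and Plancherel\<close>

definition gaussian :: "real^'n::finite \<Rightarrow> real" where
  "gaussian x = exp (- (x \<bullet> x) / 2)"

lemma gaussian_measurable[measurable]: "gaussian \<in> borel_measurable borel"
  unfolding gaussian_def[abs_def] by measurable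

lemma gaussian_nonneg: "0 \<le> gaussian x" and gaussian_le_1: "gaussian x \<le> 1"
  by (auto simp: gaussian_def)

lemma gaussian_prod: "gaussian x = (\<Prod>i\<in>UNIV. exp (- (x $ i)\<^sup>2 / 2))"
  by (simp add: gaussian_def inner_vec_def exp_sum[symmetric] sum_divide_distrib sum_negf power2_eq_square)

text \<open>The transform is the characteristic function of the standard normal distribution,
  evaluated at \<open>- s\<close> because of the sign in the Fourier kernel.\<close>

lemma
  shows integrable_gaussian_real: "integrable lborel (\<lambda>t::real. exp (- t\<^sup>2 / 2))"
    and fourier_gaussian_real:
      "(LINT t|lborel. exp (- \<i> * complex_of_real (s * t)) * complex_of_real (exp (- t\<^sup>2 / 2)))
        = complex_of_real (sqrt (2 * pi) * exp (- s\<^sup>2 / 2))"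
proof -
  have d: "std_normal_density t = 1 / sqrt (2 * pi) * exp (- t\<^sup>2 / 2)" for t
    by (rule std_normal_density_def)
  have "integrable lborel std_normal_density" by simp
  then have "integrable lborel (\<lambda>t. sqrt (2 * pi) * std_normal_density t)" by (rule integrable_mult_right)
  then show "integrable lborel (\<lambda>t::real. exp (- t\<^sup>2 / 2))" by (simp add: d)
  have "complex_of_real (exp (- s\<^sup>2 / 2)) = char std_normal_distribution (- s)"
    by (simp add: char_std_normal_distribution)
  also have "\<dots> = (LINT t|lborel. std_normal_density t *\<^sub>R exp (\<i> * complex_of_real (- s * t)))"
    unfolding char_def by (subst integral_density) (auto simp: normal_density_nonneg)
  also have "\<dots> = complex_of_real (1 / sqrt (2 * pi)) *
      (LINT t|lborel. exp (- \<i> * complex_of_real (s * t)) * complex_of_real (exp (- t\<^sup>2 / 2)))"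
    by (subst integral_mult_right_zero[symmetric]) (simp add: d scaleR_conv_of_real mult_ac)
  finally show "(LINT t|lborel. exp (- \<i> * complex_of_real (s * t)) * complex_of_real (exp (- t\<^sup>2 / 2)))
        = complex_of_real (sqrt (2 * pi) * exp (- s\<^sup>2 / 2))"
    by (simp add: field_simps)
qed

lemma integrable_gaussian: "integrable lborel (gaussian :: real^'n::finite \<Rightarrow> real)"
  unfolding gaussian_prod[abs_def]
  by (rule integrable_prod_components) (rule integrable_gaussian_real)

lemma fourier_gaussian:
  "fourier (\<lambda>x. complex_of_real (gaussian x)) p
    = complex_of_real (sqrt (2 * pi) ^ CARD('n) * gaussian (p :: real^'n::finite))"
proof -
  have "exp (- \<i> * complex_of_real (p \<bullet> x)) * complex_of_real (gaussian x) =
      (\<Prod>i\<in>UNIV. exp (- \<i> * complex_of_real (p $ i * x $ i)) * complex_of_real (exp (- (x $ i)\<^sup>2 / 2)))" for x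
  proof -
    have "exp (- \<i> * complex_of_real (p \<bullet> x)) = (\<Prod>i\<in>UNIV. exp (- \<i> * complex_of_real (p $ i * x $ i)))"
      by (simp add: inner_vec_def exp_sum[symmetric] sum_distrib_left sum_negf)
    then show ?thesis by (simp only: gaussian_prod of_real_prod prod.distrib)
  qed
  then have "fourier (\<lambda>x. complex_of_real (gaussian x)) p =
     (\<Prod>i\<in>UNIV. (LINT t|lborel. exp (- \<i> * complex_of_real (p $ i * t)) * complex_of_real (exp (- t\<^sup>2 / 2))))"
    unfolding fourier_def
    by (simp only:) (rule integral_prod_components[where g = "\<lambda>i t. exp (- \<i> * complex_of_real (p $ i * t)) * complex_of_real (exp (- t\<^sup>2 / 2))"],
        rule integrable_mult_bounded_kernel, auto intro!: integrable_of_real integrable_gaussian_real[simplified] simp del: of_real_exp)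
  also have "\<dots> = (\<Prod>i\<in>UNIV. complex_of_real (sqrt (2 * pi) * exp (- (p $ i)\<^sup>2 / 2)))"
    by (simp only: fourier_gaussian_real)
  also have "\<dots> = complex_of_real (sqrt (2 * pi) ^ CARD('n) * gaussian p)"
    by (simp add: gaussian_prod prod.distrib)
  finally show ?thesis .
qed

lemma integral_gaussian: "(LINT x::(real^'n::finite)|lborel. gaussian x) = sqrt (2 * pi) ^ CARD('n)"
proof -
  have "complex_of_real (LINT x::(real^'n)|lborel. gaussian x) = complex_of_real (sqrt (2 * pi) ^ CARD('n))"
    using fourier_gaussian[of "0 :: real^'n"] by (simp add: fourier_def gaussian_def)
  then show ?thesis by (simp only: of_real_eq_iff)
qed

text \<open>The kernel is left general because both signs of the exponent occur: the negative one in
  the multiplication formula, the positive one in Plancherel's theorem.\<close>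

lemma fubini_unimodular_kernel:
  fixes u v :: "real^'n::finite \<Rightarrow> complex"
  assumes u: "integrable lborel u" and v: "integrable lborel v"
    and k: "(\<lambda>(x, p). k x p) \<in> borel_measurable borel" "\<And>x p. cmod (k x p) = 1"
  shows "(LINT p|lborel. (LINT x|lborel. k x p * u x) * v p) = (LINT x|lborel. u x * (LINT p|lborel. k x p * v p))"
proof -
  have [measurable]: "u \<in> borel_measurable borel" "v \<in> borel_measurable borel"
    using u v by (auto dest: borel_measurable_integrable)
  have k'[measurable]: "(\<lambda>z. k (fst z) (snd z)) \<in> borel_measurable (borel \<Otimes>\<^sub>M borel)"
    using k(1) by (simp add: borel_prod case_prod_beta')
  have km: "(\<lambda>y. k x y) \<in> borel_measurable borel" for x
    using measurable_compose[OF measurable_Pair1' k', of x] by simp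
  have "integrable (lborel \<Otimes>\<^sub>M lborel) (\<lambda>(x, p). k x p * u x * v p)"
  proof (rule lborel_pair.Fubini_integrable)
    show "(\<lambda>(x, p). k x p * u x * v p) \<in> borel_measurable (lborel \<Otimes>\<^sub>M lborel)"
      unfolding case_prod_beta' by measurable
    show "integrable lborel (\<lambda>x. LINT y|lborel. cmod (case (x, y) of (x, p) \<Rightarrow> k x p * u x * v p))"
      using u by (simp add: norm_mult k(2))
    show "AE x in lborel. integrable lborel (\<lambda>y. case (x, y) of (x, p) \<Rightarrow> k x p * u x * v p)"
    proof (intro always_eventually allI)
      fix x
      have "integrable lborel (\<lambda>y. u x * (k x y * v y))"
        by (intro integrable_mult_right integrable_mult_bounded_kernel v) (simp_all add: k(2) km)
      then show "integrable lborel (\<lambda>y. case (x, y) of (x, p) \<Rightarrow> k x p * u x * v p)"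
        by (simp add: mult_ac)
    qed
  qed
  then have "(LINT p|lborel. (LINT x|lborel. k x p * u x * v p)) = (LINT x|lborel. (LINT p|lborel. k x p * u x * v p))"
    by (rule lborel_pair.Fubini_integral)
  moreover have "(LINT x|lborel. k x p * u x * v p) = (LINT x|lborel. k x p * u x) * v p" for p
    by (rule integral_mult_left_zero)
  moreover have "(LINT p|lborel. k x p * u x * v p) = u x * (LINT p|lborel. k x p * v p)" for x
    by (subst integral_mult_right_zero[symmetric]) (simp add: mult_ac)
  ultimately show ?thesis by simp
qed

lemma fourier_multiplication_formula:
  fixes u v :: "real^'n::finite \<Rightarrow> complex"
  assumes "integrable lborel u" "integrable lborel v"
  shows "(LINT p|lborel. fourier u p * v p) = (LINT x|lborel. u x * fourier v x)"
proof -
  have "(\<lambda>(x::real^'n, p). exp (- \<i> * complex_of_real (p \<bullet> x))) \<in> borel_measurable borel"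
    unfolding case_prod_beta' by (intro borel_measurable_continuous_onI continuous_intros)
  from fubini_unimodular_kernel[OF assms this] show ?thesis
    by (simp add: fourier_def inner_commute)
qed

lemma integrable_lborel_affine:
  fixes F :: "real^'n::finite \<Rightarrow> 'b::{banach,second_countable_topology}"
  assumes "integrable lborel F" "c \<noteq> 0"
  shows "integrable lborel (\<lambda>x. F (a + c *\<^sub>R x))"
proof -
  have [measurable]: "F \<in> borel_measurable borel" using assms by (auto dest: borel_measurable_integrable)
  have "integrable (density (distr lborel borel (\<lambda>x. a + c *\<^sub>R x)) (\<lambda>_. \<bar>c\<bar> ^ CARD('n))) F"
    using assms(1) lborel_affine[OF assms(2), of a] by simp
  then have "integrable lborel (\<lambda>x. \<bar>c\<bar> ^ CARD('n) *\<^sub>R F (a + c *\<^sub>R x))"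
    by (simp add: integrable_density integrable_distr_eq)
  from integrable_scaleR_right[OF this, of "inverse (\<bar>c\<bar> ^ CARD('n))"] show ?thesis
    using assms(2) by simp
qed

text \<open>Stated without negative powers of \<open>c\<close>: in the inversion proof the argument
  \<open>c *\<^sub>R p\<close> and the factor \<open>c ^ CARD('n)\<close> arise together from the
  substitution that removes the scale.\<close>

lemma fourier_affine:
  fixes f :: "real^'n::finite \<Rightarrow> complex"
  assumes c: "c > 0" and [measurable]: "f \<in> borel_measurable borel"
  shows "complex_of_real (c ^ CARD('n)) * fourier (\<lambda>z. f (a + c *\<^sub>R z)) (c *\<^sub>R p) = exp (\<i> * complex_of_real (p \<bullet> a)) * fourier f p"
proof -
  have "exp (\<i> * complex_of_real (p \<bullet> a)) * fourier f p =
      (LINT x|lborel. exp (\<i> * complex_of_real (p \<bullet> a)) * (exp (- \<i> * complex_of_real (p \<bullet> x)) * f x))"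
    by (simp add: fourier_def)
  also have "\<dots> = \<bar>c\<bar> ^ CARD('n) *\<^sub>R
      (LINT x|lborel. exp (\<i> * complex_of_real (p \<bullet> a)) * (exp (- \<i> * complex_of_real (p \<bullet> (a + c *\<^sub>R x))) * f (a + c *\<^sub>R x)))"
    by (rule integral_lborel_affine) (use c in auto)
  also have "(\<lambda>x. exp (\<i> * complex_of_real (p \<bullet> a)) * (exp (- \<i> * complex_of_real (p \<bullet> (a + c *\<^sub>R x))) * f (a + c *\<^sub>R x)))
      = (\<lambda>x. exp (- \<i> * complex_of_real ((c *\<^sub>R p) \<bullet> x)) * f (a + c *\<^sub>R x))"
    by (auto simp: fun_eq_iff inner_simps algebra_simps simp flip: exp_add)
  finally show ?thesis using c by (simp add: fourier_def scaleR_conv_of_real)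
qed

lemma integrable_cnj_fourier_mult:
  assumes f: "f \<in> schwartz" and g: "g \<in> schwartz"
  shows "integrable lborel (\<lambda>p. cnj (fourier f p) * fourier g p)"
proof -
  obtain C where C: "C \<ge> 0" "\<And>p. cmod (fourier f p) \<le> C * decay_weight p" using fourier_decay[OF f] by blast
  obtain D where D: "\<And>p. cmod (fourier g p) \<le> D * decay_weight p" using fourier_decay[OF g] by blast
  show ?thesis
    by (rule integrable_cnj_mult_of_decay[OF _ _ C(2) D C(1)]) (intro measurable_fourier schwartz_measurable f g)+
qed

lemma fourier_integrable: "f \<in> schwartz \<Longrightarrow> integrable lborel (fourier f)"
  using fourier_decay integrable_of_decay measurable_fourier schwartz_measurable by metis

text \<open>\<open>A n\<close> is evaluated in two ways. It averages \<open>f\<close> over a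
  Gaussian shrinking to \<open>x\<close>, so it tends to a multiple of \<open>f x\<close>; by the
  multiplication formula it also equals the inversion integral damped by a widening Gaussian. Both
  limits are taken by dominated convergence.\<close>

lemma fourier_inversion:
  fixes f :: "real^'n::finite \<Rightarrow> complex"
  assumes f: "f \<in> schwartz"
  shows "(LINT p|lborel. exp (\<i> * complex_of_real (p \<bullet> x)) * fourier f p) = complex_of_real ((2 * pi) ^ CARD('n)) * f x"
proof -
  let ?s = "sqrt (2 * pi) ^ CARD('n)"
  define t where "t = (\<lambda>n. inverse (real (Suc n)))"
  have t: "0 < t n" for n by (auto simp: t_def)
  have t0: "t \<longlonglongrightarrow> 0" unfolding t_def by (rule LIMSEQ_inverse_real_of_nat)
  note [measurable] = schwartz_measurable[OF f]
  obtain C where C: "C \<ge> 0" "\<And>x. cmod (f x) \<le> C" using schwartz_bounded[OF f] by blast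
  obtain D where D: "D \<ge> 0" "\<And>x. cmod (fourier f x) \<le> D * decay_weight x" using fourier_decay[OF f] by blast
  define A where "A = (\<lambda>n. LINT z|lborel. f (x + t n *\<^sub>R z) * complex_of_real (?s * gaussian z))"
  have contf: "isCont f y" for y
    using schwartz_differentiable[OF f] by (rule differentiable_imp_continuous_within)
  have "A \<longlonglongrightarrow> (LINT z::(real^'n)|lborel. f x * complex_of_real (?s * gaussian z))"
    unfolding A_def
  proof (rule integral_dominated_convergence[where w = "\<lambda>z::real^'n. C * ?s * gaussian z"])
    show "integrable lborel (\<lambda>z::real^'n. C * ?s * gaussian z)" by (intro integrable_mult_right integrable_gaussian)
    show "AE z in lborel. (\<lambda>n. f (x + t n *\<^sub>R z) * complex_of_real (?s * gaussian z)) \<longlonglongrightarrow> f x * complex_of_real (?s * gaussian z)"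
    proof (intro always_eventually allI tendsto_mult_right)
      fix z :: "real^'n"
      have "(\<lambda>n. x + t n *\<^sub>R z) \<longlonglongrightarrow> x + 0 *\<^sub>R z" by (intro tendsto_intros t0)
      then show "(\<lambda>n. f (x + t n *\<^sub>R z)) \<longlonglongrightarrow> f x" using isCont_tendsto_compose[OF contf] by fastforce
    qed
    show "AE z in lborel. cmod (f (x + t n *\<^sub>R z) * complex_of_real (?s * gaussian z)) \<le> C * ?s * gaussian z" for n
      by (intro always_eventually allI) (simp add: norm_mult norm_power C gaussian_def mult_right_mono mult.assoc)
  qed auto
  also have "(LINT z::(real^'n)|lborel. f x * complex_of_real (?s * gaussian z)) = complex_of_real (?s * ?s) * f x"
    by (simp add: integral_gaussian mult.assoc)
  \<comment> \<open>One factor \<open>?s\<close> comes from the transform of the Gaussian, the other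
    from its integral.\<close>
  also have "?s * ?s = (2 * pi) ^ CARD('n)" by (subst power_mult_distrib[symmetric]) simp
  finally have lim1: "A \<longlonglongrightarrow> complex_of_real ((2 * pi) ^ CARD('n)) * f x" .
  have A: "A n = (LINT r|lborel. exp (\<i> * complex_of_real (r \<bullet> x)) * fourier f r * complex_of_real (gaussian (t n *\<^sub>R r)))" for n
  proof -
    let ?u = "\<lambda>z. f (x + t n *\<^sub>R z)"
    have "A n = (LINT z|lborel. ?u z * fourier (\<lambda>x. complex_of_real (gaussian x)) z)"
      by (simp only: A_def fourier_gaussian)
    also have "\<dots> = (LINT p|lborel. fourier ?u p * complex_of_real (gaussian p))"
      by (rule fourier_multiplication_formula[symmetric])
        (use t[of n] in \<open>auto intro!: integrable_lborel_affine schwartz_integrable[OF f] integrable_gaussian\<close>)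
    \<comment> \<open>The substitution \<open>p = t n *\<^sub>R r\<close> undoes the scaling inside
      \<open>?u\<close>.\<close>
    also have "\<dots> = \<bar>t n\<bar> ^ CARD('n) *\<^sub>R (LINT r|lborel. fourier ?u (0 + t n *\<^sub>R r) * complex_of_real (gaussian (0 + t n *\<^sub>R r)))"
      by (rule integral_lborel_affine) (use t[of n] in auto)
    also have "\<dots> = (LINT r|lborel. complex_of_real (t n ^ CARD('n)) * fourier ?u (t n *\<^sub>R r) * complex_of_real (gaussian (t n *\<^sub>R r)))"
      using t[of n] by (simp add: scaleR_conv_of_real mult.assoc)
    also have "\<dots> = (LINT r|lborel. exp (\<i> * complex_of_real (r \<bullet> x)) * fourier f r * complex_of_real (gaussian (t n *\<^sub>R r)))"
      by (simp only: fourier_affine[OF t \<open>f \<in> borel_measurable borel\<close>])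
    finally show ?thesis .
  qed
  have [measurable]: "(\<lambda>r. exp (\<i> * complex_of_real (r \<bullet> x))) \<in> borel_measurable borel"
    by (intro borel_measurable_continuous_onI continuous_intros)
  have "A \<longlonglongrightarrow> (LINT r|lborel. exp (\<i> * complex_of_real (r \<bullet> x)) * fourier f r)"
    unfolding A
  proof (rule integral_dominated_convergence[where w = "\<lambda>r::real^'n. D * decay_weight r"])
    show "integrable lborel (\<lambda>r::real^'n. D * decay_weight r)" by (intro integrable_mult_right integrable_decay_weight)
    show "AE r in lborel. (\<lambda>n. exp (\<i> * complex_of_real (r \<bullet> x)) * fourier f r * complex_of_real (gaussian (t n *\<^sub>R r)))
        \<longlonglongrightarrow> exp (\<i> * complex_of_real (r \<bullet> x)) * fourier f r"
    proof (intro always_eventually allI)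
      fix r :: "real^'n"
      have "(\<lambda>n. complex_of_real (gaussian (t n *\<^sub>R r))) \<longlonglongrightarrow> complex_of_real (exp (- ((0 *\<^sub>R r) \<bullet> (0 *\<^sub>R r)) / 2))"
        unfolding gaussian_def by (intro tendsto_intros t0) auto
      from tendsto_mult_left[OF this, of "exp (\<i> * complex_of_real (r \<bullet> x)) * fourier f r"]
      show "(\<lambda>n. exp (\<i> * complex_of_real (r \<bullet> x)) * fourier f r * complex_of_real (gaussian (t n *\<^sub>R r)))
        \<longlonglongrightarrow> exp (\<i> * complex_of_real (r \<bullet> x)) * fourier f r" by simp
    qed
    show "AE r in lborel. cmod (exp (\<i> * complex_of_real (r \<bullet> x)) * fourier f r * complex_of_real (gaussian (t n *\<^sub>R r))) \<le> D * decay_weight r" for n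
    proof (intro always_eventually allI)
      fix r :: "real^'n"
      have "0 \<le> gaussian (t n *\<^sub>R r)" "gaussian (t n *\<^sub>R r) \<le> 1" by (auto simp: gaussian_nonneg gaussian_le_1)
      then have "cmod (fourier f r) * gaussian (t n *\<^sub>R r) \<le> cmod (fourier f r)" by (intro mult_left_le) auto
      with D(2)[of r] \<open>0 \<le> gaussian (t n *\<^sub>R r)\<close>
      show "cmod (exp (\<i> * complex_of_real (r \<bullet> x)) * fourier f r * complex_of_real (gaussian (t n *\<^sub>R r))) \<le> D * decay_weight r"
        by (simp add: norm_mult)
    qed
  qed measurable
  with lim1 show ?thesis by (rule LIMSEQ_unique[THEN sym])
qed

text \<open>Writing the conjugate transform as an integral and exchanging the order of integration
  leaves the inversion integral of \<open>g\<close> inside.\<close>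

lemma plancherel:
  fixes f g :: "real^'n::finite \<Rightarrow> complex"
  assumes f: "f \<in> schwartz" and g: "g \<in> schwartz"
  shows "(LINT p|lborel. cnj (fourier f p) * fourier g p) = complex_of_real ((2 * pi) ^ CARD('n)) * l2_inner f g"
proof -
  have k: "(\<lambda>(x::real^'n, p). exp (\<i> * complex_of_real (p \<bullet> x))) \<in> borel_measurable borel"
    unfolding case_prod_beta' by (intro borel_measurable_continuous_onI continuous_intros)
  have cnj: "cnj (fourier f p) = (LINT x|lborel. exp (\<i> * complex_of_real (p \<bullet> x)) * cnj (f x))" for p
    unfolding fourier_def by (subst Bochner_Integration.integral_cnj[symmetric]) (simp add: exp_cnj)
  have "(LINT p|lborel. cnj (fourier f p) * fourier g p) =
      (LINT x|lborel. cnj (f x) * (LINT p|lborel. exp (\<i> * complex_of_real (p \<bullet> x)) * fourier g p))"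
    unfolding cnj
    by (rule fubini_unimodular_kernel[OF _ _ k]) (auto intro: schwartz_integrable fourier_integrable f g)
  also have "\<dots> = (LINT x|lborel. complex_of_real ((2 * pi) ^ CARD('n)) * (cnj (f x) * g x))"
    by (simp only: fourier_inversion[OF g] mult.left_commute)
  finally show ?thesis by (simp add: l2_inner_def)
qed

section \<open>The Gaussian is a Schwartz function\<close>

inductive polynomial_in_components :: "(real^'n::finite \<Rightarrow> real) \<Rightarrow> bool" where
  const: "polynomial_in_components (\<lambda>_. c)"
| component: "polynomial_in_components (\<lambda>x. x $ i)"
| add: "polynomial_in_components p \<Longrightarrow> polynomial_in_components q \<Longrightarrow> polynomial_in_components (\<lambda>x. p x + q x)"
| mult: "polynomial_in_components p \<Longrightarrow> polynomial_in_components q \<Longrightarrow> polynomial_in_components (\<lambda>x. p x * q x)"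

lemma polynomial_has_derivative:
  fixes p :: "real^'n::finite \<Rightarrow> real"
  assumes "polynomial_in_components p"
  shows "\<exists>D. (\<forall>x. (p has_derivative D x) (at x)) \<and> (\<forall>i. polynomial_in_components (\<lambda>x. D x (axis i 1)))"
  using assms
proof induction
  case (const c)
  then show ?case by (intro exI[of _ "\<lambda>_ _. 0"]) (auto intro: polynomial_in_components.const)
next
  case (component j)
  have "(\<lambda>x::real^'n. (axis i 1 :: real^'n) $ j) = (\<lambda>_. if i = j then 1 else 0)" for i
    by (auto simp: axis_def)
  then show ?case
    by (intro exI[of _ "\<lambda>_ h. h $ j"])
      (auto intro: polynomial_in_components.const intro!: bounded_linear_imp_has_derivative bounded_linear_vec_nth)
next
  case (add p q)
  from add.IH(1) obtain D where D: "\<forall>x. (p has_derivative D x) (at x)" "\<forall>i. polynomial_in_components (\<lambda>x. D x (axis i 1))"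
    by (elim exE conjE)
  from add.IH(2) obtain E where E: "\<forall>x. (q has_derivative E x) (at x)" "\<forall>i. polynomial_in_components (\<lambda>x. E x (axis i 1))"
    by (elim exE conjE)
  from D E show ?case
    by (intro exI[of _ "\<lambda>x h. D x h + E x h"])
      (auto intro: polynomial_in_components.add has_derivative_add)
next
  case (mult p q)
  from mult.IH(1) obtain D where D: "\<forall>x. (p has_derivative D x) (at x)" "\<forall>i. polynomial_in_components (\<lambda>x. D x (axis i 1))"
    by (elim exE conjE)
  from mult.IH(2) obtain E where E: "\<forall>x. (q has_derivative E x) (at x)" "\<forall>i. polynomial_in_components (\<lambda>x. E x (axis i 1))"
    by (elim exE conjE)
  from D E mult.hyps show ?case
    by (intro exI[of _ "\<lambda>x h. p x * E x h + D x h * q x"])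
      (auto intro!: polynomial_in_components.add polynomial_in_components.mult has_derivative_mult)
qed

lemma polynomial_growth:
  assumes "polynomial_in_components p"
  shows "\<exists>C k. C \<ge> 0 \<and> (\<forall>x. \<bar>p x\<bar> \<le> C * (1 + norm x) ^ k)"
  using assms
proof induction
  case (const c)
  then show ?case by (intro exI[of _ "\<bar>c\<bar>"] exI[of _ 0]) auto
next
  case (component i)
  show ?case
    by (intro exI[of _ 1] exI[of _ "1::nat"]) (auto intro: order_trans[OF component_le_norm_cart])
next
  case (add p q)
  then obtain A k B l where *: "A \<ge> 0" "\<And>x. \<bar>p x\<bar> \<le> A * (1 + norm x) ^ k" "B \<ge> 0" "\<And>x. \<bar>q x\<bar> \<le> B * (1 + norm x) ^ l"
    by blast
  have "\<bar>p x + q x\<bar> \<le> (A + B) * (1 + norm x) ^ max k l" for x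
  proof -
    have "A * (1 + norm x) ^ k \<le> A * (1 + norm x) ^ max k l" "B * (1 + norm x) ^ l \<le> B * (1 + norm x) ^ max k l"
      using * by (auto intro!: mult_left_mono power_increasing)
    then show ?thesis using *(2)[of x] *(4)[of x] by (simp add: distrib_right abs_le_iff)
  qed
  then show ?case using * by (intro exI[of _ "A + B"] exI[of _ "max k l"]) auto
next
  case (mult p q)
  then obtain A k B l where *: "A \<ge> 0" "\<And>x. \<bar>p x\<bar> \<le> A * (1 + norm x) ^ k" "B \<ge> 0" "\<And>x. \<bar>q x\<bar> \<le> B * (1 + norm x) ^ l"
    by blast
  have "\<bar>p x * q x\<bar> \<le> (A * B) * (1 + norm x) ^ (k + l)" for x
    using mult_mono[OF *(2)[of x] *(4)[of x]] *(1) by (simp add: abs_mult power_add mult_ac)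
  then show ?case using * by (intro exI[of _ "A * B"] exI[of _ "k + l"]) auto
qed

text \<open>\<open>(1 + r) ^ m\<close> is at most \<open>exp (m r)\<close>, and completing the
  square bounds \<open>m r - r^2 / 2\<close> by \<open>m^2 / 2\<close>.\<close>

lemma power_times_exp_bounded:
  assumes "0 \<le> r" shows "(1 + r) ^ m * exp (- r\<^sup>2 / 2) \<le> exp ((real m)\<^sup>2 / 2)"
proof -
  have "(1 + r) ^ m \<le> exp r ^ m" using assms by (intro power_mono exp_ge_add_one_self) auto
  also have "\<dots> = exp (real m * r)" by (rule exp_of_nat_mult[symmetric])
  finally have "(1 + r) ^ m * exp (- r\<^sup>2 / 2) \<le> exp (real m * r) * exp (- r\<^sup>2 / 2)"
    by (rule mult_right_mono) simp
  also have "\<dots> = exp (real m * r - r\<^sup>2 / 2)" by (simp flip: exp_add)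
  also have "real m * r - r\<^sup>2 / 2 \<le> (real m)\<^sup>2 / 2"
    using zero_le_power2[of "real m - r"] by (simp add: power2_diff)
  finally show ?thesis by simp
qed

text \<open>It provides a test function with nonzero integral, which tells the limit states apart.
  Polynomials times the Gaussian form a class \<open>G\<close> closed under every partial
  derivative, and each member is rapidly decreasing, so that induction on the list of derivatives
  suffices.\<close>

lemma gaussian_schwartz: "(\<lambda>x. complex_of_real (gaussian x)) \<in> (schwartz :: (real^'n::finite \<Rightarrow> complex) set)"
proof -
  define G where "G = {\<lambda>x::real^'n. complex_of_real (p x * gaussian x) |p. polynomial_in_components p}"
  have g': "(gaussian has_derivative (\<lambda>h. - (x \<bullet> h) * gaussian x)) (at x)" for x :: "real^'n"
    unfolding gaussian_def[abs_def]
    by (auto intro!: derivative_eq_intros simp: inner_commute fun_eq_iff)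
  have G_deriv: "f differentiable (at x) \<and> partial_deriv i f \<in> G" if fG: "f \<in> G" for f i x
  proof -
    obtain p where p: "polynomial_in_components p" and f: "f = (\<lambda>x. complex_of_real (p x * gaussian x))"
      using fG by (auto simp: G_def)
    obtain D where D: "\<And>x. (p has_derivative D x) (at x)" "\<And>i. polynomial_in_components (\<lambda>x. D x (axis i 1))"
      using polynomial_has_derivative[OF p] by (elim exE conjE) metis
    have der: "(f has_derivative (\<lambda>h. complex_of_real (p x * (- (x \<bullet> h) * gaussian x) + D x h * gaussian x))) (at x)" for x
      unfolding f by (intro has_derivative_of_real has_derivative_mult D g')
    have "partial_deriv i f = (\<lambda>x. complex_of_real ((p x * (-1 * x $ i) + D x (axis i 1)) * gaussian x))"
      by (rule ext) (simp add: partial_deriv_eq[OF der] inner_axis algebra_simps)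
    moreover have "polynomial_in_components (\<lambda>x. p x * (-1 * x $ i) + D x (axis i 1))"
      by (intro polynomial_in_components.intros p D)
    ultimately have "partial_deriv i f \<in> G"
      unfolding G_def by (intro CollectI exI[of _ "\<lambda>x. p x * (-1 * x $ i) + D x (axis i 1)"] conjI)
    then show ?thesis using der unfolding differentiable_def by blast
  qed
  have G_bdd: "bounded (range (\<lambda>x. norm x ^ k *\<^sub>R f x))" if fG: "f \<in> G" for f k
  proof -
    obtain p where p: "polynomial_in_components p" and f: "f = (\<lambda>x. complex_of_real (p x * gaussian x))"
      using fG by (auto simp: G_def)
    obtain C l where C: "C \<ge> 0" "\<And>x. \<bar>p x\<bar> \<le> C * (1 + norm x) ^ l" using polynomial_growth[OF p] by (elim exE conjE) metis
    define B where "B = exp ((real (k + l))\<^sup>2 / 2)"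
    have "norm (norm x ^ k *\<^sub>R f x) \<le> C * B" for x
    proof -
      have "norm (norm x ^ k *\<^sub>R f x) = norm x ^ k * (\<bar>p x\<bar> * gaussian x)"
        by (simp add: f norm_mult gaussian_def)
      also have "\<dots> \<le> (1 + norm x) ^ k * (C * (1 + norm x) ^ l * gaussian x)"
        by (intro mult_mono power_mono mult_right_mono C) (auto simp: gaussian_def)
      also have "\<dots> = C * ((1 + norm x) ^ (k + l) * exp (- (norm x)\<^sup>2 / 2))"
        by (simp add: gaussian_def power_add dot_square_norm)
      also have "\<dots> \<le> C * B" unfolding B_def by (intro mult_left_mono power_times_exp_bounded C) auto
      finally show ?thesis .
    qed
    then show ?thesis unfolding bounded_iff by blast
  qed
  have "(\<lambda>x. complex_of_real (gaussian x)) \<in> G"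
    unfolding G_def by (auto intro!: exI[of _ "\<lambda>_. 1"] polynomial_in_components.const)
  then have "iter_partial_deriv is (\<lambda>x. complex_of_real (gaussian x)) \<in> G" for "is"
    by (induction "is") (use G_deriv in auto)
  then show ?thesis unfolding schwartz_def using G_deriv G_bdd by blast
qed

section \<open>The classical Weyl algebra and its states\<close>

abbreviation (input) keys where "keys \<equiv> Poly_Mapping.keys"
abbreviation (input) lookup where "lookup \<equiv> Poly_Mapping.lookup"
abbreviation (input) single where "single \<equiv> Poly_Mapping.single"

text \<open>Values on sums are computed through \<open>lin_ext_add\<close>, which absorbs
  cancellations and coinciding keys, so that supports need not be tracked.\<close>

definition lin_ext :: "('a \<Rightarrow> complex) \<Rightarrow> ('a \<Rightarrow>\<^sub>0 complex) \<Rightarrow> complex" where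
  "lin_ext \<phi> a = (\<Sum>f\<in>keys a. lookup a f * \<phi> f)"

lemma lin_ext_zero [simp]: "lin_ext \<phi> 0 = 0"
  by (simp add: lin_ext_def)

lemma lin_ext_add: "lin_ext \<phi> (a + b) = lin_ext \<phi> a + lin_ext \<phi> b"
  unfolding lin_ext_def by (rule setsum_keys_plus_distrib) (auto simp: algebra_simps)

lemma lin_ext_sum: "lin_ext \<phi> (\<Sum>i\<in>I. a i) = (\<Sum>i\<in>I. lin_ext \<phi> (a i))"
  by (induction I rule: infinite_finite_induct) (auto simp: lin_ext_add)

lemma lin_ext_single [simp]: "lin_ext \<phi> (single f c) = c * \<phi> f"
  by (cases "c = 0") (auto simp: lin_ext_def)

lemma sum_single_lookup:
  fixes a :: "'a \<Rightarrow>\<^sub>0 complex"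
  shows "(\<Sum>f\<in>keys a. single f (lookup a f)) = a"
proof (rule poly_mapping_eqI)
  fix k
  have "lookup (\<Sum>f\<in>keys a. single f (lookup a f)) k
      = (\<Sum>f\<in>keys a. if f = k then lookup a f else 0)"
    by (simp add: lookup_sum lookup_single when_def)
  also have "\<dots> = lookup a k"
    by (auto simp: not_in_keys_iff_lookup_eq_zero)
  finally show "lookup (\<Sum>f\<in>keys a. single f (lookup a f)) k = lookup a k" .
qed

lemma mult_eq_sum_single:
  fixes a b :: "'a::comm_monoid_add \<Rightarrow>\<^sub>0 complex"
  shows "a * b = (\<Sum>f\<in>keys a. \<Sum>g\<in>keys b.
      single (f + g) (lookup a f * lookup b g))"
proof -
  have "a * b = (\<Sum>f\<in>keys a. single f (lookup a f)) *
     (\<Sum>f\<in>keys b. single f (lookup b f))"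
    by (simp only: sum_single_lookup)
  then show ?thesis by (simp only: sum_product mult_single)
qed

abbreviation classical_poly :: "'n::finite weyl_poly star_algebra" where
  "classical_poly \<equiv> weyl_poly_algebra 0"

definition weyl_star :: "'n::finite weyl_poly \<Rightarrow> 'n weyl_poly" where
  "weyl_star a = (\<Sum>f\<in>keys a. single (- f) (cnj (lookup a f)))"

abbreviation W :: "(real^'n::finite \<Rightarrow> complex) \<Rightarrow> 'n weyl_poly" where
  "W f \<equiv> single f 1"

abbreviation scal :: "complex \<Rightarrow> 'n::finite weyl_poly" where
  "scal c \<equiv> single 0 c"

definition weyl_polys :: "'n::finite weyl_poly set" where
  "weyl_polys = {a. keys a \<subseteq> schwartz}"

text \<open>At \<open>h = 0\<close> the phase in the product equals 1, so the product is the
  convolution of finitely supported functions, and scaling is convolution with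
  \<open>single 0 c\<close>. From here on computations take place in that commutative ring.\<close>

lemma classical_poly_simps [simp]:
  "carrier classical_poly = weyl_polys"
  "a \<otimes>\<^bsub>classical_poly\<^esub> b = a * b"
  "\<one>\<^bsub>classical_poly\<^esub> = 1"
  "\<zero>\<^bsub>classical_poly\<^esub> = 0"
  "a \<oplus>\<^bsub>classical_poly\<^esub> b = a + b"
  "c \<odot>\<^bsub>classical_poly\<^esub> a = scal c * a"
  "star classical_poly = weyl_star"
  by (simp_all add: weyl_poly_algebra_def weyl_polys_def mult_eq_sum_single[of a b] mult_map_scale_conv_mult
      weyl_star_def fun_eq_iff)

lemma alg_diff_classical_poly [simp]: "alg_diff classical_poly a b = a - b"
  by (simp add: alg_diff_def single_uminus)

text \<open>A coefficientwise description, from which the additive rules for the star follow by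
  comparing coefficients.\<close>

lemma lookup_weyl_star: "lookup (weyl_star a) f = cnj (lookup a (- f))"
proof -
  have "lookup (weyl_star a) f =
     (\<Sum>g\<in>keys a. if g = - f then cnj (lookup a g) else 0)"
    unfolding weyl_star_def lookup_sum lookup_single when_def
    by (intro sum.cong refl if_cong) (auto simp: minus_equation_iff)
  then show ?thesis by (auto simp: not_in_keys_iff_lookup_eq_zero)
qed

lemma weyl_star_add: "weyl_star (a + b) = weyl_star a + weyl_star b"
  by (rule poly_mapping_eqI) (simp add: lookup_weyl_star lookup_add)

lemma weyl_star_minus: "weyl_star (a - b) = weyl_star a - weyl_star b"
  by (rule poly_mapping_eqI) (simp add: lookup_weyl_star lookup_minus)

lemma weyl_star_zero [simp]: "weyl_star 0 = 0"
  by (rule poly_mapping_eqI) (simp add: lookup_weyl_star)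

lemma weyl_star_single [simp]: "weyl_star (single f c) = single (- f) (cnj c)"
  by (cases "c = 0") (simp_all add: weyl_star_def)

lemma weyl_star_one [simp]: "weyl_star 1 = 1"
  using weyl_star_single[of 0 1] by simp

lemma weyl_star_sum: "weyl_star (\<Sum>i\<in>I. a i) = (\<Sum>i\<in>I. weyl_star (a i))"
  by (induction I rule: infinite_finite_induct) (auto simp: weyl_star_add)

lemma weyl_star_star [simp]: "weyl_star (weyl_star a) = a"
  by (rule poly_mapping_eqI) (simp add: lookup_weyl_star)

lemma weyl_star_mult: "weyl_star (a * b) = weyl_star a * weyl_star b"
proof -
  have "weyl_star (a * b) = (\<Sum>f\<in>keys a. \<Sum>g\<in>keys b.
      single (- f) (cnj (lookup a f)) * single (- g) (cnj (lookup b g)))"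
    unfolding mult_eq_sum_single[of a b] by (simp add: weyl_star_sum mult_single add.commute)
  also have "\<dots> = weyl_star a * weyl_star b"
    unfolding weyl_star_def sum_product ..
  finally show ?thesis .
qed

lemma scal_mult: "scal c * scal d = scal (c * d)" by (simp add: mult_single)

lemma weyl_polys_closed [simp, intro]:
  shows "0 \<in> weyl_polys" "1 \<in> weyl_polys" "f \<in> schwartz \<Longrightarrow> single f c \<in> weyl_polys"
    and "a \<in> weyl_polys \<Longrightarrow> b \<in> weyl_polys \<Longrightarrow> a + b \<in> weyl_polys"
    and "a \<in> weyl_polys \<Longrightarrow> b \<in> weyl_polys \<Longrightarrow> a - b \<in> weyl_polys"
    and "a \<in> weyl_polys \<Longrightarrow> b \<in> weyl_polys \<Longrightarrow> a * b \<in> weyl_polys"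
    and "a \<in> weyl_polys \<Longrightarrow> - a \<in> weyl_polys"
    and "a \<in> weyl_polys \<Longrightarrow> scal c * a \<in> weyl_polys"
    and "a \<in> weyl_polys \<Longrightarrow> weyl_star a \<in> weyl_polys"
proof -
  show z: "0 \<in> weyl_polys" by (simp add: weyl_polys_def)
  show s: "f \<in> schwartz \<Longrightarrow> single f c \<in> weyl_polys" for f c by (simp add: weyl_polys_def)
  show "1 \<in> weyl_polys" using s[of 0 1] schwartz_zero by simp
  show "a \<in> weyl_polys \<Longrightarrow> b \<in> weyl_polys \<Longrightarrow> a + b \<in> weyl_polys"
    using keys_add[of a b] unfolding weyl_polys_def by blast
  show "a \<in> weyl_polys \<Longrightarrow> b \<in> weyl_polys \<Longrightarrow> a - b \<in> weyl_polys"
    using keys_diff[of a b] unfolding weyl_polys_def by blast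
  show m: "a \<in> weyl_polys \<Longrightarrow> b \<in> weyl_polys \<Longrightarrow> a * b \<in> weyl_polys" for a b
    using keys_mult[of a b] schwartz_add unfolding weyl_polys_def by blast
  show "a \<in> weyl_polys \<Longrightarrow> - a \<in> weyl_polys"
    by (auto simp: weyl_polys_def in_keys_iff)
  show "a \<in> weyl_polys \<Longrightarrow> scal c * a \<in> weyl_polys" by (intro m s schwartz_zero)
  have "f \<in> schwartz" if "a \<in> weyl_polys" "f \<in> keys (weyl_star a)" for f
  proof -
    have "- f \<in> keys a" using that(2) by (simp add: in_keys_iff lookup_weyl_star)
    then have "- f \<in> schwartz" using that(1) by (auto simp: weyl_polys_def)
    from schwartz_uminus[OF this] show ?thesis by simp
  qed
  then show "a \<in> weyl_polys \<Longrightarrow> weyl_star a \<in> weyl_polys"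
    by (auto simp: weyl_polys_def)
qed

lemma weyl_polys_sum: "(\<And>i. i \<in> I \<Longrightarrow> a i \<in> weyl_polys) \<Longrightarrow> (\<Sum>i\<in>I. a i) \<in> weyl_polys"
  by (induction I rule: infinite_finite_induct) (simp_all)

lemma cnj_mult_self: "cnj z * z = complex_of_real ((cmod z)\<^sup>2)"
  by (subst mult.commute) (rule complex_norm_square[symmetric])

text \<open>A bound for the seminorm in every state at once, since each \<open>W f\<close> acts
  isometrically; it makes the supremum in the maximal norm finite.\<close>

definition l1_norm :: "('a \<Rightarrow>\<^sub>0 complex) \<Rightarrow> real" where
  "l1_norm a = (\<Sum>f\<in>keys a. cmod (lookup a f))"

lemma binomial_product:
  fixes a b c d x y :: "'a::comm_ring_1"
  shows "(a + y * b) * (c + x * d) = a * c + x * (a * d) + y * (b * c) + (y * x) * (b * d)"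
  by (simp add: algebra_simps)

section \<open>Positivity, Cauchy-Schwarz and the seminorm of a state on polynomials\<close>

locale classical_state =
  fixes s :: "'n::finite weyl_poly \<Rightarrow> complex"
  assumes state: "is_state classical_poly s"
begin

lemma add: "a \<in> weyl_polys \<Longrightarrow> b \<in> weyl_polys \<Longrightarrow> s (a + b) = s a + s b"
  and scal: "a \<in> weyl_polys \<Longrightarrow> s (scal c * a) = c * s a"
  and pos: "a \<in> weyl_polys \<Longrightarrow> s (weyl_star a * a) \<in> \<real>\<^sub>\<ge>\<^sub>0"
  and one: "s 1 = 1"
  using state unfolding is_state_def by simp_all

lemma minus: "a \<in> weyl_polys \<Longrightarrow> b \<in> weyl_polys \<Longrightarrow> s (a - b) = s a - s b"
  using add[of a "scal (-1) * b"] scal[of b "-1"] by (simp add: single_uminus)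

lemma zero: "s 0 = 0" using minus[of 0 0] by simp

lemma sum: "(\<And>i. i \<in> I \<Longrightarrow> a i \<in> weyl_polys) \<Longrightarrow> s (\<Sum>i\<in>I. a i) = (\<Sum>i\<in>I. s (a i))"
proof (induction I rule: infinite_finite_induct)
  case (insert i I)
  then show ?case using add[of "a i" "\<Sum>i\<in>I. a i"] weyl_polys_sum[of I a] by (simp)
qed (simp_all add: zero)

text \<open>The GNS seminorm on the level of polynomials, that is, the norm of the vector obtained
  from the cyclic vector.\<close>

definition n :: "'n weyl_poly \<Rightarrow> real" where
  "n a = sqrt (Re (s (weyl_star a * a)))"

lemma pos_Re: "a \<in> weyl_polys \<Longrightarrow> 0 \<le> Re (s (weyl_star a * a))"
  and pos_Im: "a \<in> weyl_polys \<Longrightarrow> Im (s (weyl_star a * a)) = 0"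
  using pos by (auto simp: complex_nonneg_Reals_iff)

lemma n_nonneg: "a \<in> weyl_polys \<Longrightarrow> 0 \<le> n a" by (simp add: n_def pos_Re)

lemma n_square: "a \<in> weyl_polys \<Longrightarrow> (n a)\<^sup>2 = Re (s (weyl_star a * a))"
  by (simp add: n_def pos_Re)

lemma s_square: "a \<in> weyl_polys \<Longrightarrow> s (weyl_star a * a) = complex_of_real ((n a)\<^sup>2)"
  by (simp add: n_square complex_eq_iff pos_Im)

lemma expand:
  assumes a: "a \<in> weyl_polys" and b: "b \<in> weyl_polys"
  shows "s (weyl_star (a + scal z * b) * (a + scal z * b)) =
    s (weyl_star a * a) + z * s (weyl_star a * b) + cnj z * s (weyl_star b * a) + cnj z * z * s (weyl_star b * b)"
proof -
  have "weyl_star (a + scal z * b) = weyl_star a + scal (cnj z) * weyl_star b"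
    by (simp add: weyl_star_add weyl_star_mult)
  then have *: "weyl_star (a + scal z * b) * (a + scal z * b) =
      weyl_star a * a + scal z * (weyl_star a * b) + scal (cnj z) * (weyl_star b * a) + scal (cnj z * z) * (weyl_star b * b)"
    by (simp only: binomial_product scal_mult)
  show ?thesis
    unfolding * using a b by (simp only: add scal weyl_polys_closed)
qed

lemma expand_real:
  assumes a: "a \<in> weyl_polys" and b: "b \<in> weyl_polys"
  shows "s (weyl_star (a + scal z * b) * (a + scal z * b)) =
    complex_of_real ((n a)\<^sup>2 + (cmod z)\<^sup>2 * (n b)\<^sup>2) + (z * s (weyl_star a * b) + cnj z * s (weyl_star b * a))"
  unfolding expand[OF a b] cnj_mult_self s_square[OF a] s_square[OF b] of_real_add of_real_mult
  by (simp only: add_ac)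

text \<open>Positivity makes the cross terms in the expansion at \<open>a + z b\<close> real for all
  \<open>z\<close>; the values 1 and \<i> of \<open>z\<close> determine both parts.\<close>

lemma hermitian:
  assumes a: "a \<in> weyl_polys" and b: "b \<in> weyl_polys"
  shows "s (weyl_star b * a) = cnj (s (weyl_star a * b))"
proof -
  have im: "Im (z * s (weyl_star a * b) + cnj z * s (weyl_star b * a)) = 0" for z
  proof -
    have "a + scal z * b \<in> weyl_polys" by (intro weyl_polys_closed a b)
    from pos_Im[OF this] show ?thesis
      unfolding expand_real[OF a b] by (simp only: plus_complex.sel Im_complex_of_real add_0_left)
  qed
  show ?thesis using im[of 1] im[of \<i>] by (simp add: complex_eq_iff)
qed

lemma cauchy_schwarz:
  assumes a: "a \<in> weyl_polys" and b: "b \<in> weyl_polys"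
  shows "cmod (s (weyl_star a * b)) \<le> n a * n b"
proof -
  define w where "w = s (weyl_star a * b)"
  have key: "0 \<le> (n a)\<^sup>2 - 2 * r * (cmod w)\<^sup>2 + r\<^sup>2 * (cmod w)\<^sup>2 * (n b)\<^sup>2" for r :: real
  proof -
    \<comment> \<open>The phase of \<open>z\<close> turns the cross term into a real multiple of
      |w|^2, leaving a quadratic polynomial in the real parameter \<open>r\<close>.\<close>
    define z where "z = - complex_of_real r * cnj w"
    have "a + scal z * b \<in> weyl_polys" by (intro weyl_polys_closed a b)
    then have "0 \<le> Re (s (weyl_star (a + scal z * b) * (a + scal z * b)))" by (rule pos_Re)
    also have "\<dots> = (n a)\<^sup>2 + 2 * Re (z * w) + (cmod z)\<^sup>2 * (n b)\<^sup>2"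
    proof -
      have "Re (cnj z * cnj w) = Re (z * w)" by (simp only: complex_cnj_mult[symmetric] cnj.sel)
      then show ?thesis
        unfolding expand_real[OF a b] hermitian[OF a b] w_def[symmetric] plus_complex.sel Re_complex_of_real
        by linarith
    qed
    also have "Re (z * w) = - r * (cmod w)\<^sup>2"
      by (simp add: z_def cmod_power2) (simp add: power2_eq_square algebra_simps)
    also have "(cmod z)\<^sup>2 = r\<^sup>2 * (cmod w)\<^sup>2" by (simp add: z_def norm_mult power_mult_distrib)
    finally show ?thesis by simp
  qed
  have "(cmod w)\<^sup>2 \<le> (n a * n b)\<^sup>2"
  proof (cases "n b = 0")
    case True
    have "w = 0"
    proof (rule ccontr)
      assume "w \<noteq> 0"
      then have "0 < (cmod w)\<^sup>2" by simp
      \<comment> \<open>With this \<open>r\<close> the polynomial, affine when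
        \<open>n b = 0\<close>, takes the value -1.\<close>
      then show False using key[of "((n a)\<^sup>2 + 1) / (2 * (cmod w)\<^sup>2)"] True by simp
    qed
    then show ?thesis by simp
  next
    case False
    then have nb: "(n b)\<^sup>2 > 0" by simp
    \<comment> \<open>The value \<open>1 / (n b)^2\<close> of \<open>r\<close> minimises the
      quadratic polynomial.\<close>
    have "(1 / (n b)\<^sup>2)\<^sup>2 * (cmod w)\<^sup>2 * (n b)\<^sup>2 = (cmod w)\<^sup>2 / (n b)\<^sup>2"
      using False by (simp add: power2_eq_square)
    then have "0 \<le> (n a)\<^sup>2 - (cmod w)\<^sup>2 / (n b)\<^sup>2"
      using key[of "1 / (n b)\<^sup>2"] by simp
    then show ?thesis using nb by (simp add: field_simps power_mult_distrib)
  qed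
  then show ?thesis
    unfolding w_def by (rule power2_le_imp_le) (intro mult_nonneg_nonneg n_nonneg a b)
qed

lemma norm_le: "a \<in> weyl_polys \<Longrightarrow> cmod (s a) \<le> n a"
  using cauchy_schwarz[of 1 a] by (simp add: n_def[of 1] one)

lemma n_triangle:
  assumes a: "a \<in> weyl_polys" and b: "b \<in> weyl_polys"
  shows "n (a + b) \<le> n a + n b"
proof -
  have ab: "a + b \<in> weyl_polys" using a b by simp
  have "(n (a + b))\<^sup>2 = (n a)\<^sup>2 + 2 * Re (s (weyl_star a * b)) + (n b)\<^sup>2"
    using expand_real[OF a b, of 1] hermitian[OF a b] by (simp add: n_square[OF ab])
  also have "\<dots> \<le> (n a)\<^sup>2 + 2 * (n a * n b) + (n b)\<^sup>2"
    using cauchy_schwarz[OF a b] complex_Re_le_cmod[of "s (weyl_star a * b)"] by simp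
  also have "\<dots> = (n a + n b)\<^sup>2" by (simp add: power2_sum)
  finally show ?thesis by (rule power2_le_imp_le) (intro add_nonneg_nonneg n_nonneg a b)
qed

lemma n_scal:
  assumes a: "a \<in> weyl_polys" shows "n (scal c * a) = cmod c * n a"
proof -
  have "weyl_star (scal c * a) * (scal c * a) = scal (cnj c * c) * (weyl_star a * a)"
    unfolding scal_mult[symmetric] by (simp add: weyl_star_mult mult_ac)
  then have *: "weyl_star (scal c * a) * (scal c * a) = scal (complex_of_real ((cmod c)\<^sup>2)) * (weyl_star a * a)"
    by (simp only: cnj_mult_self)
  have "s (weyl_star (scal c * a) * (scal c * a)) = complex_of_real ((cmod c)\<^sup>2) * s (weyl_star a * a)"
    unfolding * by (intro scal weyl_polys_closed a)
  then show ?thesis unfolding n_def by (simp only: Re_complex_of_real times_complex.sel Im_complex_of_real) (simp add: real_sqrt_mult)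
qed

lemma n_minus: "a \<in> weyl_polys \<Longrightarrow> n (- a) = n a"
  using n_scal[of a "-1"] by (simp add: single_uminus)

lemma n_zero: "n 0 = 0" by (simp add: n_def zero)

lemma n_diff_commute: "a \<in> weyl_polys \<Longrightarrow> b \<in> weyl_polys \<Longrightarrow> n (a - b) = n (b - a)"
  using n_minus[of "a - b"] by simp

lemma n_triangle_diff: "a \<in> weyl_polys \<Longrightarrow> b \<in> weyl_polys \<Longrightarrow> c \<in> weyl_polys \<Longrightarrow> n (a - c) \<le> n (a - b) + n (b - c)"
  using n_triangle[of "a - b" "b - c"] by simp

lemma n_diff_bound:
  assumes "a \<in> weyl_polys" "b \<in> weyl_polys" shows "\<bar>n a - n b\<bar> \<le> n (a - b)"
  using n_triangle[of b "a - b"] n_triangle[of a "b - a"] n_diff_commute[of a b] assms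
  by simp

lemma n_sum: "(\<And>i. i \<in> I \<Longrightarrow> a i \<in> weyl_polys) \<Longrightarrow> n (\<Sum>i\<in>I. a i) \<le> (\<Sum>i\<in>I. n (a i))"
proof (induction I rule: infinite_finite_induct)
  case (insert i I)
  then show ?case using n_triangle[of "a i" "\<Sum>i\<in>I. a i"] weyl_polys_sum[of I a]
    by force
qed (simp_all add: n_zero)

text \<open>\<open>W (- f) * W f = 1\<close>, and commutativity moves this factor out of the
  square.\<close>

lemma n_weyl_mult:
  assumes "f \<in> schwartz" "a \<in> weyl_polys" shows "n (W f * a) = n a"
proof -
  have "weyl_star (W f * a) * (W f * a) = (W (- f) * W f) * (weyl_star a * a)"
    by (simp add: weyl_star_mult mult_ac)
  then show ?thesis by (simp add: n_def mult_single)
qed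

lemma n_mult_le_l1:
  assumes a: "a \<in> weyl_polys" and b: "b \<in> weyl_polys"
  shows "n (a * b) \<le> l1_norm a * n b"
proof -
  have k: "f \<in> schwartz" if "f \<in> keys a" for f using a that by (auto simp: weyl_polys_def)
  have c: "single f c * b \<in> weyl_polys" if "f \<in> keys a" for f c
    by (intro weyl_polys_closed(6) weyl_polys_closed(3) k that b)
  have e: "single f c * b = scal c * (W f * b)" for f c
    by (simp add: mult.assoc[symmetric] mult_single)
  have "a * b = (\<Sum>f\<in>keys a. single f (lookup a f) * b)"
    by (simp only: sum_distrib_right[symmetric] sum_single_lookup)
  then have "n (a * b) \<le> (\<Sum>f\<in>keys a. n (single f (lookup a f) * b))"
    by (simp only:) (rule n_sum, rule c)
  also have "\<dots> = (\<Sum>f\<in>keys a. cmod (lookup a f) * n b)"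
    using k b by (intro sum.cong refl) (subst e, simp add: n_scal n_weyl_mult)
  finally show ?thesis by (simp add: l1_norm_def sum_distrib_right)
qed

lemma n_one: "n 1 = 1" by (simp add: n_def one)

lemma n_le_l1: "a \<in> weyl_polys \<Longrightarrow> n a \<le> l1_norm a"
  using n_mult_le_l1[of a 1] by (simp add: n_one)

lemma n_star: "n (weyl_star a) = n a"
  by (simp add: n_def mult.commute)

text \<open>The vector state of \<open>b\<close> in the GNS space. Evaluated on the square of
  \<open>a\<close>, it turns the maximal norm of \<open>a\<close> into a bound for multiplication by
  \<open>a\<close>.\<close>

lemma conjugated_state:
  assumes b: "b \<in> weyl_polys" and nb: "n b \<noteq> 0"
  shows "is_state classical_poly (\<lambda>x. s (weyl_star b * x * b) / complex_of_real ((n b)\<^sup>2))"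
  unfolding is_state_def
proof (intro conjI ballI allI, goal_cases)
  case (1 x y)
  then show ?case using b add[of "weyl_star b * x * b" "weyl_star b * y * b"]
    by (simp add: distrib_left distrib_right add_divide_distrib)
next
  case (2 c x)
  have "weyl_star b * (scal c * x) * b = scal c * (weyl_star b * x * b)" by (simp add: mult_ac)
  moreover have "s (scal c * (weyl_star b * x * b)) = c * s (weyl_star b * x * b)"
    using 2 b by (intro scal weyl_polys_closed) auto
  ultimately show ?case by (simp only: classical_poly_simps times_divide_eq_right)
next
  case (3 x)
  have "weyl_star b * (weyl_star x * x) * b = weyl_star (x * b) * (x * b)" by (simp add: weyl_star_mult mult_ac)
  moreover have "s (weyl_star (x * b) * (x * b)) / complex_of_real ((n b)\<^sup>2) \<in> \<real>\<^sub>\<ge>\<^sub>0"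
    using 3 b by (intro nonneg_Reals_divide_I pos weyl_polys_closed)
      (simp_all only: nonneg_Reals_of_real_iff zero_le_power2 classical_poly_simps)
  ultimately show ?case by simp
next
  case 4
  then show ?case using nb s_square[OF b] by simp
qed

end

text \<open>This is evaluation of the functions \<open>W f\<close> at the point 0. It shows that the
  set of states is nonempty, so that the supremum defining \<open>mnorm\<close> is
  meaningful.\<close>

lemma trivial_character_state:
  "is_state (classical_poly :: 'n::finite weyl_poly star_algebra) (lin_ext (\<lambda>_. 1))"
proof -
  have mult: "lin_ext (\<lambda>_. 1) (a * b) = lin_ext (\<lambda>_. 1) a * lin_ext (\<lambda>_. 1) b" for a b :: "'n weyl_poly"
  proof -
    have "lin_ext (\<lambda>_. 1) (a * b) =
      (\<Sum>f\<in>keys a. \<Sum>g\<in>keys b. lookup a f * lookup b g)"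
      unfolding mult_eq_sum_single[of a b] by (simp add: lin_ext_sum)
    then show ?thesis by (simp add: lin_ext_def sum_product)
  qed
  have star: "lin_ext (\<lambda>_. 1) (weyl_star a) = cnj (lin_ext (\<lambda>_. 1) a)" for a :: "'n weyl_poly"
    unfolding weyl_star_def by (simp add: lin_ext_sum) (simp add: lin_ext_def)
  have one: "lin_ext (\<lambda>_. 1) (1 :: 'n weyl_poly) = 1"
    using lin_ext_single[of "\<lambda>_. 1" 0 1] by simp
  have "cnj z * z \<in> \<real>\<^sub>\<ge>\<^sub>0" for z
    by (simp add: complex_nonneg_Reals_iff mult.commute)
  then show ?thesis
    by (simp add: is_state_def lin_ext_add mult star one)
qed

section \<open>The maximal norm of the classical algebra\<close>

abbreviation mnorm :: "'n::finite weyl_poly \<Rightarrow> real" where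
  "mnorm \<equiv> max_norm classical_poly"

lemma max_norm_eq: "mnorm a = (SUP s\<in>{s. is_state classical_poly s}. classical_state.n s a)"
  unfolding max_norm_def
  by (rule SUP_cong) (auto simp: classical_state.n_def[OF classical_state.intro])

text \<open>A supremum of reals is an upper bound only for a bounded set; \<open>l1_norm a\<close>
  bounds the values for all states.\<close>

lemma n_le_max_norm:
  assumes "is_state classical_poly s" "a \<in> weyl_polys"
  shows "classical_state.n s a \<le> mnorm a"
  unfolding max_norm_eq
proof (rule cSUP_upper)
  show "bdd_above ((\<lambda>s. classical_state.n s a) ` {s. is_state classical_poly s})"
    using assms(2) classical_state.n_le_l1[OF classical_state.intro]
    by (intro bdd_aboveI2[where M = "l1_norm a"]) auto
qed (use assms in auto)

lemma max_norm_le: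
  assumes "\<And>s. is_state classical_poly s \<Longrightarrow> classical_state.n s a \<le> B"
  shows "mnorm a \<le> B"
  unfolding max_norm_eq by (rule cSUP_least) (use assms trivial_character_state in auto)

lemma max_norm_nonneg: "a \<in> weyl_polys \<Longrightarrow> 0 \<le> mnorm a"
  by (rule order_trans[OF classical_state.n_nonneg[OF classical_state.intro[OF trivial_character_state]]
        n_le_max_norm[OF trivial_character_state]])

lemma max_norm_zero: "mnorm 0 = 0"
proof (rule antisym)
  show "mnorm 0 \<le> 0"
    by (rule max_norm_le) (simp add: classical_state.n_zero[OF classical_state.intro])
qed (rule max_norm_nonneg, simp)

lemma max_norm_triangle:
  assumes "a \<in> weyl_polys" "b \<in> weyl_polys" shows "mnorm (a + b) \<le> mnorm a + mnorm b"
  by (rule max_norm_le, rule order_trans[OF classical_state.n_triangle[OF classical_state.intro]])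
    (use assms in \<open>auto intro!: add_mono n_le_max_norm\<close>)

lemma max_norm_scal_le:
  assumes "a \<in> weyl_polys" shows "mnorm (scal c * a) \<le> cmod c * mnorm a"
proof (rule max_norm_le)
  fix s :: "'a weyl_poly \<Rightarrow> complex" assume s: "is_state classical_poly s"
  show "classical_state.n s (scal c * a) \<le> cmod c * mnorm a"
    unfolding classical_state.n_scal[OF classical_state.intro[OF s] assms]
    by (intro mult_left_mono n_le_max_norm s assms) simp
qed

lemma max_norm_star: "mnorm (weyl_star a) = mnorm a"
  unfolding max_norm_eq by (rule SUP_cong) (auto simp: classical_state.n_star[OF classical_state.intro])

lemma max_norm_diff_commute: "a \<in> weyl_polys \<Longrightarrow> b \<in> weyl_polys \<Longrightarrow> mnorm (a - b) = mnorm (b - a)"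
  unfolding max_norm_eq
  by (rule SUP_cong) (auto simp: classical_state.n_diff_commute[OF classical_state.intro])

text \<open>If \<open>b\<close> is not null, \<open>n (a * b) / n b\<close> is the seminorm of
  \<open>a\<close> in the state conjugated by \<open>b\<close>, hence at most
  \<open>mnorm a\<close>. If \<open>b\<close> is null, the cruder bound by \<open>l1_norm\<close>
  already gives 0.\<close>

lemma n_mult_le_max_norm:
  assumes s: "is_state classical_poly s" and a: "a \<in> weyl_polys" and b: "b \<in> weyl_polys"
  shows "classical_state.n s (a * b) \<le> mnorm a * classical_state.n s b"
proof -
  interpret classical_state s using s by (rule classical_state.intro)
  show ?thesis
  proof (cases "n b = 0")
    case True
    then show ?thesis using n_mult_le_l1[OF a b] by simp
  next
    case False
    define t where "t = (\<lambda>x. s (weyl_star b * x * b) / complex_of_real ((n b)\<^sup>2))"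
    have t: "is_state classical_poly t" unfolding t_def by (rule conjugated_state[OF b False])
    have "Re (t (weyl_star a * a)) = (n (a * b) / n b)\<^sup>2"
    proof -
      have "weyl_star b * (weyl_star a * a) * b = weyl_star (a * b) * (a * b)" by (simp add: weyl_star_mult mult_ac)
      then show ?thesis
        using n_square[of "a * b"] a b by (simp add: t_def power_divide)
    qed
    then have "classical_state.n t a = n (a * b) / n b"
      using n_nonneg[of "a * b"] n_nonneg[OF b] a b
      by (simp add: classical_state.n_def[OF classical_state.intro[OF t]])
    moreover have "classical_state.n t a \<le> mnorm a" by (rule n_le_max_norm[OF t a])
    moreover have "0 < n b" using False n_nonneg[OF b] by simp
    ultimately show ?thesis by (simp add: divide_le_eq)
  qed
qed

lemma max_norm_mult:
  assumes "a \<in> weyl_polys" "b \<in> weyl_polys" shows "mnorm (a * b) \<le> mnorm a * mnorm b"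
proof (rule max_norm_le)
  fix s :: "'a weyl_poly \<Rightarrow> complex" assume s: "is_state classical_poly s"
  show "classical_state.n s (a * b) \<le> mnorm a * mnorm b"
    by (rule order_trans[OF n_mult_le_max_norm[OF s assms]])
      (intro mult_left_mono n_le_max_norm s assms max_norm_nonneg)
qed

section \<open>The completion and the GNS representation\<close>

interpretation wa: alg_completion "classical_poly :: 'n::finite weyl_poly star_algebra" mnorm
proof
  fix x y z :: "'n weyl_poly" assume "x \<in> carrier classical_poly" "y \<in> carrier classical_poly"
  then have xy: "x \<in> weyl_polys" "y \<in> weyl_polys" by auto
  show "mnorm (alg_diff classical_poly x y) = mnorm (alg_diff classical_poly y x)"
    using max_norm_diff_commute[OF xy] by simp
  have "mnorm x \<le> mnorm y + mnorm (x - y)" "mnorm y \<le> mnorm x + mnorm (y - x)"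
    using max_norm_triangle[of y "x - y"] max_norm_triangle[of x "y - x"] xy by simp_all
  then show "\<bar>mnorm x - mnorm y\<bar> \<le> mnorm (alg_diff classical_poly x y)"
    using max_norm_diff_commute[OF xy] by simp
  assume "z \<in> carrier classical_poly"
  then show "mnorm (alg_diff classical_poly x z) \<le> mnorm (alg_diff classical_poly x y) + mnorm (alg_diff classical_poly y z)"
    using max_norm_triangle[of "x - y" "y - z"] xy by simp
qed (simp add: max_norm_zero)

abbreviation CS :: "(nat \<Rightarrow> 'n::finite weyl_poly) set" where
  "CS \<equiv> cauchy_seqs classical_poly mnorm"

abbreviation cls :: "(nat \<Rightarrow> 'n::finite weyl_poly) \<Rightarrow> 'n weyl_elem" where
  "cls \<equiv> cauchy_class classical_poly mnorm"

lemma CS_polys: "x \<in> CS \<Longrightarrow> x n \<in> weyl_polys"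
  using wa.CS_carrier[of x n] by simp

lemma CS_dist: "x \<in> CS \<Longrightarrow> e > 0 \<Longrightarrow> \<exists>N. \<forall>m\<ge>N. \<forall>n\<ge>N. mnorm (x m - x n) < e"
  using wa.CS_D[of x e] by simp

lemma const_CS: "a \<in> weyl_polys \<Longrightarrow> (\<lambda>_. a) \<in> CS"
  by (rule wa.const_CS) simp

abbreviation (input) W0 :: "'n::finite weyl_elem normed_star_algebra" where
  "W0 \<equiv> weyl_algebra 0"

lemma W0_raw:
  "carrier W0 = compl_carrier classical_poly mnorm"
  "add W0 = compl_lift2 classical_poly mnorm (add classical_poly)"
  "mult W0 = compl_lift2 classical_poly mnorm (mult classical_poly)"
  "one W0 = compl_embed classical_poly mnorm 1"
  "smult W0 c = compl_lift classical_poly mnorm (smult classical_poly c)"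
  "star W0 = compl_lift classical_poly mnorm weyl_star"
  "anorm W0 = compl_norm mnorm"
  by (simp_all add: weyl_algebra_def cstar_completion_def Let_def)

lemma W0_carrierE:
  assumes "X \<in> carrier W0" obtains x where "x \<in> CS" "X = cls x"
  using assms wa.compl_carrierE[of X] by (auto simp: W0_raw)

lemma cls_carrier: "x \<in> CS \<Longrightarrow> cls x \<in> carrier W0"
  by (simp add: W0_raw wa.cls_in_compl_carrier)

section \<open>Operations of the completed algebra on representatives\<close>

lemma
  assumes x: "x \<in> CS" and y: "y \<in> CS"
  shows CS_add: "(\<lambda>n. x n + y n) \<in> CS"
    and cls_add: "cls x \<oplus>\<^bsub>W0\<^esub> cls y = cls (\<lambda>n. x n + y n)"
proof -
  have *: "mnorm (alg_diff classical_poly (a \<oplus>\<^bsub>classical_poly\<^esub> b) (a' \<oplus>\<^bsub>classical_poly\<^esub> b')) \<le>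
      1 * mnorm (alg_diff classical_poly b b') + 1 * mnorm (alg_diff classical_poly a a')"
    if "a \<in> carrier classical_poly" "b \<in> carrier classical_poly" "a' \<in> carrier classical_poly" "b' \<in> carrier classical_poly"
    for a b a' b' :: "'a weyl_poly"
  proof -
    have "a + b - (a' + b') = (b - b') + (a - a')" by simp
    then show ?thesis using max_norm_triangle[of "b - b'" "a - a'"] that by (simp only: classical_poly_simps alg_diff_classical_poly weyl_polys_closed simp_thms mult_1)
  qed
  note A = wa.compl_lift2_cls[OF x y, where T = "add classical_poly" and P = "\<lambda>_. 1" and R = "\<lambda>_. 1", OF _ *]
  show "(\<lambda>n. x n + y n) \<in> CS" "cls x \<oplus>\<^bsub>W0\<^esub> cls y = cls (\<lambda>n. x n + y n)"
    using A by (auto simp: W0_raw)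
qed

lemma
  assumes x: "x \<in> CS" and y: "y \<in> CS"
  shows CS_mult: "(\<lambda>n. x n * y n) \<in> CS"
    and cls_mult: "cls x \<otimes>\<^bsub>W0\<^esub> cls y = cls (\<lambda>n. x n * y n)"
proof -
  have *: "mnorm (alg_diff classical_poly (a \<otimes>\<^bsub>classical_poly\<^esub> b) (a' \<otimes>\<^bsub>classical_poly\<^esub> b')) \<le>
      mnorm a * mnorm (alg_diff classical_poly b b') + mnorm b' * mnorm (alg_diff classical_poly a a')"
    if "a \<in> carrier classical_poly" "b \<in> carrier classical_poly" "a' \<in> carrier classical_poly" "b' \<in> carrier classical_poly"
    for a b a' b' :: "'a weyl_poly"
  proof -
    \<comment> \<open>Commutativity puts \<open>b'\<close> in front, and submultiplicativity then
      bounds both terms in the form required by \<open>compl_lift2_cls\<close>.\<close>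
    have "a * b - a' * b' = a * (b - b') + b' * (a - a')" by (simp add: algebra_simps)
    then have "mnorm (a * b - a' * b') \<le> mnorm (a * (b - b')) + mnorm (b' * (a - a'))"
      using max_norm_triangle[of "a * (b - b')" "b' * (a - a')"] that by simp
    then show ?thesis using max_norm_mult[of a "b - b'"] max_norm_mult[of b' "a - a'"] that by simp
  qed
  have bd: "\<exists>K. \<forall>n. mnorm (x n) \<le> K" if "x \<in> CS" for x :: "nat \<Rightarrow> 'a weyl_poly"
    by (rule wa.CS_norm_bounded[OF that])
  note A = wa.compl_lift2_cls[OF x y, where T = "mult classical_poly" and P = mnorm and R = mnorm, OF _ * bd bd]
  show "(\<lambda>n. x n * y n) \<in> CS" "cls x \<otimes>\<^bsub>W0\<^esub> cls y = cls (\<lambda>n. x n * y n)"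
    using A by (auto simp: W0_raw)
qed

lemma
  assumes x: "x \<in> CS"
  shows CS_scal: "(\<lambda>n. scal c * x n) \<in> CS"
    and cls_scal: "c \<odot>\<^bsub>W0\<^esub> cls x = cls (\<lambda>n. scal c * x n)"
proof -
  have *: "mnorm (alg_diff classical_poly (c \<odot>\<^bsub>classical_poly\<^esub> a) (c \<odot>\<^bsub>classical_poly\<^esub> a')) \<le>
      cmod c * mnorm (alg_diff classical_poly a a')"
    if "a \<in> carrier classical_poly" "a' \<in> carrier classical_poly" for a a' :: "'a weyl_poly"
    using max_norm_scal_le[of "a - a'" c] that by (simp add: right_diff_distrib)
  note A = wa.compl_lift_cls[OF x, where T = "smult classical_poly c", OF _ *]
  show "(\<lambda>n. scal c * x n) \<in> CS" "c \<odot>\<^bsub>W0\<^esub> cls x = cls (\<lambda>n. scal c * x n)"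
    using A by (auto simp: W0_raw)
qed

lemma
  assumes x: "x \<in> CS"
  shows CS_star: "(\<lambda>n. weyl_star (x n)) \<in> CS"
    and cls_star: "star W0 (cls x) = cls (\<lambda>n. weyl_star (x n))"
proof -
  have *: "mnorm (alg_diff classical_poly (weyl_star a) (weyl_star a')) \<le> 1 * mnorm (alg_diff classical_poly a a')"
    if "a \<in> carrier classical_poly" "a' \<in> carrier classical_poly" for a a' :: "'a weyl_poly"
    using max_norm_star[of "a - a'"] by (simp add: weyl_star_minus)
  note A = wa.compl_lift_cls[OF x, where T = weyl_star, OF _ *]
  show "(\<lambda>n. weyl_star (x n)) \<in> CS" "star W0 (cls x) = cls (\<lambda>n. weyl_star (x n))"
    using A by (auto simp: W0_raw)
qed

lemma
  assumes x: "x \<in> CS" and y: "y \<in> CS"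
  shows CS_diff: "(\<lambda>n. x n - y n) \<in> CS"
    and cls_diff: "alg_diff W0 (cls x) (cls y) = cls (\<lambda>n. x n - y n)"
  using CS_add[OF x CS_scal[OF y, of "-1"]] cls_add[OF x CS_scal[OF y, of "-1"]]
  by (simp_all add: alg_diff_def cls_scal[OF y] single_uminus)

lemma weyl_incl_cls: "weyl_incl 0 a = cls (\<lambda>_. a)"
  by (simp add: weyl_incl_def compl_embed_def)

lemma weyl_cls: "weyl 0 f = cls (\<lambda>_. W f)"
  by (simp add: weyl_def weyl_incl_cls)

lemma one_cls: "\<one>\<^bsub>W0\<^esub> = cls (\<lambda>_. 1)"
  by (simp add: W0_raw compl_embed_def)

lemma anorm_cls: "x \<in> CS \<Longrightarrow> (\<lambda>n. mnorm (x n)) \<longlonglongrightarrow> anorm W0 (cls x)"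
  using wa.compl_norm_cls_tendsto[of x] by (simp add: W0_raw)

text \<open>The choice of a representative is immaterial for states, which are contractions for the
  maximal norm. Being defined for arbitrary \<open>s\<close>, the extension can be used outside the
  locale, with functionals depending on a parameter.\<close>

definition state_ext :: "('n::finite weyl_poly \<Rightarrow> complex) \<Rightarrow> 'n weyl_elem \<Rightarrow> complex" where
  "state_ext s X = lim (\<lambda>n. s ((SOME x. x \<in> X) n))"

context classical_state
begin

abbreviation sx :: "'n weyl_elem \<Rightarrow> complex" where "sx \<equiv> state_ext s"

lemma norm_diff_le: "a \<in> weyl_polys \<Longrightarrow> b \<in> weyl_polys \<Longrightarrow> cmod (s a - s b) \<le> mnorm (a - b)"
  using norm_le[of "a - b"] n_le_max_norm[OF state, of "a - b"] minus[of a b] by simp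

lemma state_ext_tendsto:
  assumes x: "x \<in> CS" shows "(\<lambda>n. s (x n)) \<longlonglongrightarrow> sx (cls x)"
proof -
  define y where "y = (SOME y. y \<in> cls x)"
  have "y \<in> cls x" unfolding y_def by (rule someI[of "\<lambda>y. y \<in> cls x"]) (rule wa.self_mem_cls[OF x])
  then have y: "y \<in> CS" and xy: "(\<lambda>n. mnorm (x n - y n)) \<longlonglongrightarrow> 0" by (auto simp: wa.mem_cls)
  have "Cauchy (\<lambda>n. s (y n))"
    unfolding Cauchy_def dist_norm
  proof (intro allI impI)
    fix e :: real assume "e > 0"
    then obtain N where "\<forall>m\<ge>N. \<forall>n\<ge>N. mnorm (y m - y n) < e" using CS_dist[OF y] by blast
    then show "\<exists>N. \<forall>m\<ge>N. \<forall>n\<ge>N. cmod (s (y m) - s (y n)) < e"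
      using norm_diff_le[OF CS_polys[OF y] CS_polys[OF y]] by (meson le_less_trans)
  qed
  then have lim: "(\<lambda>n. s (y n)) \<longlonglongrightarrow> sx (cls x)"
    unfolding state_ext_def y_def[symmetric] by (rule convergent_LIMSEQ_iff[THEN iffD1, OF Cauchy_convergent])
  have "(\<lambda>n. s (x n) - s (y n)) \<longlonglongrightarrow> 0"
    by (rule Lim_null_comparison[OF _ xy]) (intro always_eventually allI norm_diff_le CS_polys x y)
  from tendsto_add[OF this lim] show ?thesis by simp
qed

lemma state_ext_eqI: "x \<in> CS \<Longrightarrow> (\<lambda>n. s (x n)) \<longlonglongrightarrow> l \<Longrightarrow> sx (cls x) = l"
  using state_ext_tendsto LIMSEQ_unique by blast

lemma state_ext_incl: "a \<in> weyl_polys \<Longrightarrow> sx (weyl_incl 0 a) = s a"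
  unfolding weyl_incl_cls by (intro state_ext_eqI const_CS tendsto_const)

text \<open>Each clause is an equality or a closed condition on values of \<open>s\<close>, hence
  survives the limit along representatives.\<close>

lemma state_ext_is_state: "is_cstar_state W0 sx"
  unfolding is_cstar_state_def is_state_def
proof (intro conjI ballI allI)
  fix X Y :: "'n weyl_elem" and c assume "X \<in> carrier W0"
  then obtain x where x: "x \<in> CS" "X = cls x" by (rule W0_carrierE)
  show "sx (c \<odot>\<^bsub>W0\<^esub> X) = c * sx X"
    unfolding x cls_scal[OF x(1)]
    by (rule state_ext_eqI[OF CS_scal[OF x(1)]])
      (simp only: scal[OF CS_polys[OF x(1)]], intro tendsto_mult_left state_ext_tendsto x)
  have "(\<lambda>n. s (weyl_star (x n) * x n)) \<longlonglongrightarrow> sx (star W0 X \<otimes>\<^bsub>W0\<^esub> X)"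
    unfolding x cls_star[OF x(1)] cls_mult[OF CS_star[OF x(1)] x(1)]
    by (intro state_ext_tendsto CS_mult CS_star x)
  then show "sx (star W0 X \<otimes>\<^bsub>W0\<^esub> X) \<in> \<real>\<^sub>\<ge>\<^sub>0"
    by (rule Lim_in_closed_set[OF closed_nonneg_Reals_complex, rotated 2])
      (auto intro!: always_eventually pos CS_polys x)
  have "(\<lambda>n. cmod (s (x n))) \<longlonglongrightarrow> cmod (sx X)" unfolding x by (intro tendsto_norm state_ext_tendsto x)
  moreover have "(\<lambda>n. mnorm (x n)) \<longlonglongrightarrow> anorm W0 X" unfolding x by (intro anorm_cls x)
  ultimately show "cmod (sx X) \<le> anorm W0 X"
    using norm_le[OF CS_polys[OF x(1)]] n_le_max_norm[OF state CS_polys[OF x(1)]]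
    by (intro LIMSEQ_le) (auto intro: order_trans)
  assume "Y \<in> carrier W0"
  then obtain y where y: "y \<in> CS" "Y = cls y" by (rule W0_carrierE)
  show "sx (X \<oplus>\<^bsub>W0\<^esub> Y) = sx X + sx Y"
    unfolding x y cls_add[OF x(1) y(1)]
    by (rule state_ext_eqI[OF CS_add[OF x(1) y(1)]])
      (simp only: add[OF CS_polys[OF x(1)] CS_polys[OF y(1)]], intro tendsto_add state_ext_tendsto x y)
next
  show "sx \<one>\<^bsub>W0\<^esub> = 1" unfolding one_cls by (intro state_ext_eqI const_CS) (simp_all add: one)
qed

section \<open>The GNS space over the completed algebra\<close>

abbreviation g :: "'n weyl_elem \<Rightarrow> real" where "g \<equiv> gns_seminorm W0 sx"

lemma gns_seminorm_tendsto:
  assumes x: "x \<in> CS" shows "(\<lambda>k. n (x k)) \<longlonglongrightarrow> g (cls x)"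
  unfolding gns_seminorm_def n_def cls_star[OF x] cls_mult[OF CS_star[OF x] x]
  by (intro tendsto_real_sqrt tendsto_Re state_ext_tendsto CS_mult CS_star x)

lemma gns_seminorm_incl: "a \<in> weyl_polys \<Longrightarrow> g (cls (\<lambda>_. a)) = n a"
  using gns_seminorm_tendsto[OF const_CS, of a] LIMSEQ_const_iff by metis

lemma gns_dist_tendsto:
  assumes "x \<in> CS" "y \<in> CS" shows "(\<lambda>k. n (x k - y k)) \<longlonglongrightarrow> g (alg_diff W0 (cls x) (cls y))"
  unfolding cls_diff[OF assms] by (intro gns_seminorm_tendsto CS_diff assms)

text \<open>The second layer: its points are classes of sequences whose members are themselves
  classes. Every axiom is the limit of the corresponding property of \<open>n\<close>.\<close>

sublocale gns: alg_completion W0 g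
proof
  fix X Y Z :: "'n weyl_elem" assume "X \<in> carrier W0" "Y \<in> carrier W0"
  then obtain x y where x: "x \<in> CS" "X = cls x" and y: "y \<in> CS" "Y = cls y" by (elim W0_carrierE) (rule that)
  note p = CS_polys[OF x(1)] CS_polys[OF y(1)]
  show "g (alg_diff W0 X Y) = g (alg_diff W0 Y X)"
    using LIMSEQ_unique[OF gns_dist_tendsto[OF x(1) y(1)]] gns_dist_tendsto[OF y(1) x(1)]
    unfolding x y by (simp only: n_diff_commute[OF p])
  have "(\<lambda>k. \<bar>n (x k) - n (y k)\<bar>) \<longlonglongrightarrow> \<bar>g X - g Y\<bar>"
    unfolding x y by (intro tendsto_rabs tendsto_diff gns_seminorm_tendsto x y)
  then show "\<bar>g X - g Y\<bar> \<le> g (alg_diff W0 X Y)"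
    unfolding x y
    by (rule LIMSEQ_le[OF _ gns_dist_tendsto[OF x(1) y(1)]]) (intro exI allI impI n_diff_bound p)
  assume "Z \<in> carrier W0"
  then obtain z where z: "z \<in> CS" "Z = cls z" by (rule W0_carrierE)
  show "g (alg_diff W0 X Z) \<le> g (alg_diff W0 X Y) + g (alg_diff W0 Y Z)"
    unfolding x y z
    by (rule LIMSEQ_le[OF gns_dist_tendsto tendsto_add[OF gns_dist_tendsto gns_dist_tendsto]])
      (auto intro!: x y z n_triangle_diff CS_polys)
next
  fix X :: "'n weyl_elem" assume "X \<in> carrier W0"
  then obtain x where x: "x \<in> CS" "X = cls x" by (rule W0_carrierE)
  show "g (alg_diff W0 X X) = 0"
    using LIMSEQ_unique[OF gns_dist_tendsto[OF x(1) x(1)], of 0] unfolding x by (simp add: n_zero)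
qed

lemma add_closed: "X \<in> carrier W0 \<Longrightarrow> Y \<in> carrier W0 \<Longrightarrow> alg_diff W0 X Y \<in> carrier W0"
  by (elim W0_carrierE) (simp add: cls_diff CS_diff cls_carrier)

lemma scal_closed: "X \<in> carrier W0 \<Longrightarrow> c \<odot>\<^bsub>W0\<^esub> X \<in> carrier W0"
  by (elim W0_carrierE) (simp add: cls_scal CS_scal cls_carrier)

lemma weyl_mult_cls:
  assumes "f \<in> schwartz" "x \<in> CS"
  shows "weyl 0 f \<otimes>\<^bsub>W0\<^esub> cls x = cls (\<lambda>k. W f * x k)" "(\<lambda>k. W f * x k) \<in> CS"
  unfolding weyl_cls using cls_mult[OF const_CS assms(2), of "W f"] CS_mult[OF const_CS assms(2), of "W f"] assms(1) by auto

lemma weyl_mult_closed: "f \<in> schwartz \<Longrightarrow> X \<in> carrier W0 \<Longrightarrow> weyl 0 f \<otimes>\<^bsub>W0\<^esub> X \<in> carrier W0"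
  by (elim W0_carrierE) (simp add: weyl_mult_cls cls_carrier)

text \<open>Since \<open>W f\<close> is isometric for \<open>n\<close>, left multiplication is
  Lipschitz with constant 1 and lifts to the GNS space.\<close>

lemma gns_rep_weyl:
  assumes f: "f \<in> schwartz" and z: "z \<in> cauchy_seqs W0 g"
  shows "(\<lambda>k. weyl 0 f \<otimes>\<^bsub>W0\<^esub> z k) \<in> cauchy_seqs W0 g"
    and "gns_rep W0 sx (weyl 0 f) (cauchy_class W0 g z) = cauchy_class W0 g (\<lambda>k. weyl 0 f \<otimes>\<^bsub>W0\<^esub> z k)"
proof -
  have *: "g (alg_diff W0 (weyl 0 f \<otimes>\<^bsub>W0\<^esub> X) (weyl 0 f \<otimes>\<^bsub>W0\<^esub> Y)) \<le> 1 * g (alg_diff W0 X Y)"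
    if "X \<in> carrier W0" "Y \<in> carrier W0" for X Y
  proof -
    from that obtain x y where x: "x \<in> CS" "X = cls x" and y: "y \<in> CS" "Y = cls y" by (elim W0_carrierE) (rule that)
    have "n (W f * x k - W f * y k) = n (x k - y k)" for k
      using n_weyl_mult[OF f, of "x k - y k"] CS_polys[OF x(1), of k] CS_polys[OF y(1), of k] by (simp add: right_diff_distrib)
    then have "(\<lambda>k. n (x k - y k)) \<longlonglongrightarrow> g (alg_diff W0 (weyl 0 f \<otimes>\<^bsub>W0\<^esub> X) (weyl 0 f \<otimes>\<^bsub>W0\<^esub> Y))"
      using gns_dist_tendsto[OF weyl_mult_cls(2)[OF f x(1)] weyl_mult_cls(2)[OF f y(1)]]
      by (simp add: x y weyl_mult_cls(1)[OF f])
    from LIMSEQ_unique[OF this] show ?thesis using gns_dist_tendsto[OF x(1) y(1)] unfolding x y by simp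
  qed
  show "(\<lambda>k. weyl 0 f \<otimes>\<^bsub>W0\<^esub> z k) \<in> cauchy_seqs W0 g"
    "gns_rep W0 sx (weyl 0 f) (cauchy_class W0 g z) = cauchy_class W0 g (\<lambda>k. weyl 0 f \<otimes>\<^bsub>W0\<^esub> z k)"
    using gns.compl_lift_cls[OF z, where T = "mult W0 (weyl 0 f)", OF weyl_mult_closed[OF f] *]
    by (auto simp: gns_rep_def)
qed

lemma gns_sub_class:
  assumes y: "y \<in> cauchy_seqs W0 g" and z: "z \<in> cauchy_seqs W0 g"
  shows "(\<lambda>k. alg_diff W0 (y k) (z k)) \<in> cauchy_seqs W0 g"
    and "gns_sub W0 sx (cauchy_class W0 g y) (cauchy_class W0 g z) = cauchy_class W0 g (\<lambda>k. alg_diff W0 (y k) (z k))"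
proof -
  have *: "g (alg_diff W0 (alg_diff W0 A B) (alg_diff W0 A' B')) \<le> 1 * g (alg_diff W0 B B') + 1 * g (alg_diff W0 A A')"
    if "A \<in> carrier W0" "B \<in> carrier W0" "A' \<in> carrier W0" "B' \<in> carrier W0" for A B A' B'
  proof -
    from that obtain a b a' b' where ab: "a \<in> CS" "A = cls a" "b \<in> CS" "B = cls b" "a' \<in> CS" "A' = cls a'" "b' \<in> CS" "B' = cls b'"
      by (elim W0_carrierE) (rule that)
    have le: "n (a k - b k - (a' k - b' k)) \<le> n (b k - b' k) + n (a k - a' k)" for k
    proof -
      have e: "a k - b k - (a' k - b' k) = (b' k - b k) + (a k - a' k)" by simp
      have p: "b' k - b k \<in> weyl_polys" "a k - a' k \<in> weyl_polys" by (intro weyl_polys_closed CS_polys ab)+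
      have c: "n (b k - b' k) = n (b' k - b k)" by (intro n_diff_commute CS_polys ab)
      show ?thesis unfolding e c by (rule n_triangle[OF p])
    qed
    have "g (alg_diff W0 (alg_diff W0 A B) (alg_diff W0 A' B')) \<le> g (alg_diff W0 B B') + g (alg_diff W0 A A')"
      unfolding ab cls_diff[OF ab(1,3)] cls_diff[OF ab(5,7)]
      by (rule LIMSEQ_le[OF gns_dist_tendsto[OF CS_diff CS_diff] tendsto_add[OF gns_dist_tendsto gns_dist_tendsto]])
        (use le in \<open>auto intro!: ab\<close>)
    then show ?thesis by simp
  qed
  show "(\<lambda>k. alg_diff W0 (y k) (z k)) \<in> cauchy_seqs W0 g"
    "gns_sub W0 sx (cauchy_class W0 g y) (cauchy_class W0 g z) = cauchy_class W0 g (\<lambda>k. alg_diff W0 (y k) (z k))"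
    using gns.compl_lift2_cls[OF y z, where T = "alg_diff W0" and P = "\<lambda>_. 1" and R = "\<lambda>_. 1", OF add_closed *]
    by (auto simp: gns_sub_def)
qed

lemma gns_smult_class:
  assumes z: "z \<in> cauchy_seqs W0 g"
  shows "(\<lambda>k. c \<odot>\<^bsub>W0\<^esub> z k) \<in> cauchy_seqs W0 g"
    and "gns_smult W0 sx c (cauchy_class W0 g z) = cauchy_class W0 g (\<lambda>k. c \<odot>\<^bsub>W0\<^esub> z k)"
proof -
  have *: "g (alg_diff W0 (c \<odot>\<^bsub>W0\<^esub> X) (c \<odot>\<^bsub>W0\<^esub> Y)) \<le> cmod c * g (alg_diff W0 X Y)"
    if "X \<in> carrier W0" "Y \<in> carrier W0" for X Y
  proof -
    from that obtain x y where x: "x \<in> CS" "X = cls x" and y: "y \<in> CS" "Y = cls y" by (elim W0_carrierE) (rule that)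
    have e: "n (scal c * x k - scal c * y k) = cmod c * n (x k - y k)" for k
      using n_scal[of "x k - y k" c] CS_polys[OF x(1), of k] CS_polys[OF y(1), of k] by (simp add: right_diff_distrib)
    have "(\<lambda>k. cmod c * n (x k - y k)) \<longlonglongrightarrow> g (alg_diff W0 (c \<odot>\<^bsub>W0\<^esub> X) (c \<odot>\<^bsub>W0\<^esub> Y))"
      using gns_dist_tendsto[OF CS_scal[OF x(1), of c] CS_scal[OF y(1), of c]]
      unfolding e x y cls_scal[OF x(1)] cls_scal[OF y(1)] .
    from LIMSEQ_unique[OF this tendsto_mult_left[OF gns_dist_tendsto[OF x(1) y(1)]]]
    show ?thesis unfolding x y by simp
  qed
  show "(\<lambda>k. c \<odot>\<^bsub>W0\<^esub> z k) \<in> cauchy_seqs W0 g"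
    "gns_smult W0 sx c (cauchy_class W0 g z) = cauchy_class W0 g (\<lambda>k. c \<odot>\<^bsub>W0\<^esub> z k)"
    using gns.compl_lift_cls[OF z, where T = "smult W0 c", OF scal_closed *]
    by (auto simp: gns_smult_def)
qed

text \<open>Replacing \<open>X\<close> by a polynomial \<open>a\<close> costs twice its distance
  from \<open>X\<close>. On the polynomial, commutativity puts \<open>a\<close> in front of
  \<open>W f - W f'\<close>, leaving only the distance of the two generators on the cyclic
  vector.\<close>

lemma weyl_difference_bound:
  assumes f: "f \<in> schwartz" "f' \<in> schwartz" and X: "X \<in> carrier W0" and a: "a \<in> weyl_polys"
  shows "g (alg_diff W0 (weyl 0 f \<otimes>\<^bsub>W0\<^esub> X) (weyl 0 f' \<otimes>\<^bsub>W0\<^esub> X))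
      \<le> 2 * g (alg_diff W0 X (cls (\<lambda>_. a))) + l1_norm a * n (W f - W f')"
proof -
  from X obtain x where x: "x \<in> CS" "X = cls x" by (rule W0_carrierE)
  have "n (W f * x k - W f' * x k) \<le> 2 * n (x k - a) + l1_norm a * n (W f - W f')" for k
  proof -
    have xk: "x k \<in> weyl_polys" "x k - a \<in> weyl_polys" using CS_polys[OF x(1)] a by auto
    have "W f * x k - W f' * x k = W f * (x k - a) - W f' * (x k - a) + a * (W f - W f')"
      by (simp add: algebra_simps)
    then have "n (W f * x k - W f' * x k) \<le> n (W f * (x k - a) - W f' * (x k - a)) + n (a * (W f - W f'))"
      using n_triangle[of "W f * (x k - a) - W f' * (x k - a)" "a * (W f - W f')"] f a xk by simp
    also have "n (W f * (x k - a) - W f' * (x k - a)) \<le> n (W f * (x k - a)) + n (W f' * (x k - a))"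
      using n_triangle[of "W f * (x k - a)" "- (W f' * (x k - a))"] n_minus[of "W f' * (x k - a)"] f xk by simp
    also have "\<dots> = 2 * n (x k - a)" using n_weyl_mult f xk by simp
    also have "n (a * (W f - W f')) \<le> l1_norm a * n (W f - W f')" using n_mult_le_l1[OF a, of "W f - W f'"] f by simp
    finally show ?thesis by simp
  qed
  then show ?thesis
    unfolding x weyl_mult_cls(1)[OF f(1) x(1)] weyl_mult_cls(1)[OF f(2) x(1)]
    by (intro LIMSEQ_le[OF gns_dist_tendsto[OF weyl_mult_cls(2)[OF f(1) x(1)] weyl_mult_cls(2)[OF f(2) x(1)]]
       tendsto_add[OF tendsto_mult_left[OF gns_dist_tendsto[OF x(1) const_CS[OF a]]] tendsto_const]]) auto
qed

lemma dense_polys: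
  assumes X: "X \<in> carrier W0" and e: "e > 0"
  obtains a where "a \<in> weyl_polys" "g (alg_diff W0 X (cls (\<lambda>_. a))) \<le> e"
proof -
  from X obtain x where x: "x \<in> CS" "X = cls x" by (rule W0_carrierE)
  obtain N where N: "\<forall>m\<ge>N. \<forall>k\<ge>N. mnorm (x m - x k) < e" using CS_dist[OF x(1) e] by blast
  have "n (x k - x N) \<le> e" if "k \<ge> N" for k
    using n_le_max_norm[OF state, of "x k - x N"] N that CS_polys[OF x(1)] by (force intro: order_trans less_imp_le)
  then have "g (alg_diff W0 X (cls (\<lambda>_. x N))) \<le> e"
    unfolding x by (intro LIMSEQ_le_const2[OF gns_dist_tendsto[OF x(1) const_CS[OF CS_polys[OF x(1)]]]]) auto
  then show ?thesis using that CS_polys[OF x(1)] by blast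
qed

text \<open>Continuity on the cyclic vector is enough: a vector is approximated first by an element
  of the algebra and then by a polynomial.\<close>

lemma strongly_continuous_weyl:
  assumes f: "f \<in> schwartz"
    and cont: "\<And>r. ((\<lambda>t. n (W (\<lambda>x. t *\<^sub>R f x) - W (\<lambda>x. r *\<^sub>R f x))) \<longlongrightarrow> 0) (at r)"
  shows "strongly_continuous W0 sx (\<lambda>t. weyl 0 (\<lambda>x. t *\<^sub>R f x))"
  unfolding strongly_continuous_def
proof (intro ballI allI)
  fix \<psi> r assume "\<psi> \<in> gns_space W0 sx"
  then obtain z where z: "z \<in> cauchy_seqs W0 g" "\<psi> = cauchy_class W0 g z"
    unfolding gns_space_def by (rule gns.compl_carrierE)
  let ?f = "\<lambda>t x. t *\<^sub>R f x"
  have fs: "?f t \<in> schwartz" for t using schwartz_scaleR[OF f] .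
  let ?d = "\<lambda>t k. alg_diff W0 (weyl 0 (?f t) \<otimes>\<^bsub>W0\<^esub> z k) (weyl 0 (?f r) \<otimes>\<^bsub>W0\<^esub> z k)"
  have dCS: "?d t \<in> cauchy_seqs W0 g" for t by (intro gns_sub_class gns_rep_weyl fs z)
  have eq: "gns_norm W0 sx (gns_sub W0 sx (gns_rep W0 sx (weyl 0 (?f t)) \<psi>) (gns_rep W0 sx (weyl 0 (?f r)) \<psi>))
      = compl_norm g (cauchy_class W0 g (?d t))" for t
    unfolding z gns_rep_weyl(2)[OF fs z(1)] gns_sub_class(2)[OF gns_rep_weyl(1)[OF fs z(1)] gns_rep_weyl(1)[OF fs z(1)]]
    by (simp add: gns_norm_def)
  have lim: "(\<lambda>k. g (?d t k)) \<longlonglongrightarrow> compl_norm g (cauchy_class W0 g (?d t))" for t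
    by (rule gns.compl_norm_cls_tendsto[OF dCS])
  have d0: "0 \<le> g (?d t k)" for t k
    by (intro gns.dist_nonneg weyl_mult_closed fs gns.CS_carrier z)
  show "((\<lambda>t. gns_norm W0 sx (gns_sub W0 sx (gns_rep W0 sx (weyl 0 (?f t)) \<psi>) (gns_rep W0 sx (weyl 0 (?f r)) \<psi>))) \<longlongrightarrow> 0) (at r)"
    unfolding eq
  proof (rule tendstoI)
    fix e :: real assume e: "e > 0"
    \<comment> \<open>Two errors of \<open>e / 8\<close> make \<open>e / 4\<close>, which
      \<open>weyl_difference_bound\<close> doubles; the other half of \<open>e\<close> is left for
      the cyclic vector.\<close>
    then have e8: "e / 8 > 0" by simp
    obtain m where m: "\<forall>i\<ge>m. \<forall>j\<ge>m. g (alg_diff W0 (z i) (z j)) < e / 8" using gns.CS_D[OF z(1) e8] by blast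
    have zc: "z k \<in> carrier W0" for k by (rule gns.CS_carrier[OF z(1)])
    obtain a where a: "a \<in> weyl_polys" "g (alg_diff W0 (z m) (cls (\<lambda>_. a))) \<le> e / 8" using dense_polys[OF zc e8] .
    have close: "g (alg_diff W0 (z k) (cls (\<lambda>_. a))) \<le> e / 4" if "k \<ge> m" for k
    proof -
      have "g (alg_diff W0 (z k) (cls (\<lambda>_. a))) \<le> g (alg_diff W0 (z k) (z m)) + g (alg_diff W0 (z m) (cls (\<lambda>_. a)))"
        by (intro gns.dist_triangle zc cls_carrier const_CS a)
      also have "\<dots> \<le> e / 8 + e / 8"
        using m[rule_format, OF that order_refl] a(2) by (intro add_mono) auto
      finally show ?thesis by simp
    qed
    let ?b = "\<lambda>t. e / 2 + l1_norm a * n (W (?f t) - W (?f r))"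
    have le: "compl_norm g (cauchy_class W0 g (?d t)) \<le> ?b t" for t
    proof (rule LIMSEQ_le_const2[OF lim], intro exI allI impI)
      fix k assume "m \<le> k"
      then show "g (?d t k) \<le> ?b t"
        using weyl_difference_bound[OF fs[of t] fs[of r] zc[of k] a(1)] close[of k] by simp
    qed
    have ge: "0 \<le> compl_norm g (cauchy_class W0 g (?d t))" for t
      by (rule LIMSEQ_le_const[OF lim]) (use d0 in auto)
    have "(?b \<longlongrightarrow> e / 2 + l1_norm a * 0) (at r)" by (intro tendsto_intros cont)
    then have "\<forall>\<^sub>F t in at r. ?b t < e" by (rule order_tendstoD(2)) (use e in simp)
    then show "\<forall>\<^sub>F t in at r. dist (compl_norm g (cauchy_class W0 g (?d t))) 0 < e"
      by eventually_elim (use le ge in \<open>auto simp: dist_real_def intro: le_less_trans\<close>)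
  qed
qed

text \<open>The derivative of the orbit of the cyclic vector need not come from an element of the
  algebra. It is produced by completeness, so a Cauchy condition on the difference quotients
  \<open>E t\<close> is the right hypothesis.\<close>

lemma gns_vector_in_generator_domain:
  fixes f :: "real^'n \<Rightarrow> complex"
  defines "E \<equiv> \<lambda>t. scal (1 / (\<i> * complex_of_real t)) * (W (\<lambda>x. t *\<^sub>R f x) - 1)"
  assumes f: "f \<in> schwartz"
    and cauchy: "\<And>e. e > 0 \<Longrightarrow> \<exists>\<delta>>0. \<forall>t r. 0 < \<bar>t\<bar> \<and> \<bar>t\<bar> < \<delta> \<and> 0 < \<bar>r\<bar> \<and> \<bar>r\<bar> < \<delta> \<longrightarrow> n (E t - E r) < e"
  shows "gns_vector W0 sx \<in> generator_domain W0 sx (\<lambda>t. weyl 0 (\<lambda>x. t *\<^sub>R f x))"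
proof -
  let ?f = "\<lambda>t x. t *\<^sub>R f x"
  let ?C = "cauchy_class W0 g"
  have fs: "?f t \<in> schwartz" for t using schwartz_scaleR[OF f] .
  have Ep: "E t \<in> weyl_polys" for t unfolding E_def by (intro weyl_polys_closed fs)
  have ic: "cls (\<lambda>_. a) \<in> carrier W0" if "a \<in> weyl_polys" for a by (intro cls_carrier const_CS that)
  have id: "alg_diff W0 (cls (\<lambda>_. a)) (cls (\<lambda>_. b)) = cls (\<lambda>_. a - b)" if "a \<in> weyl_polys" "b \<in> weyl_polys" for a b
    by (rule cls_diff) (intro const_CS that)+
  define u where "u = (\<lambda>k. inverse (real (Suc k)))"
  have u0: "u \<longlonglongrightarrow> 0" unfolding u_def by (rule LIMSEQ_inverse_real_of_nat)
  have upos: "u k > 0" for k by (simp add: u_def)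
  have usmall: "\<exists>K. \<forall>k\<ge>K. \<bar>u k\<bar> < \<delta>" if "\<delta> > 0" for \<delta>
    using u0 that unfolding lim_sequentially dist_real_def by simp
  \<comment> \<open>The witness for the derivative: the difference quotients along
    \<open>t = 1 / (k + 1)\<close>.\<close>
  define y where "y = (\<lambda>k. cls (\<lambda>_. E (u k)))"
  have y: "y \<in> cauchy_seqs W0 g"
  proof (rule gns.CS_I)
    show "y k \<in> carrier W0" for k unfolding y_def by (intro ic Ep)
    fix e :: real assume "e > 0"
    then obtain \<delta> where \<delta>: "\<delta> > 0" "\<forall>t r. 0 < \<bar>t\<bar> \<and> \<bar>t\<bar> < \<delta> \<and> 0 < \<bar>r\<bar> \<and> \<bar>r\<bar> < \<delta> \<longrightarrow> n (E t - E r) < e" using cauchy by metis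
    obtain K where K: "\<forall>k\<ge>K. \<bar>u k\<bar> < \<delta>" using usmall[OF \<delta>(1)] by blast
    show "\<exists>K. \<forall>i\<ge>K. \<forall>j\<ge>K. g (alg_diff W0 (y i) (y j)) < e"
    proof (intro exI[of _ K] allI impI)
      fix i j assume "K \<le> i" "K \<le> j"
      then have "n (E (u i) - E (u j)) < e"
        using \<delta>(2)[rule_format, of "u i" "u j"] K[rule_format, of i] K[rule_format, of j] upos[of i] upos[of j] by simp
      then show "g (alg_diff W0 (y i) (y j)) < e"
        unfolding y_def by (simp add: id Ep gns_seminorm_incl)
    qed
  qed
  have vec: "gns_vector W0 sx = ?C (\<lambda>_. cls (\<lambda>_. 1))"
    by (simp add: gns_vector_def compl_embed_def one_cls)
  have c1: "(\<lambda>_. cls (\<lambda>_. a)) \<in> cauchy_seqs W0 g" if "a \<in> weyl_polys" for a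
    by (intro gns.const_CS ic that)
  have quot: "gns_smult W0 sx (1 / (\<i> * complex_of_real t)) (gns_sub W0 sx (gns_rep W0 sx (weyl 0 (?f t)) (gns_vector W0 sx)) (gns_vector W0 sx))
      = ?C (\<lambda>_. cls (\<lambda>_. E t))" for t
  proof -
    have r: "gns_rep W0 sx (weyl 0 (?f t)) (gns_vector W0 sx) = ?C (\<lambda>_. cls (\<lambda>_. W (?f t)))"
      unfolding vec gns_rep_weyl(2)[OF fs c1[OF weyl_polys_closed(2)]]
        weyl_mult_cls(1)[OF fs const_CS[OF weyl_polys_closed(2)]] by simp
    have s: "gns_sub W0 sx (?C (\<lambda>_. cls (\<lambda>_. W (?f t)))) (gns_vector W0 sx) = ?C (\<lambda>_. cls (\<lambda>_. W (?f t) - 1))"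
      unfolding vec gns_sub_class(2)[OF c1[OF weyl_polys_closed(3)[OF fs]] c1[OF weyl_polys_closed(2)]]
      by (simp only: id[OF weyl_polys_closed(3)[OF fs] weyl_polys_closed(2)])
    have w: "W (?f t) - 1 \<in> weyl_polys" by (intro weyl_polys_closed fs)
    show ?thesis unfolding r s gns_smult_class(2)[OF c1[OF w]] cls_scal[OF const_CS[OF w]] E_def ..
  qed
  have "((\<lambda>t. gns_norm W0 sx (gns_sub W0 sx (?C (\<lambda>_. cls (\<lambda>_. E t))) (?C y))) \<longlongrightarrow> 0) (at 0)"
  proof (rule tendstoI)
    fix e :: real assume e: "e > 0"
    then obtain \<delta> where \<delta>: "\<delta> > 0" "\<forall>t r. 0 < \<bar>t\<bar> \<and> \<bar>t\<bar> < \<delta> \<and> 0 < \<bar>r\<bar> \<and> \<bar>r\<bar> < \<delta> \<longrightarrow> n (E t - E r) < e / 2" using cauchy[of "e / 2"] by auto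
    obtain K where K: "\<forall>k\<ge>K. \<bar>u k\<bar> < \<delta>" using usmall[OF \<delta>(1)] by blast
    have "dist (gns_norm W0 sx (gns_sub W0 sx (?C (\<lambda>_. cls (\<lambda>_. E t))) (?C y))) 0 < e"
      if t: "t \<noteq> 0" "dist t 0 < \<delta>" for t
    proof -
      let ?d = "\<lambda>k. alg_diff W0 (cls (\<lambda>_. E t)) (y k)"
      have d: "?d \<in> cauchy_seqs W0 g" and eq: "gns_norm W0 sx (gns_sub W0 sx (?C (\<lambda>_. cls (\<lambda>_. E t))) (?C y)) = compl_norm g (?C ?d)"
        using gns_sub_class[OF c1[OF Ep[of t]] y] by (simp_all add: gns_norm_def)
      have lim: "(\<lambda>k. g (?d k)) \<longlonglongrightarrow> compl_norm g (?C ?d)" by (rule gns.compl_norm_cls_tendsto[OF d])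
      have gd: "g (?d k) = n (E t - E (u k))" for k unfolding y_def by (simp add: id Ep gns_seminorm_incl)
      have "compl_norm g (?C ?d) \<le> e / 2"
      proof (rule LIMSEQ_le_const2[OF lim], intro exI[of _ K] allI impI)
        fix k assume "K \<le> k"
        then show "g (?d k) \<le> e / 2"
          unfolding gd using \<delta>(2)[rule_format, of t "u k"] K[rule_format, of k] t upos[of k] by (simp add: dist_real_def)
      qed
      moreover have "0 \<le> compl_norm g (?C ?d)"
        by (rule LIMSEQ_le_const[OF lim]) (auto simp: gd n_nonneg Ep)
      ultimately show ?thesis unfolding eq using e by (simp add: dist_real_def)
    qed
    then show "\<forall>\<^sub>F t in at 0. dist (gns_norm W0 sx (gns_sub W0 sx (?C (\<lambda>_. cls (\<lambda>_. E t))) (?C y))) 0 < e"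
      unfolding eventually_at using \<delta>(1) by blast
  qed
  moreover have "?C y \<in> gns_space W0 sx" unfolding gns_space_def by (rule gns.cls_in_compl_carrier[OF y])
  moreover have "gns_vector W0 sx \<in> gns_space W0 sx"
    unfolding gns_space_def vec by (rule gns.cls_in_compl_carrier[OF c1]) simp
  ultimately show ?thesis
    unfolding generator_domain_def mem_Collect_eq unfolding quot by (intro conjI bexI)
qed

end

section \<open>Gaussian states\<close>

definition psd_kernel :: "'i set \<Rightarrow> ('i \<Rightarrow> 'i \<Rightarrow> complex) \<Rightarrow> bool" where
  "psd_kernel I L \<longleftrightarrow> (\<forall>c. (\<Sum>i\<in>I. \<Sum>j\<in>I. cnj (c i) * c j * L i j) \<in> \<real>\<^sub>\<ge>\<^sub>0)"

lemma psd_kernelD: "psd_kernel I L \<Longrightarrow> (\<Sum>i\<in>I. \<Sum>j\<in>I. cnj (c i) * c j * L i j) \<in> \<real>\<^sub>\<ge>\<^sub>0"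
  by (simp add: psd_kernel_def)

lemma psd_kernel_one: "psd_kernel I (\<lambda>_ _. 1)"
  unfolding psd_kernel_def
proof
  fix c :: "'a \<Rightarrow> complex"
  have "(\<Sum>i\<in>I. \<Sum>j\<in>I. cnj (c i) * c j * 1) = cnj (\<Sum>i\<in>I. c i) * (\<Sum>j\<in>I. c j)"
    by (simp add: sum_product)
  then show "(\<Sum>i\<in>I. \<Sum>j\<in>I. cnj (c i) * c j * 1) \<in> \<real>\<^sub>\<ge>\<^sub>0"
    by (simp only: cnj_mult_self nonneg_Reals_of_real_iff zero_le_power2)
qed

lemma psd_kernel_limit:
  assumes "\<And>N. psd_kernel I (L N)" "\<And>i j. i \<in> I \<Longrightarrow> j \<in> I \<Longrightarrow> (\<lambda>N. L N i j) \<longlonglongrightarrow> K i j"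
  shows "psd_kernel I K"
  unfolding psd_kernel_def
proof
  fix c
  have "(\<lambda>N. \<Sum>i\<in>I. \<Sum>j\<in>I. cnj (c i) * c j * L N i j) \<longlonglongrightarrow> (\<Sum>i\<in>I. \<Sum>j\<in>I. cnj (c i) * c j * K i j)"
    by (intro tendsto_sum tendsto_mult_left assms)
  then show "(\<Sum>i\<in>I. \<Sum>j\<in>I. cnj (c i) * c j * K i j) \<in> \<real>\<^sub>\<ge>\<^sub>0"
    by (rule Lim_in_closed_set[OF closed_nonneg_Reals_complex, rotated 2])
      (use assms(1) in \<open>auto simp: psd_kernel_def\<close>)
qed

lemma psd_kernel_add:
  "psd_kernel I K \<Longrightarrow> psd_kernel I L \<Longrightarrow> psd_kernel I (\<lambda>i j. K i j + L i j)"
  unfolding psd_kernel_def distrib_left sum.distrib by (intro allI nonneg_Reals_add_I) auto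

lemma psd_kernel_scale:
  assumes "psd_kernel I K" "0 \<le> r" shows "psd_kernel I (\<lambda>i j. complex_of_real r * K i j)"
  unfolding psd_kernel_def
proof
  fix c
  have "(\<Sum>i\<in>I. \<Sum>j\<in>I. cnj (c i) * c j * (complex_of_real r * K i j)) =
     complex_of_real r * (\<Sum>i\<in>I. \<Sum>j\<in>I. cnj (c i) * c j * K i j)"
    by (simp add: sum_distrib_left mult_ac)
  then show "(\<Sum>i\<in>I. \<Sum>j\<in>I. cnj (c i) * c j * (complex_of_real r * K i j)) \<in> \<real>\<^sub>\<ge>\<^sub>0"
    using assms by (simp only:) (intro nonneg_Reals_mult_I, auto simp: psd_kernel_def)
qed

lemma psd_kernel_sum:
  "(\<And>k. k \<in> A \<Longrightarrow> psd_kernel I (K k)) \<Longrightarrow> psd_kernel I (\<lambda>i j. \<Sum>k\<in>A. K k i j)"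
proof (induction A rule: infinite_finite_induct)
  case (insert k A)
  then show ?case using psd_kernel_add[of I "K k"] by simp
qed (simp_all add: psd_kernel_def)

text \<open>By duality, the hypothesis on \<open>B\<close> says that \<open>B\<close> is an average of real parts of Gram kernels.\<close>

lemma psd_kernel_schur:
  assumes L: "psd_kernel I L"
    and B: "\<And>m. (\<And>u :: 'i \<Rightarrow> complex. 0 \<le> (\<Sum>i\<in>I. \<Sum>j\<in>I. m i j * Re (cnj (u i) * u j)))
         \<Longrightarrow> 0 \<le> (\<Sum>i\<in>I. \<Sum>j\<in>I. m i j * B i j)"
  shows "psd_kernel I (\<lambda>i j. complex_of_real (B i j) * L i j)"
  unfolding psd_kernel_def
proof
  fix c
  define Z where "Z = (\<lambda>i j. cnj (c i) * c j * L i j)"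
  \<comment> \<open>\<open>Re (cnj (u i) * u j)\<close> splits into a product of real parts and a
    product of imaginary parts; each rescales the coefficients \<open>c\<close>, so that the
    hypothesis on \<open>L\<close> applies.\<close>
  have pos: "(\<Sum>i\<in>I. \<Sum>j\<in>I. complex_of_real (Re (cnj (u i) * u j)) * Z i j) \<in> \<real>\<^sub>\<ge>\<^sub>0" for u
  proof -
    have "(\<Sum>i\<in>I. \<Sum>j\<in>I. complex_of_real (Re (cnj (u i) * u j)) * Z i j) =
      (\<Sum>i\<in>I. \<Sum>j\<in>I. cnj (c i * complex_of_real (Re (u i))) * (c j * complex_of_real (Re (u j))) * L i j) +
      (\<Sum>i\<in>I. \<Sum>j\<in>I. cnj (c i * complex_of_real (Im (u i))) * (c j * complex_of_real (Im (u j))) * L i j)"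
      unfolding sum.distrib[symmetric] by (intro sum.cong refl) (simp add: Z_def algebra_simps)
    also have "\<dots> \<in> \<real>\<^sub>\<ge>\<^sub>0"
      using psd_kernelD[OF L, of "\<lambda>i. c i * complex_of_real (Re (u i))"]
        psd_kernelD[OF L, of "\<lambda>i. c i * complex_of_real (Im (u i))"] by (rule nonneg_Reals_add_I)
    finally show ?thesis .
  qed
  have re: "Re (\<Sum>i\<in>I. \<Sum>j\<in>I. complex_of_real (b i j) * Z i j) = (\<Sum>i\<in>I. \<Sum>j\<in>I. Re (Z i j) * b i j)" for b
    by (simp add: mult.commute)
  have im: "Im (\<Sum>i\<in>I. \<Sum>j\<in>I. complex_of_real (b i j) * Z i j) = (\<Sum>i\<in>I. \<Sum>j\<in>I. Im (Z i j) * b i j)" for b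
    by (simp add: mult.commute)
  have "0 \<le> (\<Sum>i\<in>I. \<Sum>j\<in>I. Re (Z i j) * B i j)"
  proof (rule B)
    show "0 \<le> (\<Sum>i\<in>I. \<Sum>j\<in>I. Re (Z i j) * Re (cnj (u i) * u j))" for u
      using pos[of u] unfolding re[symmetric] complex_nonneg_Reals_iff by blast
  qed
  \<comment> \<open>The pairings in \<open>pos\<close> have vanishing imaginary part, so
    \<open>B\<close> applies to \<open>Im (Z i j)\<close> with both signs and forces the imaginary
    part to be 0.\<close>
  moreover have "0 \<le> (\<Sum>i\<in>I. \<Sum>j\<in>I. Im (Z i j) * B i j)"
  proof (rule B)
    show "0 \<le> (\<Sum>i\<in>I. \<Sum>j\<in>I. Im (Z i j) * Re (cnj (u i) * u j))" for u
      using pos[of u] unfolding im[symmetric] complex_nonneg_Reals_iff by simp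
  qed
  moreover have "0 \<le> (\<Sum>i\<in>I. \<Sum>j\<in>I. - Im (Z i j) * B i j)"
  proof (rule B)
    have "(\<Sum>i\<in>I. \<Sum>j\<in>I. - Im (Z i j) * Re (cnj (u i) * u j)) = - (\<Sum>i\<in>I. \<Sum>j\<in>I. Im (Z i j) * Re (cnj (u i) * u j))" for u
      by (simp add: sum_negf)
    then show "0 \<le> (\<Sum>i\<in>I. \<Sum>j\<in>I. - Im (Z i j) * Re (cnj (u i) * u j))" for u
      using pos[of u] unfolding im[symmetric] complex_nonneg_Reals_iff by simp
  qed
  ultimately have "(\<Sum>i\<in>I. \<Sum>j\<in>I. complex_of_real (B i j) * Z i j) \<in> \<real>\<^sub>\<ge>\<^sub>0"
    unfolding complex_nonneg_Reals_iff re im by (simp add: sum_negf)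
  then show "(\<Sum>i\<in>I. \<Sum>j\<in>I. cnj (c i) * c j * (complex_of_real (B i j) * L i j)) \<in> \<real>\<^sub>\<ge>\<^sub>0"
    by (simp add: Z_def mult_ac)
qed

text \<open>Each entrywise power arises from the constant kernel by repeated Schur products, and the
  exponential series is a limit of nonnegative combinations of these powers.\<close>

lemma psd_kernel_exp:
  assumes B: "\<And>m. (\<And>u :: 'i \<Rightarrow> complex. 0 \<le> (\<Sum>i\<in>I. \<Sum>j\<in>I. m i j * Re (cnj (u i) * u j)))
         \<Longrightarrow> 0 \<le> (\<Sum>i\<in>I. \<Sum>j\<in>I. m i j * B i j)"
  shows "psd_kernel I (\<lambda>i j. complex_of_real (exp (B i j)))"
proof (rule psd_kernel_limit)
  have pow: "psd_kernel I (\<lambda>i j. complex_of_real (B i j) ^ k)" for k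
  proof (induction k)
    case 0 show ?case by (simp add: psd_kernel_one)
  next
    case (Suc k) then show ?case using psd_kernel_schur[OF Suc B] by simp
  qed
  show "psd_kernel I (\<lambda>i j. \<Sum>k<N. complex_of_real (inverse (fact k)) * complex_of_real (B i j) ^ k)" for N
    by (intro psd_kernel_sum psd_kernel_scale pow) simp
  show "(\<lambda>N. \<Sum>k<N. complex_of_real (inverse (fact k)) * complex_of_real (B i j) ^ k) \<longlonglongrightarrow> complex_of_real (exp (B i j))" for i j
  proof -
    have "(\<lambda>k. inverse (fact k) * B i j ^ k) sums exp (B i j)"
      using exp_converges[of "B i j"] by (simp add: scaleR_conv_of_real)
    from tendsto_of_real[OF this[unfolded sums_def]] show ?thesis
      by (simp only: of_real_sum of_real_mult of_real_power)
  qed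
qed

section \<open>The Gaussian functional with condensate term\<close>

locale condensate =
  fixes dim :: "'n::finite itself" and \<beta> \<alpha> :: real
  assumes dim: "CARD('n) \<ge> 3" and \<beta>: "\<beta> > 0" and \<alpha>: "\<alpha> \<ge> 0"
begin

definition wt :: "real^'n \<Rightarrow> real" where
  "wt p = inverse (\<beta> * (p \<bullet> p / 2)) / (2 * pi) ^ CARD('n)"

text \<open>The real symmetric form whose diagonal is, up to the factor -1/2, the exponent of the
  limit state.\<close>

definition B :: "(real^'n \<Rightarrow> complex) \<Rightarrow> (real^'n \<Rightarrow> complex) \<Rightarrow> real" where
  "B f g = (LINT p|lborel. wt p * Re (cnj (fourier f p) * fourier g p))
     + 2 ^ CARD('n) * \<alpha> * Re (cnj (LINT x|lborel. f x) * (LINT x|lborel. g x))"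

lemma wt_nonneg: "0 \<le> wt p"
  using \<beta> by (simp add: wt_def)

lemma wt_measurable[measurable]: "wt \<in> borel_measurable borel"
  unfolding wt_def[abs_def] by measurable

text \<open>The product of the two transforms is at most a multiple of the decay weight, and
  dimension at least 3 makes the quotient of that weight by \<open>p \<bullet> p\<close>
  integrable.\<close>

lemma integrable_B:
  assumes f: "f \<in> schwartz" and g: "g \<in> schwartz"
  shows "integrable lborel (\<lambda>p. wt p * Re (cnj (fourier f p) * fourier g p))"
proof -
  obtain C where C: "C \<ge> 0" "\<And>p. cmod (fourier f p) \<le> C * decay_weight p" using fourier_decay[OF f] by blast
  obtain D where D: "D \<ge> 0" "\<And>p. cmod (fourier g p) \<le> D * decay_weight p" using fourier_decay[OF g] by blast
  let ?K = "2 * inverse \<beta> / (2 * pi) ^ CARD('n) * (C * D)"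
  have [measurable]: "fourier f \<in> borel_measurable borel" "fourier g \<in> borel_measurable borel"
    by (intro measurable_fourier schwartz_measurable f g)+
  show ?thesis
  proof (rule Bochner_Integration.integrable_bound[OF integrable_mult_right[OF integrable_decay_weight_over_square[OF dim], of ?K]])
    show "AE p in lborel. norm (wt p * Re (cnj (fourier f p) * fourier g p)) \<le> norm (?K * (inverse (p \<bullet> p) * decay_weight p))"
    proof (intro always_eventually allI)
      fix p :: "real^'n"
      have "\<bar>Re (cnj (fourier f p) * fourier g p)\<bar> \<le> cmod (fourier f p) * cmod (fourier g p)"
        using abs_Re_le_cmod[of "cnj (fourier f p) * fourier g p"] by (simp add: norm_mult)
      also have "\<dots> \<le> (C * 1) * (D * decay_weight p)"
      proof (rule mult_mono)
        show "cmod (fourier f p) \<le> C * 1"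
          using C(2)[of p] mult_left_mono[OF decay_weight_le_1[of p] C(1)] by simp
      qed (use C D in auto)
      finally have "wt p * \<bar>Re (cnj (fourier f p) * fourier g p)\<bar> \<le> wt p * (C * D * decay_weight p)"
        by (intro mult_left_mono wt_nonneg) simp
      also have "\<dots> = ?K * (inverse (p \<bullet> p) * decay_weight p)"
        unfolding wt_def divide_inverse inverse_mult_distrib inverse_inverse_eq by (simp only: mult_ac)
      finally show "norm (wt p * Re (cnj (fourier f p) * fourier g p)) \<le> norm (?K * (inverse (p \<bullet> p) * decay_weight p))"
        unfolding real_norm_def abs_mult[of "wt p"] abs_of_nonneg[OF wt_nonneg]
        by (rule order_trans[OF _ abs_ge_self])
    qed
  qed measurable
qed

lemma B_diag: "B f f = form_of_H (\<lambda>E. inverse (\<beta> * E)) f + 2 ^ CARD('n) * \<alpha> * (cmod (LINT x|lborel. f x))\<^sup>2"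
proof -
  have "Re (cnj z * z) = (cmod z)\<^sup>2" for z by (simp only: cnj_mult_self Re_complex_of_real)
  then show ?thesis by (simp only: B_def form_of_H_def wt_def times_divide_eq_left)
qed

lemma B_commute: "B f g = B g f"
proof -
  have "Re (cnj z * w) = Re (cnj w * z)" for z w by simp
  then show ?thesis unfolding B_def
    by (intro arg_cong2[where f = "(+)"] arg_cong2[where f = "(*)"] refl Bochner_Integration.integral_cong)
qed

lemma B_add_left:
  assumes "f \<in> schwartz" "f' \<in> schwartz" "g \<in> schwartz"
  shows "B (f + f') g = B f g + B f' g"
proof -
  have "(LINT p|lborel. wt p * Re (cnj (fourier (f + f') p) * fourier g p)) =
     (LINT p|lborel. wt p * Re (cnj (fourier f p) * fourier g p) + wt p * Re (cnj (fourier f' p) * fourier g p))"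
    by (intro Bochner_Integration.integral_cong refl)
      (simp add: fourier_add schwartz_integrable assms algebra_simps)
  also have "\<dots> = (LINT p|lborel. wt p * Re (cnj (fourier f p) * fourier g p)) + (LINT p|lborel. wt p * Re (cnj (fourier f' p) * fourier g p))"
    by (intro Bochner_Integration.integral_add integrable_B assms)
  finally have e1: "(LINT p|lborel. wt p * Re (cnj (fourier (f + f') p) * fourier g p)) = \<dots>" .
  have e2: "(LINT x|lborel. (f + f') x) = (LINT x|lborel. f x) + (LINT x|lborel. f' x)"
    using Bochner_Integration.integral_add[OF schwartz_integrable schwartz_integrable] assms by (simp add: plus_fun_def)
  show ?thesis
    unfolding B_def e1 e2 complex_cnj_add distrib_right plus_complex.sel distrib_left by (simp only: add_ac)
qed

lemma B_scaleR_left: "B (\<lambda>x. t *\<^sub>R f x) g = t * B f g"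
proof -
  have "fourier (\<lambda>x. t *\<^sub>R f x) p = t *\<^sub>R fourier f p" for p
    unfolding scaleR_conv_of_real by (rule fourier_cmult)
  then have e1: "(LINT p|lborel. wt p * Re (cnj (fourier (\<lambda>x. t *\<^sub>R f x) p) * fourier g p)) =
     t * (LINT p|lborel. wt p * Re (cnj (fourier f p) * fourier g p))"
    by (simp only: complex_cnj_scaleR mult_scaleR_left scaleR_complex.sel mult.left_commute integral_mult_right_zero)
  have e2: "(LINT x|lborel. t *\<^sub>R f x) = t *\<^sub>R (LINT x|lborel. f x)" by simp
  show ?thesis
    unfolding B_def e1 e2 complex_cnj_scaleR mult_scaleR_left scaleR_complex.sel
    by (simp only: distrib_left mult.left_commute)
qed

lemma B_uminus_left: "B (- f) g = - B f g"
  using B_scaleR_left[of "-1" f g] by (simp add: fun_Compl_def)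

lemma B_add_diag:
  assumes "f \<in> schwartz" "g \<in> schwartz"
  shows "B (f + g) (f + g) = B f f + 2 * B f g + B g g"
  using B_add_left[OF assms schwartz_add[OF assms]] B_add_left[OF assms assms(1)] B_add_left[OF assms assms(2)]
    B_commute[of f "f + g"] B_commute[of g "f + g"] B_commute[of g f] by simp

text \<open>This is the premise of \<open>psd_kernel_exp\<close> for \<open>B\<close>. The
  hypothesis on \<open>m\<close> applies to the Gram kernel of the transforms at each momentum and
  to that of the integrals, and nonnegative weights preserve the inequality.\<close>

lemma B_positive:
  assumes f: "\<And>i. i \<in> I \<Longrightarrow> f i \<in> schwartz"
    and m: "\<And>u :: 'i \<Rightarrow> complex. 0 \<le> (\<Sum>i\<in>I. \<Sum>j\<in>I. m i j * Re (cnj (u i) * u j))"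
  shows "0 \<le> (\<Sum>i\<in>I. \<Sum>j\<in>I. m i j * B (f i) (f j))"
proof -
  let ?r = "\<lambda>i j p. Re (cnj (fourier (f i) p) * fourier (f j) p)"
  let ?F = "\<lambda>i. LINT x|lborel. f i x"
  have "(\<Sum>i\<in>I. \<Sum>j\<in>I. m i j * B (f i) (f j)) =
     (\<Sum>i\<in>I. \<Sum>j\<in>I. (LINT p|lborel. m i j * (wt p * ?r i j p))) +
     2 ^ CARD('n) * \<alpha> * (\<Sum>i\<in>I. \<Sum>j\<in>I. m i j * Re (cnj (?F i) * ?F j))"
    unfolding sum_distrib_left sum.distrib[symmetric] B_def integral_mult_right_zero
    by (intro sum.cong refl) (simp only: distrib_left mult.left_commute)
  also have "(\<Sum>i\<in>I. \<Sum>j\<in>I. (LINT p|lborel. m i j * (wt p * ?r i j p))) =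
     (\<Sum>i\<in>I. (LINT p|lborel. (\<Sum>j\<in>I. m i j * (wt p * ?r i j p))))"
    by (intro sum.cong refl Bochner_Integration.integral_sum[symmetric] integrable_mult_right integrable_B f)
  also have "\<dots> = (LINT p|lborel. (\<Sum>i\<in>I. \<Sum>j\<in>I. m i j * (wt p * ?r i j p)))"
    by (intro Bochner_Integration.integral_sum[symmetric] Bochner_Integration.integrable_sum integrable_mult_right integrable_B f)
  also have "\<dots> = (LINT p|lborel. wt p * (\<Sum>i\<in>I. \<Sum>j\<in>I. m i j * ?r i j p))"
    by (simp only: sum_distrib_left mult.left_commute)
  finally have eq: "(\<Sum>i\<in>I. \<Sum>j\<in>I. m i j * B (f i) (f j)) =
     (LINT p|lborel. wt p * (\<Sum>i\<in>I. \<Sum>j\<in>I. m i j * ?r i j p)) +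
     2 ^ CARD('n) * \<alpha> * (\<Sum>i\<in>I. \<Sum>j\<in>I. m i j * Re (cnj (?F i) * ?F j))" .
  show ?thesis
    unfolding eq by (intro add_nonneg_nonneg Bochner_Integration.integral_nonneg zero_le_power mult_nonneg_nonneg wt_nonneg m \<alpha>) simp
qed

definition \<phi> :: "(real^'n \<Rightarrow> complex) \<Rightarrow> complex" where
  "\<phi> f = complex_of_real (exp (- B f f / 2))"

lemma psd_phi:
  assumes I: "\<And>f. f \<in> I \<Longrightarrow> f \<in> schwartz"
  shows "psd_kernel I (\<lambda>f g. \<phi> (- f + g))"
  unfolding psd_kernel_def
proof
  fix c
  let ?e = "\<lambda>f. complex_of_real (exp (- B f f / 2))"
  \<comment> \<open>The diagonal terms factor out and are absorbed into the coefficients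
    \<open>c\<close>, leaving the exponential of \<open>B\<close>.\<close>
  have "\<phi> (- f + g) = ?e f * ?e g * complex_of_real (exp (B f g))" if "f \<in> I" "g \<in> I" for f g
  proof -
    have "B (- f + g) (- f + g) = B f f - 2 * B f g + B g g"
      using B_add_diag[OF schwartz_uminus[OF I[OF that(1)]] I[OF that(2)]]
        B_uminus_left[of f "- f"] B_commute[of f "- f"] B_uminus_left[of f f] B_uminus_left[of f g] by simp
    then have "exp (- B (- f + g) (- f + g) / 2) = exp (- B f f / 2) * exp (- B g g / 2) * exp (B f g)"
      by (simp add: field_simps flip: exp_add)
    then show ?thesis by (simp only: \<phi>_def of_real_mult)
  qed
  then have "(\<Sum>f\<in>I. \<Sum>g\<in>I. cnj (c f) * c g * \<phi> (- f + g)) =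
    (\<Sum>f\<in>I. \<Sum>g\<in>I. cnj (c f * ?e f) * (c g * ?e g) * complex_of_real (exp (B f g)))"
    by (intro sum.cong refl) (simp add: mult_ac)
  also have "\<dots> \<in> \<real>\<^sub>\<ge>\<^sub>0"
    by (rule psd_kernelD[OF psd_kernel_exp], rule B_positive[of I "\<lambda>f. f"]) (use I in auto)
  finally show "(\<Sum>f\<in>I. \<Sum>g\<in>I. cnj (c f) * c g * \<phi> (- f + g)) \<in> \<real>\<^sub>\<ge>\<^sub>0" .
qed

lemma B_zero: "B 0 0 = 0"
  by (simp add: B_def fourier_def)

text \<open>Expanding the square of \<open>a\<close> gives the quadratic form of the kernel
  \<open>\<phi> (- f + g)\<close> at the coefficients of \<open>a\<close>.\<close>

lemma phi_state: "is_state classical_poly (lin_ext \<phi>)"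
  unfolding is_state_def
proof (intro conjI ballI allI)
  fix a b :: "'n weyl_poly" and c
  show "lin_ext \<phi> (a \<oplus>\<^bsub>classical_poly\<^esub> b) = lin_ext \<phi> a + lin_ext \<phi> b" by (simp add: lin_ext_add)
  have "lin_ext \<phi> (scal c * a) = (\<Sum>f\<in>keys a. lin_ext \<phi> (scal c * single f (lookup a f)))"
    by (simp only: lin_ext_sum[symmetric] sum_distrib_left[symmetric] sum_single_lookup)
  also have "\<dots> = (\<Sum>f\<in>keys a. c * (lookup a f * \<phi> f))"
    by (simp only: mult_single add_0 lin_ext_single mult.assoc)
  also have "\<dots> = c * lin_ext \<phi> a" by (simp only: lin_ext_def sum_distrib_left)
  finally show "lin_ext \<phi> (c \<odot>\<^bsub>classical_poly\<^esub> a) = c * lin_ext \<phi> a" by simp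
  show "lin_ext \<phi> \<one>\<^bsub>classical_poly\<^esub> = 1"
    using lin_ext_single[of \<phi> 0 1] by (simp add: \<phi>_def B_zero)
  assume "a \<in> carrier classical_poly"
  then have a: "keys a \<subseteq> schwartz" by (simp add: weyl_polys_def)
  have "weyl_star a * a = (\<Sum>f\<in>keys a. single (- f) (cnj (lookup a f))) *
      (\<Sum>g\<in>keys a. single g (lookup a g))"
    by (simp only: weyl_star_def[symmetric] sum_single_lookup)
  also have "lin_ext \<phi> \<dots> = (\<Sum>f\<in>keys a. \<Sum>g\<in>keys a.
      cnj (lookup a f) * lookup a g * \<phi> (- f + g))"
    by (simp only: sum_product lin_ext_sum mult_single lin_ext_single)
  also have "\<dots> \<in> \<real>\<^sub>\<ge>\<^sub>0" by (rule psd_kernelD[OF psd_phi]) (use a in auto)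
  finally show "lin_ext \<phi> (star classical_poly a \<otimes>\<^bsub>classical_poly\<^esub> a) \<in> \<real>\<^sub>\<ge>\<^sub>0" by simp
qed

end

section \<open>Regularity and the weak KMS condition\<close>

lemma exp_quotient_tendsto: "((\<lambda>s::real. (exp (b * s) - 1) / s) \<longlongrightarrow> b) (at 0)"
proof -
  have "((\<lambda>s. exp (b * s)) has_real_derivative b) (at 0)"
    by (auto intro!: derivative_eq_intros)
  then show ?thesis by (simp add: DERIV_def)
qed

text \<open>This is the squared norm in the GNS space of the difference of the difference quotients
  \<open>(W(tf) - 1) / (it)\<close> and \<open>(W(rf) - 1) / (ir)\<close> in a Gaussian state of variance \<open>b\<close>.\<close>

lemma gaussian_difference_quotients_tendsto:
  fixes b :: real
  defines "e \<equiv> \<lambda>t. exp (- (t\<^sup>2 * b) / 2)"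
  shows "((\<lambda>(t, r). (2 - 2 * e t) / t\<^sup>2 + (2 - 2 * e r) / r\<^sup>2 - 2 * ((1 + e (r - t) - e t - e r) / (t * r))) \<longlongrightarrow> 0)
     (at 0 \<times>\<^sub>F at 0)"
proof -
  let ?F = "at (0::real) \<times>\<^sub>F at (0::real)"
  \<comment> \<open>\<open>k t\<close> is the squared norm of a single difference quotient; its
    limit is the variance.\<close>
  define k where "k = (\<lambda>t. (2 - 2 * e t) / t\<^sup>2)"
  have k: "(k \<longlongrightarrow> b) (at 0)"
  proof -
    have "filterlim (\<lambda>t::real. - (t\<^sup>2 / 2)) (at 0) (at 0)"
      unfolding filterlim_at
    proof
      show "\<forall>\<^sub>F x::real in at 0. - (x\<^sup>2 / 2) \<in> UNIV \<and> - (x\<^sup>2 / 2) \<noteq> 0" by (simp add: eventually_at_filter)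
      show "((\<lambda>t::real. - (t\<^sup>2 / 2)) \<longlongrightarrow> 0) (at 0)" by (auto intro!: tendsto_eq_intros)
    qed
    from filterlim_compose[OF exp_quotient_tendsto[of b] this]
    have "((\<lambda>t. (exp (b * - (t\<^sup>2 / 2)) - 1) / - (t\<^sup>2 / 2)) \<longlongrightarrow> b) (at 0)" .
    moreover have "(exp (b * - (t\<^sup>2 / 2)) - 1) / - (t\<^sup>2 / 2) = k t" for t
      unfolding k_def e_def by (cases "t = 0") (simp_all add: field_simps)
    ultimately show ?thesis by simp
  qed
  have e1: "(e \<longlongrightarrow> 1) (at 0)" unfolding e_def by (auto intro!: tendsto_eq_intros)
  define l where "l = (\<lambda>t. (1 - e t) / t)"
  have l: "(l \<longlongrightarrow> 0) (at 0)"
  proof -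
    have "((\<lambda>t. t / 2 * k t) \<longlongrightarrow> 0 / 2 * b) (at 0)" by (intro tendsto_intros k) auto
    moreover have "t / 2 * k t = l t" for t by (cases "t = 0") (simp_all add: k_def l_def power2_eq_square field_simps)
    ultimately show ?thesis by simp
  qed
  have fst: "filterlim fst (at 0) ?F" and snd: "filterlim snd (at 0) ?F" by (rule filterlim_fst filterlim_snd)+
  note cf = filterlim_compose[OF _ fst] and cs = filterlim_compose[OF _ snd]
  have prod: "filterlim (\<lambda>z. fst z * snd z) (at (0::real)) ?F"
    unfolding filterlim_at
  proof
    have "((\<lambda>z. fst z * snd z) \<longlongrightarrow> 0 * (0::real)) ?F"
      using fst snd by (intro tendsto_mult) (auto simp: filterlim_at)
    then show "((\<lambda>z. fst z * snd z) \<longlongrightarrow> (0::real)) ?F" by simp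
    show "\<forall>\<^sub>F z in ?F. fst z * snd z \<in> UNIV \<and> fst z * snd z \<noteq> (0::real)"
      using fst snd by (auto simp: filterlim_at elim: eventually_elim2)
  qed
  have "((\<lambda>z. k (fst z) + k (snd z) - 2 * (l (fst z) * l (snd z) + e (fst z) * e (snd z) * ((exp (b * (fst z * snd z)) - 1) / (fst z * snd z))))
      \<longlongrightarrow> b + b - 2 * (0 * 0 + 1 * 1 * b)) ?F"
    by (intro tendsto_intros cf[OF k] cs[OF k] cf[OF l] cs[OF l] cf[OF e1] cs[OF e1] filterlim_compose[OF exp_quotient_tendsto prod])
  \<comment> \<open>Because \<open>e (r - t) = e t * e r * exp (b * (t * r))\<close>, the mixed term
    splits into \<open>l t * l r\<close>, which tends to 0, and an exponential quotient at
    \<open>t * r\<close>, which tends to \<open>b\<close>.\<close>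
  moreover have "k t + k r - 2 * (l t * l r + e t * e r * ((exp (b * (t * r)) - 1) / (t * r)))
      = (2 - 2 * e t) / t\<^sup>2 + (2 - 2 * e r) / r\<^sup>2 - 2 * ((1 + e (r - t) - e t - e r) / (t * r))" for t r
  proof -
    have "e (r - t) = e t * e r * exp (b * (t * r))"
      unfolding e_def exp_add[symmetric] by (rule arg_cong[where f = exp]) (simp add: power2_eq_square field_simps)
    then have "l t * l r + e t * e r * ((exp (b * (t * r)) - 1) / (t * r)) = (1 + e (r - t) - e t - e r) / (t * r)"
      unfolding l_def by (simp add: add_divide_distrib[symmetric] algebra_simps)
    then show ?thesis by (simp add: k_def)
  qed
  ultimately show ?thesis by (simp add: case_prod_beta')
qed

text \<open>In this form the additivity of \<open>lin_ext\<close> handles products in which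
  different pairs of summands yield the same key.\<close>

lemma field_expectation_eq:
  "field_expectation \<omega> c = lin_ext (\<lambda>(u, f). - \<i> * vector_derivative (\<lambda>t. \<omega> (weyl 0 (f + (\<lambda>x. t *\<^sub>R u x)))) (at 0)) c"
  by (simp add: field_expectation_def lin_ext_def case_prod_beta')

lemma lin_ext_weyl_times_field:
  "lin_ext E (weyl_times_field b c) = (\<Sum>g\<in>keys b. lookup b g * lin_ext (\<lambda>(u, f). E (u, g + f)) c)"
  unfolding weyl_times_field_def
  by (simp add: lin_ext_sum case_prod_beta') (simp add: lin_ext_def sum_distrib_left mult.assoc case_prod_beta')

lemma lin_ext_delta00:
  "lin_ext E (delta00 a) = (\<Sum>f\<in>keys a. lookup a f * \<i> * E ((\<lambda>x. \<i> * hamiltonian f x), f))"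
  unfolding delta00_def by (simp add: lin_ext_sum)

lemma symp_form_self: "symp_form f f = 0"
proof -
  have "cnj (f x) * f x = complex_of_real ((cmod (f x))\<^sup>2)" for x by (rule cnj_mult_self)
  then show ?thesis by (simp add: symp_form_def l2_inner_def integral_complex_of_real del: of_real_power)
qed

lemma integrable_l2_inner:
  fixes f g :: "real^'m::finite \<Rightarrow> complex"
  assumes f: "f \<in> schwartz" and g: "g \<in> schwartz" shows "integrable lborel (\<lambda>x. cnj (f x) * g x)"
proof -
  obtain C where C: "C \<ge> 0" "\<And>p. cmod (f p) \<le> C * decay_weight p" using schwartz_decay[OF f] by blast
  obtain D where D: "\<And>p. cmod (g p) \<le> D * decay_weight p" using schwartz_decay[OF g] by blast
  show ?thesis
    by (rule integrable_cnj_mult_of_decay[OF _ _ C(2) D C(1)]) (intro schwartz_measurable f g)+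
qed

lemma symp_form_add_left:
  assumes "f \<in> schwartz" "f' \<in> schwartz" "g \<in> schwartz"
  shows "symp_form (f + f') g = symp_form f g + symp_form f' g"
  unfolding symp_form_def l2_inner_def plus_fun_apply complex_cnj_add distrib_right
  by (simp add: Bochner_Integration.integral_add integrable_l2_inner assms)

section \<open>Regularity of the Gaussian states\<close>

context condensate
begin

sublocale state: classical_state "lin_ext \<phi>"
  by standard (rule phi_state)

text \<open>The characteristic function of the field along \<open>f\<close>: a centred Gaussian of
  variance \<open>B f f\<close>.\<close>

definition e :: "(real^'n \<Rightarrow> complex) \<Rightarrow> real \<Rightarrow> real" where
  "e f t = exp (- (t\<^sup>2 * B f f) / 2)"

lemma B_scaleR_diag: "B (\<lambda>x. t *\<^sub>R f x) (\<lambda>x. t *\<^sub>R f x) = t\<^sup>2 * B f f"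
  using B_scaleR_left[of t f "\<lambda>x. t *\<^sub>R f x"] B_scaleR_left[of t f f] B_commute[of f "\<lambda>x. t *\<^sub>R f x"]
  by (simp add: power2_eq_square)

lemma phi_scaleR: "\<phi> (\<lambda>x. t *\<^sub>R f x) = complex_of_real (e f t)"
  by (simp only: \<phi>_def e_def B_scaleR_diag)

lemma phi_scaleR_diff: "\<phi> (- (\<lambda>x. t *\<^sub>R f x) + (\<lambda>x. r *\<^sub>R f x)) = complex_of_real (e f (r - t))"
proof -
  have "- (\<lambda>x. t *\<^sub>R f x) + (\<lambda>x. r *\<^sub>R f x) = (\<lambda>x. (r - t) *\<^sub>R f x)"
    by (auto simp: fun_eq_iff scaleR_diff_left)
  then show ?thesis by (simp only: phi_scaleR)
qed

lemma e_minus: "e f (- t) = e f t" and e_zero: "e f 0 = 1" by (simp_all add: e_def)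

lemma n_weyl_diff:
  "state.n (W (\<lambda>x. t *\<^sub>R f x) - W (\<lambda>x. r *\<^sub>R f x)) = sqrt (2 - 2 * e f (t - r))"
proof -
  let ?f = "\<lambda>t x. t *\<^sub>R f x"
  have "weyl_star (W (?f t) - W (?f r)) * (W (?f t) - W (?f r)) =
     single (- ?f t + ?f t) 1 - single (- ?f t + ?f r) 1
     - single (- ?f r + ?f t) 1 + single (- ?f r + ?f r) 1"
    by (simp only: weyl_star_minus weyl_star_single left_diff_distrib right_diff_distrib mult_single complex_cnj_one mult_1) (simp only: diff_diff_eq2 diff_diff_eq add_ac diff_conv_add_uminus minus_add_distrib minus_minus)
  moreover have "lin_ext \<phi> (a - b - c + d) = lin_ext \<phi> a - lin_ext \<phi> b - lin_ext \<phi> c + lin_ext \<phi> d" for a b c d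
  proof -
    have m: "lin_ext \<phi> (a - b) = lin_ext \<phi> a - lin_ext \<phi> b" for a b
      using lin_ext_add[of \<phi> "a - b" b] by simp
    show ?thesis by (simp only: m lin_ext_add)
  qed
  ultimately have "lin_ext \<phi> (weyl_star (W (?f t) - W (?f r)) * (W (?f t) - W (?f r)))
    = complex_of_real (2 - 2 * e f (t - r))"
    using e_minus[of f "t - r"] by (simp only: lin_ext_single phi_scaleR_diff) (simp add: e_zero)
  then show ?thesis unfolding state.n_def by (simp only: Re_complex_of_real)
qed

lemma n_difference_quotients:
  fixes f :: "real^'n \<Rightarrow> complex"
  defines "E \<equiv> \<lambda>t. scal (1 / (\<i> * complex_of_real t)) * (W (\<lambda>x. t *\<^sub>R f x) - 1)"
  assumes t: "t \<noteq> 0" and r: "r \<noteq> 0"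
  shows "state.n (E t - E r) =
    sqrt ((2 - 2 * e f t) / t\<^sup>2 + (2 - 2 * e f r) / r\<^sup>2 - 2 * ((1 + e f (r - t) - e f t - e f r) / (t * r)))"
proof -
  let ?f = "\<lambda>t x. t *\<^sub>R f x"
  \<comment> \<open>Reciprocals as separate constants keep the expansion polynomial; division
    returns only at the end.\<close>
  define A where "A = 1 / t"
  define G where "G = 1 / r"
  \<comment> \<open>The constant term is written at the key \<open>?f 0\<close>, so that one
    expansion for three multiples of \<open>f\<close> yields all nine products.\<close>
  have E: "E t - E r = single (?f t) (- \<i> * complex_of_real A) + single (?f r) (\<i> * complex_of_real G)
       + single (?f 0) (\<i> * complex_of_real (A - G))"
  proof -
    have c: "1 / (\<i> * complex_of_real t) = - \<i> * complex_of_real A" "1 / (\<i> * complex_of_real r) = - \<i> * complex_of_real G"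
      by (simp_all add: A_def G_def divide_inverse)
    have z: "?f 0 = 0" by (simp add: fun_eq_iff)
    have "E t - E r = scal (- \<i> * complex_of_real A) * W (?f t) - scal (- \<i> * complex_of_real G) * W (?f r)
       + (scal (- \<i> * complex_of_real G) - scal (- \<i> * complex_of_real A))"
      unfolding E_def c by (simp add: algebra_simps)
    also have "scal (- \<i> * complex_of_real G) - scal (- \<i> * complex_of_real A) = single (?f 0) (\<i> * complex_of_real (A - G))"
      unfolding z single_diff[symmetric] by (simp add: algebra_simps)
    also have "scal (- \<i> * complex_of_real A) * W (?f t) = single (?f t) (- \<i> * complex_of_real A)"
      by (simp only: mult_single add_0 mult_1_right)
    also have "scal (- \<i> * complex_of_real G) * W (?f r) = - single (?f r) (\<i> * complex_of_real G)"
      unfolding single_uminus[symmetric] by (simp only: mult_single add_0 mult_1_right mult_minus_left)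
    finally show ?thesis by simp
  qed
  let ?c = "\<lambda>t r. complex_of_real (e f (r - t))"
  have lin: "lin_ext \<phi> (weyl_star (single (?f x) a + single (?f y) b + single (?f z) c) *
       (single (?f x) a + single (?f y) b + single (?f z) c)) =
     cnj a * a * ?c x x + cnj a * b * ?c x y + cnj a * c * ?c x z +
     (cnj b * a * ?c y x + cnj b * b * ?c y y + cnj b * c * ?c y z) +
     (cnj c * a * ?c z x + cnj c * b * ?c z y + cnj c * c * ?c z z)" for x y z a b c
    by (simp only: weyl_star_add weyl_star_single distrib_left distrib_right mult_single lin_ext_add lin_ext_single phi_scaleR_diff)
      (simp only: add_ac)
  have sym: "e f (t - r) = e f (r - t)" "e f (0 - t) = e f t" "e f (0 - r) = e f r" "e f (t - 0) = e f t" "e f (r - 0) = e f r"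
    using e_minus[of f "r - t"] e_minus[of f t] e_minus[of f r] by simp_all
  have "Re (lin_ext \<phi> (weyl_star (E t - E r) * (E t - E r))) =
     A\<^sup>2 * (2 - 2 * e f t) + G\<^sup>2 * (2 - 2 * e f r) - 2 * (A * G * (1 + e f (r - t) - e f t - e f r))"
    unfolding E lin sym by (simp add: e_zero) (simp add: power2_eq_square algebra_simps)
  also have "\<dots> = (2 - 2 * e f t) / t\<^sup>2 + (2 - 2 * e f r) / r\<^sup>2 - 2 * ((1 + e f (r - t) - e f t - e f r) / (t * r))"
    by (simp add: A_def G_def power_one_over)
  finally show ?thesis unfolding state.n_def by simp
qed

lemma class_C2_condensate: "class_C2 state.sx"
  unfolding class_C2_def
proof (intro ballI conjI)
  fix f :: "real^'n \<Rightarrow> complex" assume f: "f \<in> schwartz"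
  show "strongly_continuous W0 state.sx (\<lambda>t. weyl 0 (\<lambda>x. t *\<^sub>R f x))"
  proof (rule state.strongly_continuous_weyl[OF f])
    fix r
    have "((\<lambda>t. sqrt (2 - 2 * e f (t - r))) \<longlongrightarrow> sqrt (2 - 2 * exp (- ((r - r)\<^sup>2 * B f f) / 2))) (at r)"
      unfolding e_def by (intro tendsto_intros) auto
    then show "((\<lambda>t. state.n (W (\<lambda>x. t *\<^sub>R f x) - W (\<lambda>x. r *\<^sub>R f x))) \<longlongrightarrow> 0) (at r)"
      unfolding n_weyl_diff by simp
  qed
  show "gns_vector W0 state.sx \<in> generator_domain W0 state.sx (\<lambda>t. weyl 0 (\<lambda>x. t *\<^sub>R f x))"
  proof (rule state.gns_vector_in_generator_domain[OF f])
    fix \<epsilon> :: real assume \<epsilon>: "\<epsilon> > 0"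
    let ?h = "\<lambda>t r. (2 - 2 * e f t) / t\<^sup>2 + (2 - 2 * e f r) / r\<^sup>2 - 2 * ((1 + e f (r - t) - e f t - e f r) / (t * r))"
    have "((\<lambda>(t, r). ?h t r) \<longlongrightarrow> 0) (at 0 \<times>\<^sub>F at 0)"
      unfolding e_def by (rule gaussian_difference_quotients_tendsto)
    then have "\<forall>\<^sub>F z in at 0 \<times>\<^sub>F at 0. (case z of (t, r) \<Rightarrow> ?h t r) < \<epsilon>\<^sup>2"
      by (rule order_tendstoD(2)) (use \<epsilon> in simp)
    \<comment> \<open>The joint limit over pairs separates into a neighbourhood for each variable,
      which is the Cauchy condition required.\<close>
    then obtain P Q where PQ: "eventually P (at 0)" "eventually Q (at 0)" "\<And>t r. P t \<Longrightarrow> Q r \<Longrightarrow> ?h t r < \<epsilon>\<^sup>2"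
      unfolding eventually_prod_filter by auto
    obtain \<delta>1 where d1: "\<delta>1 > 0" "\<And>t. t \<noteq> 0 \<Longrightarrow> \<bar>t\<bar> < \<delta>1 \<Longrightarrow> P t"
      using PQ(1) unfolding eventually_at dist_real_def by auto
    obtain \<delta>2 where d2: "\<delta>2 > 0" "\<And>t. t \<noteq> 0 \<Longrightarrow> \<bar>t\<bar> < \<delta>2 \<Longrightarrow> Q t"
      using PQ(2) unfolding eventually_at dist_real_def by auto
    show "\<exists>\<delta>>0. \<forall>t r. 0 < \<bar>t\<bar> \<and> \<bar>t\<bar> < \<delta> \<and> 0 < \<bar>r\<bar> \<and> \<bar>r\<bar> < \<delta> \<longrightarrow>
         state.n (scal (1 / (\<i> * complex_of_real t)) * (W (\<lambda>x. t *\<^sub>R f x) - 1) -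
                  scal (1 / (\<i> * complex_of_real r)) * (W (\<lambda>x. r *\<^sub>R f x) - 1)) < \<epsilon>"
    proof (intro exI[of _ "min \<delta>1 \<delta>2"] conjI allI impI)
      show "0 < min \<delta>1 \<delta>2" using d1 d2 by simp
      fix t r assume tr: "0 < \<bar>t\<bar> \<and> \<bar>t\<bar> < min \<delta>1 \<delta>2 \<and> 0 < \<bar>r\<bar> \<and> \<bar>r\<bar> < min \<delta>1 \<delta>2"
      then have h: "?h t r < \<epsilon>\<^sup>2" by (intro PQ(3) d1 d2) auto
      show "state.n (scal (1 / (\<i> * complex_of_real t)) * (W (\<lambda>x. t *\<^sub>R f x) - 1) -
                  scal (1 / (\<i> * complex_of_real r)) * (W (\<lambda>x. r *\<^sub>R f x) - 1)) < \<epsilon>"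
        using n_difference_quotients[of t r f] tr real_less_lsqrt[OF less_imp_le[OF \<epsilon>] h] by simp
    qed
  qed
qed

section \<open>The weak KMS identity\<close>

lemma state_weyl: "f \<in> schwartz \<Longrightarrow> state.sx (weyl 0 f) = \<phi> f"
  unfolding weyl_def by (subst state.state_ext_incl) simp_all

lemma B_i_hamiltonian:
  assumes f: "f \<in> schwartz" and g: "g \<in> schwartz"
  shows "B g (\<lambda>x. \<i> * hamiltonian f x) = - symp_form g f / \<beta>"
proof -
  have Hf: "hamiltonian f \<in> schwartz" by (rule schwartz_hamiltonian[OF f])
  have int: "integrable lborel (\<lambda>p. cnj (fourier g p) * fourier f p)"
    by (rule integrable_cnj_fourier_mult[OF g f])
  \<comment> \<open>An integral is the transform at momentum 0, where the factor
    \<open>p \<bullet> p / 2\<close> vanishes.\<close>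
  have F0: "(LINT x|lborel. \<i> * hamiltonian f x) = 0"
    using fourier_hamiltonian[OF f, of 0] by (simp add: fourier_def)
  have [measurable]: "fourier f \<in> borel_measurable borel" "fourier g \<in> borel_measurable borel"
    "fourier (\<lambda>x. \<i> * hamiltonian f x) \<in> borel_measurable borel"
    by (intro measurable_fourier schwartz_measurable schwartz_cmult f g Hf)+
  \<comment> \<open>The identity holds only almost everywhere: at \<open>p = 0\<close> the weight is
    0 and cannot cancel the factor of \<open>H\<close>. One nonvanishing component already ensures
    that \<open>p\<close> is not 0.\<close>
  have "AE p in lborel. wt p * Re (cnj (fourier g p) * fourier (\<lambda>x. \<i> * hamiltonian f x) p) =
      - (1 / \<beta>) / (2 * pi) ^ CARD('n) * Im (cnj (fourier g p) * fourier f p)"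
    using AE_component_nonzero[of undefined]
  proof eventually_elim
    case (elim p)
    then have p: "p \<bullet> p \<noteq> 0" by (metis inner_eq_zero_iff zero_index)
    have "wt p * (p \<bullet> p / 2) = (1 / \<beta>) / (2 * pi) ^ CARD('n)"
      using p \<beta> by (simp add: wt_def field_simps)
    then have "wt p * ((p \<bullet> p / 2) * - Im (cnj (fourier g p) * fourier f p)) =
        (1 / \<beta>) / (2 * pi) ^ CARD('n) * - Im (cnj (fourier g p) * fourier f p)"
      by (simp only: mult.assoc[symmetric])
    moreover have "Re (cnj (fourier g p) * fourier (\<lambda>x. \<i> * hamiltonian f x) p) = (p \<bullet> p / 2) * - Im (cnj (fourier g p) * fourier f p)"
      unfolding fourier_cmult fourier_hamiltonian[OF f] by (simp add: field_simps)
    ultimately show ?case by (simp only:)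
  qed
  then have "(LINT p|lborel. wt p * Re (cnj (fourier g p) * fourier (\<lambda>x. \<i> * hamiltonian f x) p)) =
     (LINT p|lborel. - (1 / \<beta>) / (2 * pi) ^ CARD('n) * Im (cnj (fourier g p) * fourier f p))"
    by (intro integral_cong_AE) measurable
  also have "\<dots> = - (1 / \<beta>) / (2 * pi) ^ CARD('n) * Im (LINT p|lborel. cnj (fourier g p) * fourier f p)"
    using int by (simp only: integral_mult_right_zero integral_Im)
  also have "\<dots> = - (1 / \<beta>) * symp_form g f"
    unfolding plancherel[OF g f] symp_form_def by simp
  finally show ?thesis unfolding B_def F0 by simp
qed

text \<open>The exponent is a quadratic polynomial in \<open>t\<close> with linear coefficient
  \<open>- B F U\<close>.\<close>

lemma state_derivative:
  assumes F: "F \<in> schwartz" and U: "U \<in> schwartz"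
  shows "vector_derivative (\<lambda>t. state.sx (weyl 0 (F + (\<lambda>x. t *\<^sub>R U x)))) (at 0) = - complex_of_real (B F U) * \<phi> F"
proof (rule vector_derivative_at)
  have q: "B (F + (\<lambda>x. t *\<^sub>R U x)) (F + (\<lambda>x. t *\<^sub>R U x)) = B F F + 2 * (t * B F U) + t\<^sup>2 * B U U" for t
  proof -
    have "B F (\<lambda>x. t *\<^sub>R U x) = t * B F U"
      by (simp only: B_commute[of F "\<lambda>x. t *\<^sub>R U x"] B_scaleR_left B_commute[of U F])
    then show ?thesis by (simp only: B_add_diag[OF F schwartz_scaleR[OF U]] B_scaleR_diag)
  qed
  have eq: "(\<lambda>t. state.sx (weyl 0 (F + (\<lambda>x. t *\<^sub>R U x)))) = (\<lambda>t. complex_of_real (exp (- (B F F + 2 * (t * B F U) + t\<^sup>2 * B U U) / 2)))"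
    by (rule ext) (simp only: state_weyl[OF schwartz_add[OF F schwartz_scaleR[OF U]]] \<phi>_def q)
  have "((\<lambda>t. exp (- (B F F + 2 * (t * B F U) + t\<^sup>2 * B U U) / 2)) has_real_derivative - B F U * exp (- B F F / 2)) (at 0)"
    by (auto intro!: derivative_eq_intros)
  from has_vector_derivative_of_real[OF this]
  show "((\<lambda>t. state.sx (weyl 0 (F + (\<lambda>x. t *\<^sub>R U x)))) has_vector_derivative - complex_of_real (B F U) * \<phi> F) (at 0)"
    unfolding eq \<phi>_def by simp
qed

lemma weak_KMS_condensate: "weak_KMS \<beta> state.sx"
  unfolding weak_KMS_def
proof (intro conjI ballI class_C2_condensate)
  fix a b :: "'n weyl_poly" assume "a \<in> carrier classical_poly" "b \<in> carrier classical_poly"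
  then have ab: "a \<in> weyl_polys" "b \<in> weyl_polys" by simp_all
  then have k: "\<And>f. f \<in> keys a \<Longrightarrow> f \<in> schwartz" "\<And>f. f \<in> keys b \<Longrightarrow> f \<in> schwartz"
    by (auto simp: weyl_polys_def)
  have p: "poisson a b \<in> weyl_polys"
    unfolding poisson_def by (intro weyl_polys_sum weyl_polys_closed(3) schwartz_add k)
  have "state.sx (weyl_incl 0 (poisson a b)) = (\<Sum>f\<in>keys a. \<Sum>g\<in>keys b.
      lookup a f * lookup b g * complex_of_real (symp_form g f) * \<phi> (f + g))"
    unfolding state.state_ext_incl[OF p] by (simp only: poisson_def lin_ext_sum lin_ext_single)
  also have "\<dots> = (\<Sum>g\<in>keys b. \<Sum>f\<in>keys a.
      lookup a f * lookup b g * complex_of_real (symp_form g f) * \<phi> (f + g))"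
    by (rule sum.swap)
  also have "\<dots> = (\<Sum>g\<in>keys b. \<Sum>f\<in>keys a. complex_of_real \<beta> * (lookup b g *
      (lookup a f * \<i> * (- \<i> * vector_derivative (\<lambda>t. state.sx (weyl 0 (g + f + (\<lambda>x. t *\<^sub>R (\<i> * hamiltonian f x))))) (at 0)))))"
  proof (intro sum.cong refl)
    fix f g assume fg: "g \<in> keys b" "f \<in> keys a"
    note fs = k(1)[OF fg(2)] and gs = k(2)[OF fg(1)]
    \<comment> \<open>The contribution of \<open>f\<close> itself drops out because
      \<open>symp_form f f = 0\<close>.\<close>
    have "B (g + f) (\<lambda>x. \<i> * hamiltonian f x) = - symp_form g f / \<beta>"
      unfolding B_i_hamiltonian[OF fs schwartz_add[OF gs fs]] symp_form_add_left[OF gs fs fs] symp_form_self by simp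
    then have d: "vector_derivative (\<lambda>t. state.sx (weyl 0 (g + f + (\<lambda>x. t *\<^sub>R (\<i> * hamiltonian f x))))) (at 0)
       = complex_of_real (symp_form g f / \<beta>) * \<phi> (f + g)"
      unfolding state_derivative[OF schwartz_add[OF gs fs] schwartz_cmult[OF schwartz_hamiltonian[OF fs]]]
      by (simp add: add.commute)
    show "lookup a f * lookup b g * complex_of_real (symp_form g f) * \<phi> (f + g) =
      complex_of_real \<beta> * (lookup b g *
      (lookup a f * \<i> * (- \<i> * vector_derivative (\<lambda>t. state.sx (weyl 0 (g + f + (\<lambda>x. t *\<^sub>R (\<i> * hamiltonian f x))))) (at 0))))"
      unfolding d using \<beta> by (simp add: field_simps)
  qed
  also have "\<dots> = complex_of_real \<beta> * field_expectation state.sx (weyl_times_field b (delta00 a))"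
    unfolding field_expectation_eq lin_ext_weyl_times_field lin_ext_delta00 by (simp add: sum_distrib_left)
  finally show "state.sx (weyl_incl 0 (poisson a b)) = complex_of_real \<beta> * field_expectation state.sx (weyl_times_field b (delta00 a))" .
qed

end

section \<open>The classical limit\<close>

lemma bose_factor_tendsto:
  fixes E :: real
  assumes "\<beta> > 0" "E \<ge> 0"
  shows "((\<lambda>h. h * ((1 + exp (- \<beta> * h * E)) * inverse (1 - exp (- \<beta> * h * E)))) \<longlongrightarrow> 2 * inverse (\<beta> * E)) (at_right 0)"
proof (cases "E = 0")
  \<comment> \<open>At \<open>E = 0\<close> the function and its limit are 0, since
    \<open>inverse 0 = 0\<close>.\<close>
  case True
  then show ?thesis by simp
next
  case False
  then have bE: "\<beta> * E > 0" using assms by simp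
  have "((\<lambda>h. (exp (- (\<beta> * E) * h) - 1) / h) \<longlongrightarrow> - (\<beta> * E)) (at_right 0)"
    using exp_quotient_tendsto[of "- (\<beta> * E)"] by (rule tendsto_mono[OF at_le, rotated]) simp
  then have "((\<lambda>h. - inverse ((exp (- (\<beta> * E) * h) - 1) / h)) \<longlongrightarrow> - inverse (- (\<beta> * E))) (at_right 0)"
    by (intro tendsto_intros) (use bE in auto)
  moreover have "- inverse ((exp (- (\<beta> * E) * h) - 1) / h) = h * inverse (1 - exp (- \<beta> * h * E))" for h
  proof -
    have "- \<beta> * h * E = - (\<beta> * E) * h" by simp
    moreover have "- inverse ((x - 1) / h) = h * inverse (1 - x)" for x :: real
      by (simp add: inverse_eq_divide) (metis minus_diff_eq minus_divide_right)
    ultimately show ?thesis by (simp only:)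
  qed
  ultimately have 1: "((\<lambda>h. h * inverse (1 - exp (- \<beta> * h * E))) \<longlongrightarrow> inverse (\<beta> * E)) (at_right 0)"
    using bE by simp
  have "((\<lambda>h. (1 + exp (- \<beta> * h * E)) * (h * inverse (1 - exp (- \<beta> * h * E)))) \<longlongrightarrow> (1 + exp (- \<beta> * 0 * E)) * inverse (\<beta> * E)) (at_right 0)"
    by (intro tendsto_intros 1)
  then show ?thesis by (simp add: mult.left_commute)
qed

lemma bose_factor_bound:
  fixes E h :: real
  assumes "\<beta> > 0" "E \<ge> 0" "h > 0"
  shows "\<bar>h * ((1 + exp (- \<beta> * h * E)) * inverse (1 - exp (- \<beta> * h * E)))\<bar> \<le> h + 2 * inverse (\<beta> * E)"
proof (cases "E = 0")
  case True
  then show ?thesis using assms by simp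
next
  case False
  define s where "s = \<beta> * h * E"
  have s: "s > 0" using assms False by (simp add: s_def)
  have e: "exp (- s) < 1" using s by simp
  \<comment> \<open>After clearing denominators the bound on the hyperbolic cotangent is equivalent
    to \<open>(1 + s) exp (- s) \<le> 1\<close>.\<close>
  have "(1 + s) * exp (- s) \<le> exp s * exp (- s)"
    by (intro mult_right_mono exp_ge_add_one_self) simp
  then have "(1 + s) * exp (- s) \<le> 1" by (simp flip: exp_add)
  then have "s * (1 + exp (- s)) \<le> (s + 2) * (1 - exp (- s))" by (simp add: algebra_simps)
  then have "(1 + exp (- s)) / (1 - exp (- s)) \<le> (s + 2) / s"
    using s e by (simp add: divide_le_eq le_divide_eq mult.commute)
  then have "h * ((1 + exp (- s)) * inverse (1 - exp (- s))) \<le> h * ((s + 2) / s)"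
    using assms by (intro mult_left_mono) (auto simp: divide_inverse)
  also have "\<dots> = h + 2 * inverse (\<beta> * E)"
    using assms False by (simp add: s_def field_simps)
  finally have "h * ((1 + exp (- s)) * inverse (1 - exp (- s))) \<le> h + 2 * inverse (\<beta> * E)" .
  moreover have "0 \<le> h * ((1 + exp (- s)) * inverse (1 - exp (- s)))"
    using assms e by (intro mult_nonneg_nonneg) (auto simp: add_nonneg_nonneg)
  moreover have "- \<beta> * h * E = - s" by (simp add: s_def)
  ultimately show ?thesis by (simp only: abs_of_nonneg)
qed

lemma form_of_H_bose_tendsto:
  fixes f :: "real^'n::finite \<Rightarrow> complex"
  assumes dim: "CARD('n) \<ge> 3" and \<beta>: "\<beta> > 0" and f: "f \<in> schwartz"
  shows "((\<lambda>h. h * form_of_H (\<lambda>E. (1 + exp (- \<beta> * h * E)) * inverse (1 - exp (- \<beta> * h * E))) f)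
     \<longlongrightarrow> 2 * form_of_H (\<lambda>E. inverse (\<beta> * E)) f) (at_right 0)"
proof -
  \<comment> \<open>The instance with \<alpha> = 0 provides the weight \<open>wt\<close> and the
    integrability against it.\<close>
  interpret condensate "TYPE('n)" \<beta> 0 by standard (use assms in auto)
  let ?K = "(2 * pi) ^ CARD('n)"
  let ?F = "\<lambda>h E. (1 + exp (- \<beta> * h * E)) * inverse (1 - exp (- \<beta> * h * E))"
  let ?s = "\<lambda>h p::real^'n. h * ?F h (p \<bullet> p / 2) * ((cmod (fourier f p))\<^sup>2 / ?K)"
  let ?w = "\<lambda>p::real^'n. (cmod (fourier f p))\<^sup>2 / ?K + 2 * (wt p * Re (cnj (fourier f p) * fourier f p))"
  have [measurable]: "fourier f \<in> borel_measurable borel"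
    by (intro measurable_fourier schwartz_measurable f)
  have sq: "Re (cnj (fourier f p) * fourier f p) = (cmod (fourier f p))\<^sup>2" for p
    by (simp only: cnj_mult_self Re_complex_of_real)
  have "integrable lborel (\<lambda>p. (cmod (fourier f p))\<^sup>2)"
    using integrable_Re[OF integrable_cnj_fourier_mult[OF f f]] by (simp only: sq)
  then have w: "integrable lborel ?w"
    by (intro Bochner_Integration.integrable_add integrable_divide integrable_mult_right integrable_B f)
  \<comment> \<open>The limit at 0 from the right is taken as t \<rightarrow> \<infinity> with
    \<open>h = inverse t\<close>, which gives dominated convergence for a continuous
    parameter.\<close>
  have lim: "((\<lambda>t. LINT p|lborel. ?s (inverse t) p) \<longlongrightarrow> (LINT p|lborel. 2 * inverse (\<beta> * (p \<bullet> p / 2)) * ((cmod (fourier f p))\<^sup>2 / ?K))) at_top"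
  proof (rule integral_dominated_convergence_at_top[OF _ _ w])
    show "AE p in lborel. ((\<lambda>t. ?s (inverse t) p) \<longlongrightarrow> 2 * inverse (\<beta> * (p \<bullet> p / 2)) * ((cmod (fourier f p))\<^sup>2 / ?K)) at_top"
      by (intro always_eventually allI tendsto_mult_right bose_factor_tendsto[OF \<beta>, unfolded filterlim_at_right_to_top]) simp
    \<comment> \<open>For \<open>t \<ge> 1\<close> the summand \<open>h\<close> in
      \<open>bose_factor_bound\<close> is at most 1, so the dominating function does not depend on
      \<open>t\<close>.\<close>
    have "\<forall>\<^sub>F t::real in at_top. 1 \<le> t" by (rule eventually_ge_at_top)
    then show "\<forall>\<^sub>F t in at_top. AE p in lborel. norm (?s (inverse t) p) \<le> ?w p"
    proof eventually_elim
      case (elim t)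
      show ?case
      proof (intro always_eventually allI)
        fix p :: "real^'n"
        let ?c = "(cmod (fourier f p))\<^sup>2 / ?K"
        have c: "0 \<le> ?c" by simp
        have "norm (?s (inverse t) p) = \<bar>inverse t * ?F (inverse t) (p \<bullet> p / 2)\<bar> * ?c"
          by (simp only: real_norm_def abs_mult[of _ ?c] abs_of_nonneg[OF c])
        also have "\<dots> \<le> (inverse t + 2 * inverse (\<beta> * (p \<bullet> p / 2))) * ?c"
          by (intro mult_right_mono bose_factor_bound \<beta> c) (use elim in auto)
        also have "\<dots> \<le> (1 + 2 * inverse (\<beta> * (p \<bullet> p / 2))) * ?c"
          by (intro mult_right_mono add_right_mono c) (use elim in \<open>simp add: inverse_le_1_iff\<close>)
        also have "\<dots> = ?w p" unfolding sq wt_def distrib_right mult_1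
          by (simp only: times_divide_eq_left times_divide_eq_right mult.assoc)
        finally show "norm (?s (inverse t) p) \<le> ?w p" .
      qed
    qed
  qed measurable
  have e1: "(LINT p|lborel. ?s h p) = h * form_of_H (?F h) f" for h
    unfolding form_of_H_def integral_mult_right_zero[symmetric] by (simp only: mult.assoc times_divide_eq_right)
  have e2: "(LINT p|lborel. 2 * inverse (\<beta> * (p \<bullet> p / 2)) * ((cmod (fourier f p))\<^sup>2 / ?K)) = 2 * form_of_H (\<lambda>E. inverse (\<beta> * E)) f"
    unfolding form_of_H_def integral_mult_right_zero[symmetric] by (simp only: mult.assoc times_divide_eq_right)
  show ?thesis unfolding filterlim_at_right_to_top using lim unfolding e1 e2 .
qed

section \<open>Generators in the quantum Weyl algebras\<close>

lemma symp_form_uminus_self: "symp_form (- f) f = 0"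
  using symp_form_self[of f] by (simp add: symp_form_def l2_inner_def)

text \<open>The coefficient at 0 of a square is the sum of the squared moduli of the coefficients,
  since the phases there contain \<open>symp_form (- g) g = 0\<close>. This state exists for every
  \<open>h\<close> and makes the set of states nonempty.\<close>

lemma tracial_state: "is_state (weyl_poly_algebra h :: 'n::finite weyl_poly star_algebra) (\<lambda>a. lookup a 0)"
  unfolding is_state_def
proof (intro conjI ballI allI)
  fix a b :: "'n weyl_poly" and c
  let ?A = "weyl_poly_algebra h :: 'n weyl_poly star_algebra"
  show "lookup (a \<oplus>\<^bsub>?A\<^esub> b) 0 = lookup a 0 + lookup b 0"
    by (simp add: weyl_poly_algebra_def lookup_add)
  show "lookup (c \<odot>\<^bsub>?A\<^esub> a) 0 = c * lookup a 0"
    by (simp add: weyl_poly_algebra_def Poly_Mapping.map.rep_eq when_def)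
  show "lookup \<one>\<^bsub>?A\<^esub> 0 = 1" by (simp add: weyl_poly_algebra_def)
  have st: "star ?A = weyl_star" by (simp add: weyl_poly_algebra_def weyl_star_def fun_eq_iff)
  have mult: "x \<otimes>\<^bsub>?A\<^esub> y = (\<Sum>f\<in>keys x. \<Sum>g\<in>keys y. single (f + g)
      (lookup x f * lookup y g * exp (- \<i> / 2 * complex_of_real (h * symp_form f g))))" for x y
    by (simp add: weyl_poly_algebra_def)
  let ?m = "\<lambda>f g. lookup (weyl_star a) f * lookup a g * exp (- \<i> / 2 * complex_of_real (h * symp_form f g))"
  have "lookup (star ?A a \<otimes>\<^bsub>?A\<^esub> a) 0 =
      (\<Sum>f\<in>keys (weyl_star a). \<Sum>g\<in>keys a. if f = - g then ?m f g else 0)"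
    unfolding st mult lookup_sum lookup_single when_def add_eq_0_iff2 ..
  also have "\<dots> = (\<Sum>g\<in>keys a. \<Sum>f\<in>keys (weyl_star a). if f = - g then ?m f g else 0)"
    by (rule sum.swap)
  also have "\<dots> = (\<Sum>g\<in>keys a. complex_of_real ((cmod (lookup a g))\<^sup>2))"
  proof (intro sum.cong refl)
    fix g assume g: "g \<in> keys a"
    then have "- g \<in> keys (weyl_star a)" by (simp add: in_keys_iff lookup_weyl_star)
    then have "(\<Sum>f\<in>keys (weyl_star a). if f = - g then ?m f g else 0) = ?m (- g) g"
      by simp
    also have "\<dots> = complex_of_real ((cmod (lookup a g))\<^sup>2)"
      unfolding symp_form_uminus_self lookup_weyl_star by (simp add: cnj_mult_self[symmetric] del: of_real_power)
    finally show "(\<Sum>f\<in>keys (weyl_star a). if f = - g then ?m f g else 0) = complex_of_real ((cmod (lookup a g))\<^sup>2)" .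
  qed
  also have "\<dots> = complex_of_real (\<Sum>g\<in>keys a. (cmod (lookup a g))\<^sup>2)" by simp
  also have "\<dots> \<in> \<real>\<^sub>\<ge>\<^sub>0" by (simp only: nonneg_Reals_of_real_iff) (intro sum_nonneg zero_le_power2)
  finally show "lookup (star ?A a \<otimes>\<^bsub>?A\<^esub> a) 0 \<in> \<real>\<^sub>\<ge>\<^sub>0" .
qed

text \<open>Over an empty set of states the supremum would be unspecified; the tracial state
  excludes this.\<close>

lemma max_norm_weyl_zero: "max_norm (weyl_poly_algebra h :: 'n::finite weyl_poly star_algebra) 0 = 0"
proof -
  let ?A = "weyl_poly_algebra h :: 'n weyl_poly star_algebra"
  have z: "star ?A 0 \<otimes>\<^bsub>?A\<^esub> 0 = 0" by (simp add: weyl_poly_algebra_def)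
  have s0: "s 0 = 0" if s: "is_state ?A s" for s
  proof -
    have "0 \<in> carrier ?A" "0 \<oplus>\<^bsub>?A\<^esub> 0 = 0" by (simp_all add: weyl_poly_algebra_def)
    then have "s 0 = s 0 + s 0" using s unfolding is_state_def by metis
    then show ?thesis by simp
  qed
  have "max_norm ?A 0 = (SUP s\<in>{s. is_state ?A s}. 0)"
    unfolding max_norm_def z
  proof (intro SUP_cong[OF refl])
    fix s assume "s \<in> {s. is_state ?A s}"
    then have "s 0 = 0" by (intro s0) simp
    then show "sqrt (Re (s 0)) = 0" by simp
  qed
  also have "\<dots> = 0"
    by (rule cSUP_const) (use tracial_state[of h] in blast)
  finally show ?thesis .
qed

text \<open>Membership amounts to a constant sequence being Cauchy, that is, to the maximal norm
  vanishing at 0. It allows linearity of a state to be used on the scalar multiples of generators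
  that \<open>Q\<close> produces.\<close>

lemma weyl_in_carrier:
  fixes f :: "real^'n::finite \<Rightarrow> complex"
  assumes "f \<in> schwartz" shows "weyl h f \<in> carrier (weyl_algebra h)"
proof -
  let ?A = "weyl_poly_algebra h :: 'n weyl_poly star_algebra"
  have "alg_diff ?A (W f) (W f) = 0"
    by (simp add: alg_diff_def weyl_poly_algebra_def map_single single_add[symmetric])
  then have "(\<lambda>_. W f) \<in> cauchy_seqs ?A (max_norm ?A)"
    using assms max_norm_weyl_zero[of h, where 'n = 'n] by (simp add: cauchy_seqs_def weyl_poly_algebra_def)
  then show ?thesis
    by (simp add: weyl_algebra_def cstar_completion_def Let_def weyl_def weyl_incl_def compl_embed_def
        compl_carrier_def cauchy_class_def quotientI)
qed

section \<open>Convergence of states: from generators to the completion\<close>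

context classical_state
begin

lemma expansion: "a \<in> weyl_polys \<Longrightarrow> s a = (\<Sum>f\<in>keys a. lookup a f * s (W f))"
proof -
  assume a: "a \<in> weyl_polys"
  then have k: "f \<in> schwartz" if "f \<in> keys a" for f using that by (auto simp: weyl_polys_def)
  have "s a = s (\<Sum>f\<in>keys a. single f (lookup a f))"
    by (simp only: sum_single_lookup)
  also have "\<dots> = (\<Sum>f\<in>keys a. s (single f (lookup a f)))"
    by (intro sum weyl_polys_closed(3) k)
  also have "\<dots> = (\<Sum>f\<in>keys a. s (scal (lookup a f) * W f))"
    by (simp only: mult_single add_0 mult_1_right)
  also have "\<dots> = (\<Sum>f\<in>keys a. lookup a f * s (W f))"
    by (intro sum.cong refl scal weyl_polys_closed(3) k)
  finally show ?thesis .
qed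

text \<open>The index \<open>N\<close> depends on the sequence and on \<open>e\<close>, but not on
  the state. This uniformity is what carries the limit in \<open>h\<close> over to the
  completion.\<close>

lemma state_ext_near:
  assumes x: "x \<in> CS" and N: "\<forall>m\<ge>N. mnorm (x m - x N) < e"
  shows "cmod (sx (cls x) - s (x N)) \<le> e"
proof (rule LIMSEQ_le_const2)
  show "(\<lambda>m. cmod (s (x m) - s (x N))) \<longlonglongrightarrow> cmod (sx (cls x) - s (x N))"
    by (intro tendsto_norm tendsto_diff tendsto_const state_ext_tendsto x)
  show "\<exists>K. \<forall>m\<ge>K. cmod (s (x m) - s (x N)) \<le> e"
    using norm_diff_le[OF CS_polys[OF x] CS_polys[OF x]] N
    by (intro exI[of _ N] allI impI) (meson less_imp_le order_trans)
qed

end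

text \<open>Convergence on generators gives convergence on one approximating polynomial by
  linearity; the two remaining errors are bounded independently of \<open>h\<close>, all states
  being contractions.\<close>

lemma state_ext_tendsto_pointwise:
  fixes t :: "'a \<Rightarrow> 'n::finite weyl_poly \<Rightarrow> complex"
  assumes s: "is_state classical_poly s"
    and t: "\<forall>\<^sub>F h in F. is_state classical_poly (t h)"
    and lim: "\<And>f. f \<in> schwartz \<Longrightarrow> ((\<lambda>h. t h (W f)) \<longlongrightarrow> s (W f)) F"
    and X: "X \<in> carrier W0"
  shows "((\<lambda>h. state_ext (t h) X) \<longlongrightarrow> state_ext s X) F"
proof (rule tendstoI)
  fix e :: real assume e: "e > 0"
  obtain x where x: "x \<in> CS" "X = cls x" using X by (rule W0_carrierE)
  obtain N where N: "\<forall>m\<ge>N. mnorm (x m - x N) < e / 4" using CS_dist[OF x(1), of "e / 4"] e by auto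
  interpret S: classical_state s using s by (rule classical_state.intro)
  have a: "x N \<in> weyl_polys" by (rule CS_polys[OF x(1)])
  then have k: "f \<in> schwartz" if "f \<in> keys (x N)" for f using that by (auto simp: weyl_polys_def)
  have "((\<lambda>h. \<Sum>f\<in>keys (x N). lookup (x N) f * t h (W f)) \<longlongrightarrow> s (x N)) F"
    unfolding S.expansion[OF a] by (intro tendsto_sum tendsto_mult_left lim k)
  then have "\<forall>\<^sub>F h in F. dist (\<Sum>f\<in>keys (x N). lookup (x N) f * t h (W f)) (s (x N)) < e / 4"
    using e by (intro tendstoD) auto
  with t show "\<forall>\<^sub>F h in F. dist (state_ext (t h) X) (state_ext s X) < e"
  proof eventually_elim
    case (elim h)
    interpret T: classical_state "t h" using elim(1) by (rule classical_state.intro)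
    have "cmod (t h (x N) - s (x N)) < e / 4" using elim(2) unfolding T.expansion[OF a] dist_norm .
    moreover have "cmod (state_ext (t h) X - t h (x N)) \<le> e / 4" unfolding x by (rule T.state_ext_near[OF x(1) N])
    moreover have "cmod (state_ext s X - s (x N)) \<le> e / 4" unfolding x by (rule S.state_ext_near[OF x(1) N])
    moreover have "cmod (state_ext (t h) X - state_ext s X) \<le> cmod (state_ext (t h) X - t h (x N)) + cmod (t h (x N) - s (x N)) + cmod (state_ext s X - s (x N))"
      using norm_triangle_ineq4[of "state_ext (t h) X - t h (x N) + (t h (x N) - s (x N))" "state_ext s X - s (x N)"]
        norm_triangle_ineq[of "state_ext (t h) X - t h (x N)" "t h (x N) - s (x N)"] by simp
    ultimately show ?case unfolding dist_norm using e by linarith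
  qed
qed

text \<open>Positivity of the pullback holds because \<open>Q\<close> maps squares to squares, and
  normalization comes from its value on \<open>weyl 0 0\<close>. The two sides of the second claim
  agree on polynomials and are both continuous for the maximal norm.\<close>

lemma
  fixes Q :: "'n::finite weyl_elem \<Rightarrow> 'n weyl_elem"
  assumes \<omega>: "is_cstar_state (weyl_algebra h) \<omega>" and Q: "is_quantization h Q"
    and \<omega>1: "\<omega> (weyl h 0) = 1"
  shows quantized_state: "is_state classical_poly (\<lambda>a. \<omega> (Q (weyl_incl 0 a)))"
    and quantized_state_ext: "X \<in> carrier W0 \<Longrightarrow> state_ext (\<lambda>a. \<omega> (Q (weyl_incl 0 a))) X = \<omega> (Q X)"
proof -
  let ?A = "weyl_algebra h :: 'n weyl_elem normed_star_algebra"
  have st: "is_state ?A \<omega>" and bd: "\<And>a. a \<in> carrier ?A \<Longrightarrow> cmod (\<omega> a) \<le> anorm ?A a"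
    using \<omega> by (auto simp: is_cstar_state_def)
  have \<omega>add: "\<omega> (a \<oplus>\<^bsub>?A\<^esub> b) = \<omega> a + \<omega> b" if "a \<in> carrier ?A" "b \<in> carrier ?A" for a b
    using st that unfolding is_state_def by simp
  have \<omega>scal: "\<omega> (c \<odot>\<^bsub>?A\<^esub> a) = c * \<omega> a" if "a \<in> carrier ?A" for a c
    using st that unfolding is_state_def by simp
  have \<omega>pos: "\<omega> (star ?A a \<otimes>\<^bsub>?A\<^esub> a) \<in> \<real>\<^sub>\<ge>\<^sub>0" if "a \<in> carrier ?A" for a
    using st that unfolding is_state_def by simp
  have lin: "alg_linear W0 ?A Q" and pos: "alg_positive W0 ?A Q" and "alg_continuous W0 ?A Q"
    using Q by (auto simp: is_quantization_def)
  then obtain C where C: "\<And>a. a \<in> carrier W0 \<Longrightarrow> anorm ?A (Q a) \<le> C * anorm W0 a"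
    unfolding alg_continuous_def by metis
  have Qc: "Q a \<in> carrier ?A" if "a \<in> carrier W0" for a using lin that by (simp add: alg_linear_def)
  have Qadd: "Q (a \<oplus>\<^bsub>W0\<^esub> b) = Q a \<oplus>\<^bsub>?A\<^esub> Q b" if "a \<in> carrier W0" "b \<in> carrier W0" for a b
    using lin that by (simp add: alg_linear_def)
  have Qscal: "Q (c \<odot>\<^bsub>W0\<^esub> a) = c \<odot>\<^bsub>?A\<^esub> Q a" if "a \<in> carrier W0" for a c
    using lin that by (simp add: alg_linear_def)
  have ic: "weyl_incl 0 a \<in> carrier W0" if "a \<in> weyl_polys" for a
    unfolding weyl_incl_cls by (intro cls_carrier const_CS that)
  show state: "is_state classical_poly (\<lambda>a. \<omega> (Q (weyl_incl 0 a)))"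
    unfolding is_state_def
  proof (intro conjI ballI allI)
    fix a b :: "'n weyl_poly" and c
    assume "a \<in> carrier classical_poly"
    then have a: "a \<in> weyl_polys" by simp
    have "weyl_incl 0 (c \<odot>\<^bsub>classical_poly\<^esub> a) = c \<odot>\<^bsub>W0\<^esub> weyl_incl 0 a"
      unfolding weyl_incl_cls cls_scal[OF const_CS[OF a]] by simp
    then show "\<omega> (Q (weyl_incl 0 (c \<odot>\<^bsub>classical_poly\<^esub> a))) = c * \<omega> (Q (weyl_incl 0 a))"
      by (simp only: Qscal[OF ic[OF a]] \<omega>scal[OF Qc[OF ic[OF a]]])
    have "weyl_incl 0 (star classical_poly a \<otimes>\<^bsub>classical_poly\<^esub> a) = star W0 (weyl_incl 0 a) \<otimes>\<^bsub>W0\<^esub> weyl_incl 0 a"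
      unfolding weyl_incl_cls cls_star[OF const_CS[OF a]] cls_mult[OF const_CS[OF weyl_polys_closed(9)[OF a]] const_CS[OF a]] by simp
    moreover obtain y where "y \<in> carrier ?A" "Q (star W0 (weyl_incl 0 a) \<otimes>\<^bsub>W0\<^esub> weyl_incl 0 a) = star ?A y \<otimes>\<^bsub>?A\<^esub> y"
      using pos ic[OF a] unfolding alg_positive_def by metis
    ultimately show "\<omega> (Q (weyl_incl 0 (star classical_poly a \<otimes>\<^bsub>classical_poly\<^esub> a))) \<in> \<real>\<^sub>\<ge>\<^sub>0"
      using \<omega>pos[of y] by (simp only:)
    assume "b \<in> carrier classical_poly"
    then have b: "b \<in> weyl_polys" by simp
    have "weyl_incl 0 (a \<oplus>\<^bsub>classical_poly\<^esub> b) = weyl_incl 0 a \<oplus>\<^bsub>W0\<^esub> weyl_incl 0 b"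
      unfolding weyl_incl_cls cls_add[OF const_CS[OF a] const_CS[OF b]] by simp
    then show "\<omega> (Q (weyl_incl 0 (a \<oplus>\<^bsub>classical_poly\<^esub> b))) = \<omega> (Q (weyl_incl 0 a)) + \<omega> (Q (weyl_incl 0 b))"
      by (simp only: Qadd[OF ic[OF a] ic[OF b]] \<omega>add[OF Qc[OF ic[OF a]] Qc[OF ic[OF b]]])
  next
    have "weyl_incl 0 \<one>\<^bsub>classical_poly\<^esub> = weyl 0 (0 :: real^'n \<Rightarrow> complex)" by (simp add: weyl_def)
    moreover have "Q (weyl 0 0) = complex_of_real (exp (- h / 4 * (l2_norm (0 :: real^'n \<Rightarrow> complex))\<^sup>2)) \<odot>\<^bsub>?A\<^esub> weyl h 0"
      using Q schwartz_zero unfolding is_quantization_def by blast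
    moreover have "l2_norm (0 :: real^'n \<Rightarrow> complex) = 0" by (simp add: l2_norm_def)
    ultimately show "\<omega> (Q (weyl_incl 0 \<one>\<^bsub>classical_poly\<^esub>)) = 1"
      using \<omega>scal[OF weyl_in_carrier[OF schwartz_zero]] \<omega>1 by simp
  qed
  interpret T: classical_state "\<lambda>a. \<omega> (Q (weyl_incl 0 a))" using state by (rule classical_state.intro)
  show "state_ext (\<lambda>a. \<omega> (Q (weyl_incl 0 a))) X = \<omega> (Q X)" if X: "X \<in> carrier W0"
  proof -
    obtain x where x: "x \<in> CS" "X = cls x" using X by (rule W0_carrierE)
    have p: "x k \<in> weyl_polys" for k by (rule CS_polys[OF x(1)])
    \<comment> \<open>Continuity of \<open>Q\<close> with constant \<open>C\<close>, combined with
      contractivity of \<open>\<omega>\<close>.\<close>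
    have diff: "cmod (\<omega> (Q (weyl_incl 0 (x k))) - \<omega> (Q X)) \<le> C * anorm W0 (alg_diff W0 (weyl_incl 0 (x k)) X)" for k
    proof -
      have m: "(-1) \<odot>\<^bsub>W0\<^esub> X \<in> carrier W0" unfolding x cls_scal[OF x(1)] by (intro cls_carrier CS_scal x)
      have c: "alg_diff W0 (weyl_incl 0 (x k)) X \<in> carrier W0"
        unfolding x weyl_incl_cls cls_diff[OF const_CS[OF p] x(1)] by (intro cls_carrier CS_diff const_CS p x)
      have "\<omega> (Q (alg_diff W0 (weyl_incl 0 (x k)) X)) = \<omega> (Q (weyl_incl 0 (x k))) - \<omega> (Q X)"
      proof -
        have "\<omega> (Q (alg_diff W0 (weyl_incl 0 (x k)) X)) = \<omega> (Q (weyl_incl 0 (x k))) + \<omega> (Q ((-1) \<odot>\<^bsub>W0\<^esub> X))"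
          by (simp only: alg_diff_def Qadd[OF ic[OF p] m] \<omega>add[OF Qc[OF ic[OF p]] Qc[OF m]])
        moreover have "\<omega> (Q ((-1) \<odot>\<^bsub>W0\<^esub> X)) = (-1) * \<omega> (Q X)"
          by (simp only: Qscal[OF X] \<omega>scal[OF Qc[OF X]])
        ultimately show ?thesis by simp
      qed
      then show ?thesis using order_trans[OF bd[OF Qc[OF c]] C[OF c]] by (simp only:)
    qed
    \<comment> \<open>A Cauchy sequence of polynomials converges to its own class in the norm of the
      completion.\<close>
    have "(\<lambda>k. anorm W0 (alg_diff W0 (weyl_incl 0 (x k)) X)) \<longlonglongrightarrow> 0"
    proof (rule LIMSEQ_I)
      fix e :: real assume e: "e > 0"
      then have "e / 2 > 0" by simp
      then obtain N where N: "\<forall>m\<ge>N. \<forall>k\<ge>N. mnorm (x m - x k) < e / 2" using CS_dist[OF x(1)] by blast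
      have "norm (anorm W0 (alg_diff W0 (weyl_incl 0 (x k)) X) - 0) < e" if "k \<ge> N" for k
      proof -
        have lim: "(\<lambda>m. mnorm (x k - x m)) \<longlonglongrightarrow> anorm W0 (alg_diff W0 (weyl_incl 0 (x k)) X)"
          unfolding x weyl_incl_cls cls_diff[OF const_CS[OF p] x(1)] by (intro anorm_cls CS_diff const_CS p x)
        have "anorm W0 (alg_diff W0 (weyl_incl 0 (x k)) X) \<le> e / 2"
          by (rule LIMSEQ_le_const2[OF lim]) (use N that in \<open>auto intro!: less_imp_le\<close>)
        moreover have "0 \<le> anorm W0 (alg_diff W0 (weyl_incl 0 (x k)) X)"
          by (rule LIMSEQ_le_const[OF lim]) (auto intro!: max_norm_nonneg p)
        ultimately show ?thesis using e by simp
      qed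
      then show "\<exists>N. \<forall>k\<ge>N. norm (anorm W0 (alg_diff W0 (weyl_incl 0 (x k)) X) - 0) < e" by blast
    qed
    from tendsto_mult_left[OF this, of C]
    have "(\<lambda>k. \<omega> (Q (weyl_incl 0 (x k))) - \<omega> (Q X)) \<longlonglongrightarrow> 0"
      by (intro Lim_null_comparison[OF always_eventually[OF allI[OF diff]]]) simp
    then have "(\<lambda>k. \<omega> (Q (weyl_incl 0 (x k)))) \<longlonglongrightarrow> \<omega> (Q X)" by (rule LIM_zero_cancel)
    then show ?thesis unfolding x by (rule T.state_ext_eqI[OF x(1)])
  qed
qed

theorem theorem4p13:
  fixes \<beta> \<alpha> :: real
    and \<rho> :: "real \<Rightarrow> real"
    and \<omega> :: "real \<Rightarrow> 'n::finite weyl_elem \<Rightarrow> complex"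
    and Q :: "real \<Rightarrow> 'n weyl_elem \<Rightarrow> 'n weyl_elem"
  assumes "CARD('n) \<ge> 3"
    and "\<beta> > 0"
    and "\<forall>h>0. \<rho> h > critical_density TYPE('n) (\<beta> * h)"
    and "\<alpha> \<ge> 0"
    and "((\<lambda>h. h * (\<rho> h - critical_density TYPE('n) (\<beta> * h))) \<longlongrightarrow> \<alpha>) (at_right 0)"
    and "\<forall>h>0. is_cstar_state (weyl_algebra h) (\<omega> h)"
    and "\<forall>h>0. \<forall>f\<in>schwartz. \<omega> h (weyl h f) =
           complex_of_real (exp (- (h / 4) *
             (form_of_H (\<lambda>E. (1 + exp (- \<beta> * h * E)) * inverse (1 - exp (- \<beta> * h * E))) f
              + 2 ^ (CARD('n) + 1) * (\<rho> h - critical_density TYPE('n) (\<beta> * h))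
                * (cmod (LINT x|lborel. f x))\<^sup>2)))"
    and "\<forall>h>0. is_quantization h (Q h)"
  shows "\<exists>\<omega>0 :: real \<Rightarrow> 'n weyl_elem \<Rightarrow> complex.
    (\<forall>a\<ge>0. is_cstar_state (weyl_algebra 0) (\<omega>0 a) \<and>
       (\<forall>f\<in>schwartz. \<omega>0 a (weyl 0 f) =
          complex_of_real (exp (- (1 / 2) *
            (form_of_H (\<lambda>E. inverse (\<beta> * E)) f
             + 2 ^ CARD('n) * a * (cmod (LINT x|lborel. f x))\<^sup>2)))) \<and>
       weak_KMS \<beta> (\<omega>0 a)) \<and>
    (\<forall>a\<ge>0. \<forall>b\<ge>0. a \<noteq> b \<longrightarrow> (\<exists>c\<in>carrier (weyl_algebra 0). \<omega>0 a c \<noteq> \<omega>0 b c)) \<and>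
    (\<forall>c\<in>carrier (weyl_algebra 0). ((\<lambda>h. \<omega> h (Q h c)) \<longlongrightarrow> \<omega>0 \<alpha> c) (at_right 0))"
proof -
  \<comment> \<open>Defined for every real \<open>a\<close>, so that a single family
    \<open>\<omega>0\<close> can be exhibited; the locale covers \<open>a \<ge> 0\<close>
    only.\<close>
  define v where "v = (\<lambda>a (f :: real^'n \<Rightarrow> complex). form_of_H (\<lambda>E. inverse (\<beta> * E)) f + 2 ^ CARD('n) * a * (cmod (LINT x|lborel. f x))\<^sup>2)"
  define \<omega>0 where "\<omega>0 = (\<lambda>a. state_ext (lin_ext (\<lambda>f :: real^'n \<Rightarrow> complex. complex_of_real (exp (- v a f / 2)))))"
  have cond: "condensate TYPE('n) \<beta> a" if "a \<ge> 0" for a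
    using assms(1,2) that by (rule condensate.intro)
  have phi: "condensate.\<phi> \<beta> a = (\<lambda>f :: real^'n \<Rightarrow> complex. complex_of_real (exp (- v a f / 2)))" if "a \<ge> 0" for a
    by (rule ext) (simp only: condensate.\<phi>_def[OF cond[OF that]] condensate.B_diag[OF cond[OF that]] v_def)
  have state: "is_state classical_poly (lin_ext (\<lambda>f :: real^'n \<Rightarrow> complex. complex_of_real (exp (- v a f / 2))))" if "a \<ge> 0" for a
    using condensate.phi_state[OF cond[OF that]] unfolding phi[OF that] .
  have weyl0: "\<omega>0 a (weyl 0 f) = complex_of_real (exp (- v a f / 2))" if "a \<ge> 0" "f \<in> schwartz" for a f
    using condensate.state_weyl[OF cond[OF that(1)] that(2)] unfolding phi[OF that(1)] \<omega>0_def .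
  have 1: "is_cstar_state (weyl_algebra 0) (\<omega>0 a)" if "a \<ge> 0" for a
    unfolding \<omega>0_def by (rule classical_state.state_ext_is_state[OF classical_state.intro[OF state[OF that]]])
  have 2: "weak_KMS \<beta> (\<omega>0 a)" if "a \<ge> 0" for a
    using condensate.weak_KMS_condensate[OF cond[OF that]] unfolding phi[OF that] \<omega>0_def .
  \<comment> \<open>On a test function with nonzero integral the exponent is injective in
    \<open>a\<close>.\<close>
  have 3: "\<exists>c\<in>carrier (weyl_algebra 0). \<omega>0 a c \<noteq> \<omega>0 b c" if ab: "a \<ge> 0" "b \<ge> 0" "a \<noteq> b" for a b
  proof
    let ?g = "\<lambda>x :: real^'n. complex_of_real (gaussian x)"
    show "weyl 0 ?g \<in> carrier W0" by (intro weyl_in_carrier gaussian_schwartz)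
    have "(LINT x|lborel. ?g x) \<noteq> 0"
      unfolding integral_complex_of_real integral_gaussian by simp
    then show "\<omega>0 a (weyl 0 ?g) \<noteq> \<omega>0 b (weyl 0 ?g)"
      unfolding weyl0[OF ab(1) gaussian_schwartz] weyl0[OF ab(2) gaussian_schwartz] v_def using ab(3) by simp
  qed
  have 4: "((\<lambda>h. \<omega> h (Q h c)) \<longlongrightarrow> \<omega>0 \<alpha> c) (at_right 0)" if c: "c \<in> carrier (weyl_algebra 0)" for c
  proof -
    have one: "\<omega> h (weyl h 0) = 1" if "h > 0" for h
    proof -
      have "form_of_H F (0 :: real^'n \<Rightarrow> complex) = 0" for F by (simp add: form_of_H_def fourier_def)
      moreover have "(LINT x|lborel. (0 :: real^'n \<Rightarrow> complex) x) = 0" by simp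
      ultimately show ?thesis using assms(7)[rule_format, OF that schwartz_zero] by (simp only:) simp
    qed
    have pos: "\<forall>\<^sub>F h::real in at_right 0. h > 0" by (rule eventually_at_right_less)
    have "((\<lambda>h. state_ext (\<lambda>a. \<omega> h (Q h (weyl_incl 0 a))) c) \<longlongrightarrow> \<omega>0 \<alpha> c) (at_right 0)"
      unfolding \<omega>0_def
    proof (rule state_ext_tendsto_pointwise[OF state[OF assms(4)] _ _ c])
      show "\<forall>\<^sub>F h in at_right 0. is_state classical_poly (\<lambda>a. \<omega> h (Q h (weyl_incl 0 a)))"
        using pos by eventually_elim (use assms(6,8) one in \<open>auto intro!: quantized_state\<close>)
      fix f :: "real^'n \<Rightarrow> complex" assume f: "f \<in> schwartz"
      let ?d = "\<lambda>h. \<rho> h - critical_density TYPE('n) (\<beta> * h)"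
      let ?F = "cmod (LINT x|lborel. f x)"
      let ?E = "\<lambda>h. form_of_H (\<lambda>E. (1 + exp (- \<beta> * h * E)) * inverse (1 - exp (- \<beta> * h * E))) f"
      \<comment> \<open>\<open>h\<close> is moved inside so that the two expressions with known
        limits, \<open>h * ?E h\<close> and \<open>h * ?d h\<close>, appear; the constant is
        \<open>2 ^ (n + 1) / 4 = 2 ^ n / 2\<close> with \<open>n = CARD('n)\<close>. The first
        exponential is the damping factor of \<open>Q h\<close>, which tends to 1.\<close>
      have eq: "\<omega> h (Q h (weyl_incl 0 (W f))) =
         complex_of_real (exp (- h / 4 * (l2_norm f)\<^sup>2) * exp (- (1 / 4 * (h * ?E h) + 2 ^ CARD('n) / 2 * (h * ?d h) * ?F\<^sup>2)))" if h: "h > 0" for h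
      proof -
        have "Q h (weyl 0 f) = complex_of_real (exp (- h / 4 * (l2_norm f)\<^sup>2)) \<odot>\<^bsub>weyl_algebra h\<^esub> weyl h f"
          using assms(8) h f unfolding is_quantization_def by blast
        moreover have "is_state (weyl_algebra h) (\<omega> h)" using assms(6) h by (simp add: is_cstar_state_def)
        ultimately have "\<omega> h (Q h (weyl 0 f)) = complex_of_real (exp (- h / 4 * (l2_norm f)\<^sup>2)) * \<omega> h (weyl h f)"
          using weyl_in_carrier[OF f] unfolding is_state_def by simp
        moreover have "\<omega> h (weyl h f) = complex_of_real (exp (- (1 / 4 * (h * ?E h) + 2 ^ CARD('n) / 2 * (h * ?d h) * ?F\<^sup>2)))"
        proof -
          have "\<omega> h (weyl h f) = complex_of_real (exp (- (h / 4) * (?E h + 2 ^ (CARD('n) + 1) * ?d h * ?F\<^sup>2)))"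
            using assms(7) h f by blast
          also have "- (h / 4) * (?E h + 2 ^ (CARD('n) + 1) * ?d h * ?F\<^sup>2) = - (1 / 4 * (h * ?E h) + 2 ^ CARD('n) / 2 * (h * ?d h) * ?F\<^sup>2)"
            by (simp add: algebra_simps)
          finally show ?thesis .
        qed
        ultimately show ?thesis by (simp only: weyl_def of_real_mult)
      qed
      have "((\<lambda>h. complex_of_real (exp (- h / 4 * (l2_norm f)\<^sup>2) * exp (- (1 / 4 * (h * ?E h) + 2 ^ CARD('n) / 2 * (h * ?d h) * ?F\<^sup>2))))
         \<longlongrightarrow> complex_of_real (exp (- 0 / 4 * (l2_norm f)\<^sup>2) * exp (- (1 / 4 * (2 * form_of_H (\<lambda>E. inverse (\<beta> * E)) f) + 2 ^ CARD('n) / 2 * \<alpha> * ?F\<^sup>2)))) (at_right 0)"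
        by (intro tendsto_intros form_of_H_bose_tendsto assms(1,2,5) f) auto
      moreover have "exp (- 0 / 4 * (l2_norm f)\<^sup>2) * exp (- (1 / 4 * (2 * form_of_H (\<lambda>E. inverse (\<beta> * E)) f) + 2 ^ CARD('n) / 2 * \<alpha> * ?F\<^sup>2)) = exp (- v \<alpha> f / 2)"
        unfolding v_def by (simp add: field_simps)
      ultimately have "((\<lambda>h. complex_of_real (exp (- h / 4 * (l2_norm f)\<^sup>2) * exp (- (1 / 4 * (h * ?E h) + 2 ^ CARD('n) / 2 * (h * ?d h) * ?F\<^sup>2))))
         \<longlongrightarrow> lin_ext (\<lambda>f. complex_of_real (exp (- v \<alpha> f / 2))) (W f)) (at_right 0)" by simp
      then show "((\<lambda>h. \<omega> h (Q h (weyl_incl 0 (W f)))) \<longlongrightarrow> lin_ext (\<lambda>f. complex_of_real (exp (- v \<alpha> f / 2))) (W f)) (at_right 0)"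
        by (rule Lim_transform_eventually) (use pos in eventually_elim, simp only: eq)
    qed
    then show ?thesis
      by (rule Lim_transform_eventually)
        (use pos in eventually_elim, use assms(6,8) one c in \<open>auto intro!: quantized_state_ext\<close>)
  qed
  have 5: "\<omega>0 a (weyl 0 f) = complex_of_real (exp (- (1 / 2) * (form_of_H (\<lambda>E. inverse (\<beta> * E)) f
             + 2 ^ CARD('n) * a * (cmod (LINT x|lborel. f x))\<^sup>2)))" if "a \<ge> 0" "f \<in> schwartz" for a f
  proof -
    have "- v a f / 2 = - (1 / 2) * v a f" by simp
    then show ?thesis unfolding weyl0[OF that] by (simp only: v_def)
  qed
  show ?thesis
    by (intro exI[of _ \<omega>0] conjI allI impI ballI 1 2 3 4 5)
qed

end
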